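(* Let $D$ be a connected highly arc-transitive digraph such that (i) for every vertex $u$ of $D$, the subdigraph induced on $\mathrm{desc}(u)$ is a tree and $2 \le \mathrm{outdegree}(u) \le \aleph_0$; and dually, for every vertex $u$ of $D$, the subdigraph induced on $\mathrm{anc}(u)$ is a tree and $2 \le \mathrm{indegree}(u) \le \aleph_0$; (ii) $D$ has the intersection property; (iii) $D$ is strongly transitive. Then there is a countable connected $3$-$CS$-homogeneous $2$-level partial order $M$ such that $M^+ \setminus M \cong D$ (where $M^+\setminus M$ is regarded as the digraph $D(M^+\setminus M)$). Conversely, let $\Gamma$ be a countable connected locally $2$-arc-transitive bipartite graph, and let $M = P(\Gamma)$ be $\Gamma$ viewed as a $2$-level partial order. If the interval $I(M)$ is isomorphic to $1 + \mathbb{Z} + 1$, then the digraph $D(M^+ \setminus M)$ naturally defined from the partial order $M^+\setminus M$ is a connected highly arc-transitive digraph satisfying properties (i) and (ii). Furthermore, if $D(M^+\setminus M)$ is locally finite then $D(M^+\setminus M)$ satisfies (iii).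
   Context: Digraphs. A digraph has an irreflexive asymmetric edge relation $\to$. It is connected if its underlying graph is connected, and locally finite if all in- and out-degrees are finite. An $s$-arc is a sequence $(v_0,\dots,v_s)$ with $v_i\to v_{i+1}$ for all $i<s$; $D$ is $s$-arc-transitive if $\mathrm{Aut}(D)$ is transitive on $s$-arcs, and highly arc-transitive if it is $s$-arc-transitive for all $s\ge 1$. $\mathrm{desc}(u)$ is the set of vertices $v$ such that there is a directed path (possibly of length $0$) from $u$ to $v$; $\mathrm{anc}(u)$ is the set of vertices of which $u$ is a descendant. A digraph is called a tree if its underlying graph is a tree. $D$ has the intersection property if for all $x,y\in D$ with $\mathrm{desc}(x)\cap\mathrm{desc}(y)\neq\varnothing$ there is $z\in\mathrm{desc}(x)\cap\mathrm{desc}(y)$ with $\mathrm{desc}(x)\cap\mathrm{desc}(y)=\mathrm{desc}(z)$. A directed line is a set $(x_i)_{i\in\mathbb Z}$ indexed by $\mathbb Z$ such that each $(x_i,x_{i+1})$ is an edge. A $Y$-configuration in a digraph $D$ is the digraph which is the amalgam of two infinite directed lines $(x_i)_{i\in\mathbb Z}$ and $(y_i)_{i\in\mathbb Z}$ amalgamated via the rule $x_i=y_i$ for all $i\ge 0$; dually, a $\overline{Y}$-configuration is obtained by amalgamating via the rule $x_i=y_i$ for all $i\le 0$. $D$ is strongly transitive if its automorphism group acts transitively on the family of $Y$-configurations, and also on the family of $\overline{Y}$-configurations. Posets. For a poset $M$ and $A\subseteq M$, $A^\uparrow$ and $A^\downarrow$ are the sets of upper and lower bounds of $A$ in $M$,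 and $A^{\uparrow\downarrow}=(A^\uparrow)^\downarrow$. An ideal of $M$ is a non-empty, bounded above $J\subseteq M$ with $J=J^{\uparrow\downarrow}$. The Dedekind–MacNeille completion $M^D$ is the set of ideals ordered by inclusion, with $a\in M$ identified with $\{x\in M:x\le a\}$. A point $x\in M^D$ is an upward (downward) ramification point of $M$ if $x=a\wedge b$ ($x=a\vee b$), computed in $M^D$, for some incomparable $a,b\in M$. $\mathrm{Ram}(M)$ is the set of all upward and downward ramification points, and $M^+=M\cup\mathrm{Ram}(M)\subseteq M^D$. A $2$-level partial order is one all of whose maximal chains have exactly two elements. A bipartite graph $\Gamma$ with parts $X,Y$ is viewed as a $2$-level partial order $P(\Gamma)$ with minimal points $X$ and maximal points $Y$ by putting $x<y$ iff $x\in X$, $y\in Y$ are adjacent; a $2$-level order is connected if the corresponding graph is. $\Gamma$ is locally $s$-arc-transitive if for each vertex $v$ the stabilizer of $v$ in $\mathrm{Aut}(\Gamma)$ is transitive on the $s$-arcs starting at $v$ (an $s$-arc in a graph being $(v_0,\dots,v_s)$ with $v_i$ adjacent to $v_{i+1}$ and $v_i\ne v_{i+2}$). The interval $I(M)$ is the common isomorphism type of the posets $[x,y]^{M^D}=\{z\in M^D:x\le z\le y\}$ for $x\in X$, $y\in Y$, $x<y$. $1+\mathbb Z+1$ is the chain $\mathbb Z$ with a least and a greatest point added. $M$ is $3$-$CS$-homogeneous if every isomorphism between connected $3$-element (induced) substructures of $M$ extends to an automorphism of $M$. $D(M^+\setminus M)$ is the digraph on $M^+\setminus M$ whose edges are the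 pairs $(x,y)$ such that $x>y$ with no points in between. *)

theory Defs
  imports Main "HOL-Library.Countable_Set" "HOL-Library.Extended"
begin

text \<open>
  A (di)graph is a vertex set together with an edge relation on it. A graph is given by its
  symmetric adjacency relation. A poset is given by its reflexive order relation \<open>r\<close> alone,
  its carrier being \<open>Field r\<close>; the library notions \<open>Partial_order\<close>, \<open>Above\<close> (upper bounds),
  \<open>Under\<close> (lower bounds) and \<open>under\<close> (principal ideal) are used for it.
\<close>

section \<open>Relational structures\<close>

text \<open>Isomorphism of two sets with a binary relation; values of \<open>f\<close> outside \<open>A\<close> are irrelevant.\<close>

definition rel_iso :: "'a set \<Rightarrow> 'a rel \<Rightarrow> 'b set \<Rightarrow> 'b rel \<Rightarrow> ('a \<Rightarrow> 'b) \<Rightarrow> bool" where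
  "rel_iso A R B S f \<longleftrightarrow>
     bij_betw f A B \<and> (\<forall>x\<in>A. \<forall>y\<in>A. (x, y) \<in> R \<longleftrightarrow> (f x, f y) \<in> S)"

abbreviation rel_aut :: "'a set \<Rightarrow> 'a rel \<Rightarrow> ('a \<Rightarrow> 'a) \<Rightarrow> bool" where
  "rel_aut A R f \<equiv> rel_iso A R A R f"

text \<open>
  Connectedness of the underlying graph, for a relation \<open>R\<close> on \<open>V\<close>. The empty structure does not
  count as connected.
\<close>

definition connected_on :: "'a set \<Rightarrow> 'a rel \<Rightarrow> bool" where
  "connected_on V R \<longleftrightarrow> V \<noteq> {} \<and> (\<forall>u\<in>V. \<forall>v\<in>V. (u, v) \<in> (R \<union> R\<inverse>)\<^sup>*)"

section \<open>Digraphs\<close>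

definition is_digraph :: "'a set \<Rightarrow> 'a rel \<Rightarrow> bool" where
  "is_digraph V E \<longleftrightarrow> E \<subseteq> V \<times> V \<and> irrefl E \<and> asym E"

definition digraph_arc :: "'a set \<Rightarrow> 'a rel \<Rightarrow> nat \<Rightarrow> 'a list \<Rightarrow> bool" where
  "digraph_arc V E s p \<longleftrightarrow>
     length p = s + 1 \<and> set p \<subseteq> V \<and> (\<forall>i<s. (p ! i, p ! (i + 1)) \<in> E)"

definition arc_transitive :: "'a set \<Rightarrow> 'a rel \<Rightarrow> nat \<Rightarrow> bool" where
  "arc_transitive V E s \<longleftrightarrow>
     (\<forall>p q. digraph_arc V E s p \<and> digraph_arc V E s q \<longrightarrow> (\<exists>f. rel_aut V E f \<and> map f p = q))"

definition highly_arc_transitive :: "'a set \<Rightarrow> 'a rel \<Rightarrow> bool" where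
  "highly_arc_transitive V E \<longleftrightarrow> (\<forall>s\<ge>1. arc_transitive V E s)"

definition locally_finite :: "'a set \<Rightarrow> 'a rel \<Rightarrow> bool" where
  "locally_finite V E \<longleftrightarrow> (\<forall>u\<in>V. finite (E `` {u}) \<and> finite (E\<inverse> `` {u}))"

definition desc :: "'a rel \<Rightarrow> 'a \<Rightarrow> 'a set" where
  "desc E u = E\<^sup>* `` {u}"

definition anc :: "'a rel \<Rightarrow> 'a \<Rightarrow> 'a set" where
  "anc E u = {v. u \<in> desc E v}"

text \<open>A cycle of an undirected graph with symmetric adjacency relation \<open>A\<close>.\<close>

definition graph_cycle :: "'a rel \<Rightarrow> 'a list \<Rightarrow> bool" where
  "graph_cycle A c \<longleftrightarrow> length c \<ge> 3 \<and> distinct c \<and>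
     (\<forall>i. i + 1 < length c \<longrightarrow> (c ! i, c ! (i + 1)) \<in> A) \<and> (last c, hd c) \<in> A"

definition digraph_tree :: "'a set \<Rightarrow> 'a rel \<Rightarrow> bool" where
  "digraph_tree V E \<longleftrightarrow> connected_on V E \<and> \<not> (\<exists>c. graph_cycle (E \<union> E\<inverse>) c)"

text \<open>The cardinality of \<open>S\<close> lies between 2 and aleph-zero.\<close>

definition two_to_countable :: "'a set \<Rightarrow> bool" where
  "two_to_countable S \<longleftrightarrow> (infinite S \<or> 2 \<le> card S) \<and> countable S"

definition locally_tree_like :: "'a set \<Rightarrow> 'a rel \<Rightarrow> bool" where
  "locally_tree_like V E \<longleftrightarrow>
     (\<forall>u\<in>V. digraph_tree (desc E u) (Restr E (desc E u)) \<and> two_to_countable (E `` {u})) \<and>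
     (\<forall>u\<in>V. digraph_tree (anc E u) (Restr E (anc E u)) \<and> two_to_countable (E\<inverse> `` {u}))"

definition intersection_property :: "'a set \<Rightarrow> 'a rel \<Rightarrow> bool" where
  "intersection_property V E \<longleftrightarrow>
     (\<forall>x\<in>V. \<forall>y\<in>V. desc E x \<inter> desc E y \<noteq> {} \<longrightarrow>
        (\<exists>z\<in>desc E x \<inter> desc E y. desc E x \<inter> desc E y = desc E z))"

subsection \<open>Strong transitivity\<close>

definition directed_line :: "'a rel \<Rightarrow> (int \<Rightarrow> 'a) \<Rightarrow> bool" where
  "directed_line E x \<longleftrightarrow> (\<forall>i. (x i, x (i + 1)) \<in> E)"

text \<open>
  In the amalgam of two infinite lines no points are identified except those prescribed by the
  rule, hence the injectivity and the equivalence below.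
\<close>

definition Y_configuration :: "'a rel \<Rightarrow> (int \<Rightarrow> 'a) \<Rightarrow> (int \<Rightarrow> 'a) \<Rightarrow> bool" where
  "Y_configuration E x y \<longleftrightarrow>
     directed_line E x \<and> directed_line E y \<and> inj x \<and> inj y \<and>
     (\<forall>i j. x i = y j \<longleftrightarrow> i = j \<and> i \<ge> 0)"

definition Y_bar_configuration :: "'a rel \<Rightarrow> (int \<Rightarrow> 'a) \<Rightarrow> (int \<Rightarrow> 'a) \<Rightarrow> bool" where
  "Y_bar_configuration E x y \<longleftrightarrow>
     directed_line E x \<and> directed_line E y \<and> inj x \<and> inj y \<and>
     (\<forall>i j. x i = y j \<longleftrightarrow> i = j \<and> i \<le> 0)"

text \<open>
  Configurations are labelled by their two lines, just as arcs are labelled by their vertices: an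
  automorphism carries one configuration to another if it carries the first line to the first and
  the second to the second. In particular (exchanging the lines of one configuration) some
  automorphism interchanges the two branches.
\<close>

definition strongly_transitive :: "'a set \<Rightarrow> 'a rel \<Rightarrow> bool" where
  "strongly_transitive V E \<longleftrightarrow>
     (\<forall>x y x' y'. Y_configuration E x y \<and> Y_configuration E x' y' \<longrightarrow>
        (\<exists>f. rel_aut V E f \<and> (\<forall>i. f (x i) = x' i \<and> f (y i) = y' i))) \<and>
     (\<forall>x y x' y'. Y_bar_configuration E x y \<and> Y_bar_configuration E x' y' \<longrightarrow>
        (\<exists>f. rel_aut V E f \<and> (\<forall>i. f (x i) = x' i \<and> f (y i) = y' i)))"

section \<open>Posets\<close>

definition ideals :: "'a rel \<Rightarrow> 'a set set" where
  "ideals r = {J. J \<noteq> {} \<and> Above r J \<noteq> {} \<and> J = Under r (Above r J)}"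

text \<open>
  The Dedekind-MacNeille completion, as an order relation with field \<open>ideals r\<close>. The point \<open>a\<close> of
  the poset is identified with the principal ideal \<open>under r a\<close>.
\<close>

definition completion :: "'a rel \<Rightarrow> 'a set rel" where
  "completion r = {(I, J). I \<in> ideals r \<and> J \<in> ideals r \<and> I \<subseteq> J}"

definition embedded :: "'a rel \<Rightarrow> 'a set set" where
  "embedded r = under r ` Field r"

definition is_meet :: "'a rel \<Rightarrow> 'a \<Rightarrow> 'a \<Rightarrow> 'a \<Rightarrow> bool" where
  "is_meet r a b x \<longleftrightarrow> (x, a) \<in> r \<and> (x, b) \<in> r \<and>
     (\<forall>z. (z, a) \<in> r \<and> (z, b) \<in> r \<longrightarrow> (z, x) \<in> r)"

definition is_join :: "'a rel \<Rightarrow> 'a \<Rightarrow> 'a \<Rightarrow> 'a \<Rightarrow> bool" where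
  "is_join r a b x \<longleftrightarrow> (a, x) \<in> r \<and> (b, x) \<in> r \<and>
     (\<forall>z. (a, z) \<in> r \<and> (b, z) \<in> r \<longrightarrow> (x, z) \<in> r)"

definition incomparable :: "'a rel \<Rightarrow> 'a \<Rightarrow> 'a \<Rightarrow> bool" where
  "incomparable r a b \<longleftrightarrow> a \<in> Field r \<and> b \<in> Field r \<and> (a, b) \<notin> r \<and> (b, a) \<notin> r"

definition ramification_points :: "'a rel \<Rightarrow> 'a set set" where
  "ramification_points r =
     {x. \<exists>a b. incomparable r a b \<and> is_meet (completion r) (under r a) (under r b) x} \<union>
     {x. \<exists>a b. incomparable r a b \<and> is_join (completion r) (under r a) (under r b) x}"

definition M_plus :: "'a rel \<Rightarrow> 'a set set" where
  "M_plus r = embedded r \<union> ramification_points r"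

text \<open>Vertices and edges of the digraph of ramification points outside the poset itself.\<close>

definition ram_verts :: "'a rel \<Rightarrow> 'a set set" where
  "ram_verts r = M_plus r - embedded r"

definition ram_edges :: "'a rel \<Rightarrow> 'a set rel" where
  "ram_edges r = {(x, y). x \<in> ram_verts r \<and> y \<in> ram_verts r \<and> y \<subset> x \<and>
     \<not> (\<exists>z\<in>ram_verts r. y \<subset> z \<and> z \<subset> x)}"

definition two_level :: "'a rel \<Rightarrow> bool" where
  "two_level r \<longleftrightarrow> Partial_order r \<and>
     (\<forall>C. pred_on.maxchain (Field r) (\<lambda>x y. (x, y) \<in> r) C \<longrightarrow> card C = 2)"

definition connected_poset :: "'a rel \<Rightarrow> bool" where
  "connected_poset r \<longleftrightarrow> connected_on (Field r) r"

definition three_CS_homogeneous :: "'a rel \<Rightarrow> bool" where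
  "three_CS_homogeneous r \<longleftrightarrow>
     (\<forall>A B f. A \<subseteq> Field r \<and> B \<subseteq> Field r \<and> card A = 3 \<and> card B = 3 \<and>
        connected_poset (Restr r A) \<and> connected_poset (Restr r B) \<and>
        rel_iso A (Restr r A) B (Restr r B) f \<longrightarrow>
        (\<exists>g. rel_aut (Field r) r g \<and> (\<forall>a\<in>A. g a = f a)))"

text \<open>
  All intervals \<open>[x, y]\<close> of the completion with \<open>x < y\<close> in the poset have the order type of the
  poset \<open>s\<close>. At least one pair \<open>x < y\<close> must exist for there to be a common type.
\<close>

definition completion_interval :: "'a rel \<Rightarrow> 'a \<Rightarrow> 'a \<Rightarrow> 'a set set" where
  "completion_interval r x y =
     {z. (under r x, z) \<in> completion r \<and> (z, under r y) \<in> completion r}"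

definition has_interval_type :: "'a rel \<Rightarrow> 'b rel \<Rightarrow> bool" where
  "has_interval_type r s \<longleftrightarrow> (\<exists>x y. (x, y) \<in> r \<and> x \<noteq> y) \<and>
     (\<forall>x y. (x, y) \<in> r \<and> x \<noteq> y \<longrightarrow>
        (\<exists>f. rel_iso (completion_interval r x y)
               (Restr (completion r) (completion_interval r x y)) (Field s) s f))"

text \<open>The type \<open>int extended\<close> consists of the integers with a least and a greatest point added.\<close>

definition one_Z_one :: "int extended rel" where
  "one_Z_one = {(x, y). x \<le> y}"

section \<open>Bipartite graphs\<close>

definition bipartite_graph :: "'a set \<Rightarrow> 'a set \<Rightarrow> 'a rel \<Rightarrow> bool" where
  "bipartite_graph X Y A \<longleftrightarrow> X \<inter> Y = {} \<and> A \<subseteq> X \<times> Y \<union> Y \<times> X \<and> sym A"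

definition graph_arc :: "'a set \<Rightarrow> 'a rel \<Rightarrow> nat \<Rightarrow> 'a list \<Rightarrow> bool" where
  "graph_arc V A s p \<longleftrightarrow> length p = s + 1 \<and> set p \<subseteq> V \<and>
     (\<forall>i<s. (p ! i, p ! (i + 1)) \<in> A) \<and> (\<forall>i. i + 2 \<le> s \<longrightarrow> p ! i \<noteq> p ! (i + 2))"

definition locally_arc_transitive :: "'a set \<Rightarrow> 'a rel \<Rightarrow> nat \<Rightarrow> bool" where
  "locally_arc_transitive V A s \<longleftrightarrow>
     (\<forall>v\<in>V. \<forall>p q. graph_arc V A s p \<and> graph_arc V A s q \<and> hd p = v \<and> hd q = v \<longrightarrow>
        (\<exists>f. rel_aut V A f \<and> f v = v \<and> map f p = q))"

definition P_of :: "'a set \<Rightarrow> 'a set \<Rightarrow> 'a rel \<Rightarrow> 'a rel" where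
  "P_of X Y A = Id_on (X \<union> Y) \<union> (A \<inter> X \<times> Y)"

end

theory Submission
  imports Defs "HOL-Library.Diagonal_Subsequence"
begin

text \<open>
  From \<open>D\<close> to \<open>M\<close>: paths in \<open>D\<close> are unique, so reachability is an order with finite chains as
  intervals, in which two vertices with a common descendant have a meet and, as a consequence, two
  vertices with a common ancestor have a join. The lower points of \<open>M\<close> are ends of descending rays, the upper points are ends of ascending rays, and \<open>x < y\<close> iff
  some line runs from \<open>y\<close> to \<open>x\<close>. A pair of comparabilities with a common lower point is a
  \<open>Y\<close>-configuration up to the choice of the start of the line, so strong transitivity is
  3-CS-homogeneity, and the meet of two upper points is the vertex where their lines diverge.
  All ends would be too many; a Skolem hull gives a countable set of them.

  From \<open>\<Gamma>\<close> to \<open>D\<close>: the non-principal ideals are the sets of lower points that are closed under the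
  polarity of adjacency and have at least two points and two upper bounds. Since the interval is
  \<open>1 + \<int> + 1\<close>, each such \<open>J\<close> below \<open>y\<close> has a cover, and any upper bound of \<open>J\<close> that does not
  bound the cover meets \<open>y\<close> exactly in \<open>J\<close>. Hence \<open>(x, y, J)\<close> amounts to a 2-arc of \<open>\<Gamma>\<close>, and
  2-arc-transitivity gives transitivity on finite arcs and on finite pieces of \<open>Y\<close>-configurations; in
  the locally finite case a compactness argument passes to the infinite configurations.
\<close>

section \<open>Relations, trees and automorphisms\<close>

text \<open>Both directions live in locales closed under reversal (of the edges, or of the roles of
  \<open>X\<close> and \<open>Y\<close>), so that ascending rays and
  \<open>Y_bar_configuration\<close> need no argument of their own. An end is a set of vertices
  rather than a class of rays: equality of ends is equality of sets, automorphisms act by images,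
  and a lower and an upper point are related iff the two sets meet. The automorphisms in use must
  map the countable set of ends onto itself, so the hull is closed under inverses too. In the
  converse, one 2-arc controls directed paths of any finite length: the closed sets that contain a
  given point and have a given upper bound form a chain, so a descending path of covers is known
  from its start and one point of its last set. This cannot reach infinite lines. A point lies in
  all members of at most one descending ray from a given set, while there are uncountably many such
  rays and only countably many points; so some lines end at no point of the graph and are reached
  only as limits.\<close>

lemma rtrancl_imp_distinct_path:
  assumes "(a, b) \<in> R\<^sup>*"
  obtains p where "p \<noteq> []" "hd p = a" "last p = b" "distinct p" "successively (\<lambda>x y. (x, y) \<in> R) p"
proof -
  have "\<exists>p. p \<noteq> [] \<and> hd p = a \<and> last p = b \<and> distinct p \<and> successively (\<lambda>x y. (x, y) \<in> R) p"
    using assms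
  proof (induction rule: converse_rtrancl_induct)
    case base
    then show ?case by (intro exI[of _ "[b]"]) auto
  next
    case (step a a')
    then obtain p where p: "p \<noteq> []" "hd p = a'" "last p = b" "distinct p"
      "successively (\<lambda>x y. (x, y) \<in> R) p" by blast
    show ?case
    proof (cases "a \<in> set p")
      case True
      \<comment> \<open>A return to \<open>a\<close> is a loop, which is cut out by keeping only the
        tail from \<open>a\<close> on.\<close>
      then obtain xs ys where "p = xs @ a # ys" by (meson split_list)
      with p show ?thesis by (intro exI[of _ "a # ys"]) (auto simp: successively_append_iff)
    next
      case False
      with p step show ?thesis by (intro exI[of _ "a # p"]) (auto simp: successively_Cons)
    qed
  qed
  with that show thesis by blast
qed

section \<open>Tree descendant sets and unique parents\<close>

lemma graph_cycle_successively:
  "graph_cycle A c \<longleftrightarrow> length c \<ge> 3 \<and> distinct c \<and> successively (\<lambda>x y. (x, y) \<in> A) c \<and> (last c, hd c) \<in> A"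
  by (auto simp: graph_cycle_def successively_conv_nth)

lemma digraph_tree_converse: "digraph_tree V (E\<inverse>) \<longleftrightarrow> digraph_tree V E"
  by (simp add: digraph_tree_def connected_on_def Un_commute)

lemma anc_eq_desc_converse: "anc E u = desc (E\<inverse>) u"
  by (auto simp: anc_def desc_def rtrancl_converse)

lemma Restr_converse: "Restr (E\<inverse>) D = (Restr E D)\<inverse>"
  by auto

lemma successively_in_desc:
  assumes "successively (\<lambda>x y. (x, y) \<in> E) p" "p \<noteq> []" "(u, hd p) \<in> E\<^sup>*"
  shows "set p \<subseteq> desc E u"
  using assms
proof (induction p)
  case (Cons a p)
  then show ?case
    by (cases "p = []") (auto simp: successively_Cons desc_def intro: rtrancl_into_rtrancl)
qed auto

text \<open>A directed cycle through \<open>v\<close> lies inside \<open>desc E v\<close> and would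
  be an undirected cycle of that tree; irreflexivity and asymmetry exclude the lengths 1 and 2,
  which \<open>graph_cycle\<close> does not count.\<close>

lemma tree_desc_acyclic:
  assumes E: "irrefl E" "asym E" and EV: "E \<subseteq> V \<times> V"
    and tree: "\<And>u. u \<in> V \<Longrightarrow> digraph_tree (desc E u) (Restr E (desc E u))"
  shows "acyclic E"
proof (rule acyclicI, intro allI notI)
  fix v assume "(v, v) \<in> E\<^sup>+"
  then obtain w where w: "(v, w) \<in> E" "(w, v) \<in> E\<^sup>*" by (meson tranclD)
  obtain p where p: "p \<noteq> []" "hd p = w" "last p = v" "distinct p" "successively (\<lambda>x y. (x, y) \<in> E) p"
    using rtrancl_imp_distinct_path[OF w(2)] by metis
  have "length p \<ge> 3"
  proof (rule ccontr)
    assume "\<not> 3 \<le> length p"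
    then consider a where "p = [a]" | a b where "p = [a, b]"
      using p(1) by (cases p; cases "tl p"; cases "tl (tl p)") auto
    then show False
      using p w E by cases (auto simp: irrefl_def dest: asymD)
  qed
  let ?D = "desc E v" and ?R = "Restr E (desc E v)"
  have sub: "set p \<subseteq> ?D" using p w by (intro successively_in_desc) auto
  have "successively (\<lambda>x y. (x, y) \<in> ?R \<union> ?R\<inverse>) p"
    using p(5) by (rule successively_mono) (use sub in auto)
  moreover have "(last p, hd p) \<in> ?R \<union> ?R\<inverse>"
    using p w sub by (metis IntI SigmaI UnI1 hd_in_set last_in_set subset_iff)
  ultimately have "graph_cycle (?R \<union> ?R\<inverse>) p"
    using \<open>length p \<ge> 3\<close> p(4) by (simp add: graph_cycle_successively)
  moreover have "v \<in> V" using w EV by auto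
  ultimately show False using tree unfolding digraph_tree_def by blast
qed

text \<open>The two paths from \<open>u\<close> connect \<open>w1\<close> with \<open>w2\<close>
  while avoiding \<open>w\<close>, because each vertex on them lies strictly above \<open>w\<close>.
  Closing the connection through \<open>w\<close> gives a cycle.\<close>

lemma tree_desc_unique_parent:
  assumes ac: "acyclic E" and u: "digraph_tree (desc E u) (Restr E (desc E u))"
    and w: "(w1, w) \<in> E" "(w2, w) \<in> E" "(u, w1) \<in> E\<^sup>*" "(u, w2) \<in> E\<^sup>*"
  shows "w1 = w2"
proof (rule ccontr)
  assume neq: "w1 \<noteq> w2"
  let ?D = "desc E u" and ?R = "Restr E (desc E u)"
  \<comment> \<open>The induced graph with \<open>w\<close> deleted: a distinct path found in it
    from \<open>w1\<close> to \<open>w2\<close> can be extended by \<open>w\<close> to a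
    cycle.\<close>
  let ?R' = "{(a, b). (a, b) \<in> ?R \<union> ?R\<inverse> \<and> a \<noteq> w \<and> b \<noteq> w}"
  \<comment> \<open>The parent \<open>v\<close> of \<open>w\<close> is kept fixed during the
    induction, as the witness that every vertex visited is above \<open>w\<close> and so differs
    from it.\<close>
  have *: "(u, z) \<in> ?R'\<^sup>*" if "(u, z) \<in> E\<^sup>*" "(z, v) \<in> E\<^sup>*" "(v, w) \<in> E" for z v
    using that
  proof (induction rule: rtrancl_induct)
    case (step y z)
    have "(y, w) \<in> E\<^sup>+" "(z, w) \<in> E\<^sup>+"
      using step by (meson converse_rtrancl_into_rtrancl rtrancl_into_trancl1)+
    then have "y \<noteq> w" "z \<noteq> w" using ac by (auto simp: acyclic_def)
    then have "(y, z) \<in> ?R'"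
      using step by (auto simp: desc_def intro: rtrancl_into_rtrancl)
    moreover have "(u, y) \<in> ?R'\<^sup>*"
      using step by (meson converse_rtrancl_into_rtrancl)
    ultimately show ?case by (rule rtrancl_into_rtrancl[rotated])
  qed simp
  have "sym ?R'" by (auto simp: sym_def)
  then have "sym (?R'\<^sup>*)" by (rule sym_rtrancl)
  with *[OF w(3) _ w(1)] *[OF w(4) _ w(2)] have "(w1, w2) \<in> ?R'\<^sup>*"
    by (meson rtrancl.rtrancl_refl rtrancl_trans symD)
  then obtain p where p: "p \<noteq> []" "hd p = w1" "last p = w2" "distinct p"
      "successively (\<lambda>x y. (x, y) \<in> ?R') p"
    by (rule rtrancl_imp_distinct_path) blast
  then obtain b q where q: "p = w1 # b # q"
    using neq by (cases p; cases "tl p") auto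
  have "w \<notin> set xs" if "successively (\<lambda>x y. (x, y) \<in> ?R') xs" "xs \<noteq> []" "hd xs \<noteq> w" for xs
    using that
  proof (induction xs)
    case (Cons a xs)
    then show ?case by (cases "xs = []") (auto simp: successively_Cons)
  qed auto
  moreover have "w1 \<noteq> w" using ac w(1) by (auto simp: acyclic_def)
  ultimately have "w \<notin> set p" using p by blast
  moreover have "successively (\<lambda>x y. (x, y) \<in> ?R \<union> ?R\<inverse>) p"
    using p(5) by (rule successively_mono) auto
  moreover have "{w1, w2, w} \<subseteq> ?D"
    using w by (auto simp: desc_def)
  ultimately have "graph_cycle (?R \<union> ?R\<inverse>) (w # p)"
    using p w q by (auto simp: graph_cycle_successively successively_Cons)
  then show False using u unfolding digraph_tree_def by blast
qed

text \<open>A lowest vertex of a cycle would have two distinct parents.\<close>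

lemma unique_parent_imp_tree_desc:
  assumes ac: "acyclic E"
    and uniq: "\<And>w w1 w2. (w1, w) \<in> E \<Longrightarrow> (w2, w) \<in> E \<Longrightarrow> (u, w1) \<in> E\<^sup>* \<Longrightarrow> (u, w2) \<in> E\<^sup>* \<Longrightarrow> w1 = w2"
  shows "digraph_tree (desc E u) (Restr E (desc E u))"
  unfolding digraph_tree_def
proof (intro conjI notI)
  let ?D = "desc E u" and ?R = "Restr E (desc E u)"
  have *: "(u, v) \<in> (?R \<union> ?R\<inverse>)\<^sup>*" if "(u, v) \<in> E\<^sup>*" for v
    using that
  proof (induction rule: rtrancl_induct)
    case (step y z)
    then have "(y, z) \<in> ?R \<union> ?R\<inverse>" by (auto simp: desc_def intro: rtrancl_into_rtrancl)
    with step show ?case by (meson rtrancl_into_rtrancl)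
  qed simp
  have "sym ((?R \<union> ?R\<inverse>)\<^sup>*)" by (intro sym_rtrancl) (auto simp: sym_def)
  then show "connected_on ?D ?R"
    using * by (auto simp: connected_on_def desc_def) (meson rtrancl_trans symD)
  assume "\<exists>c. graph_cycle (?R \<union> ?R\<inverse>) c"
  then obtain c where c: "length c \<ge> 3" "distinct c"
    "\<forall>i. i + 1 < length c \<longrightarrow> (c ! i, c ! (i + 1)) \<in> ?R \<union> ?R\<inverse>" "(last c, hd c) \<in> ?R \<union> ?R\<inverse>"
    by (auto simp: graph_cycle_def)
  define n where "n = length c"
  have adj: "(c ! i, c ! ((i + 1) mod n)) \<in> ?R \<union> ?R\<inverse>" if "i < n" for i
  proof (cases "i + 1 < n")
    case True
    then show ?thesis using c(3) by (simp add: n_def)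
  next
    case False
    with that have "i = n - 1" "i + 1 = n" by auto
    then show ?thesis using c(1,4) by (auto simp: n_def last_conv_nth hd_conv_nth simp flip: length_0_conv)
  qed
  \<comment> \<open>The directed edges between vertices of the cycle form a finite acyclic relation,
    so some \<open>m\<close> on the cycle has no child on it. Both neighbours of \<open>m\<close> in
    the cycle must then be parents.\<close>
  let ?S = "Restr E (set c)"
  have "finite ?S" by (rule finite_subset[of _ "set c \<times> set c"]) auto
  moreover have "acyclic (?S\<inverse>)"
    using acyclic_subset[OF ac, of ?S] by (simp only: acyclic_converse) auto
  ultimately have "wf (?S\<inverse>)" by (intro finite_acyclic_wf) auto
  moreover have "hd c \<in> set c" using c(1) by (intro hd_in_set) auto
  ultimately obtain m where m: "m \<in> set c" "\<And>y. (y, m) \<in> ?S\<inverse> \<Longrightarrow> y \<notin> set c"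
    by (meson wfE_min)
  then obtain i where i: "i < n" "c ! i = m" by (auto simp: in_set_conv_nth n_def)
  define j where "j = (i + 1) mod n"
  \<comment> \<open>The cyclic predecessor of \<open>i\<close>; adding \<open>n - 1\<close> avoids
    truncated subtraction at \<open>i = 0\<close>. It differs from the successor \<open>j\<close>
    because \<open>n \<ge> 3\<close>.\<close>
  define k where "k = (i + (n - 1)) mod n"
  have n3: "n \<ge> 3" using c(1) by (simp add: n_def)
  have k: "(k + 1) mod n = i" "k < n"
    using n3 i by (auto simp: k_def mod_Suc_eq)
  have j: "j < n" using n3 by (simp add: j_def)
  have jk: "j \<noteq> k"
  proof
    assume "j = k"
    then have "(i + 1 + 1) mod n = i" using k j_def by (metis mod_add_left_eq)
    moreover have "(i + 1 + 1) mod n = i + 2 \<or> n \<le> i + 2 \<and> (i + 1 + 1) mod n = i + 2 - n"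
    proof (cases "i + 2 < n")
      case False
      then have "(i + 2) mod n = i + 2 - n" using i n3 by (subst le_mod_geq) auto
      then show ?thesis using False by simp
    qed simp
    ultimately show False using n3 by arith
  qed
  have par: "(c ! l, m) \<in> E \<and> (u, c ! l) \<in> E\<^sup>*" if "l < n" "(m, c ! l) \<in> ?R \<union> ?R\<inverse>" for l
  proof -
    have "c ! l \<in> set c" using that(1) by (simp add: n_def)
    then have "(m, c ! l) \<notin> E" using m(1) m(2)[of "c ! l"] by blast
    then show ?thesis using that(2) by (auto simp: desc_def)
  qed
  have "(c ! j, m) \<in> E \<and> (u, c ! j) \<in> E\<^sup>*"
    using adj[OF i(1)] i j by (intro par) (auto simp: j_def)
  moreover have "(c ! k, m) \<in> E \<and> (u, c ! k) \<in> E\<^sup>*"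
    using adj[OF k(2)] i k by (intro par) auto
  ultimately have "c ! j = c ! k" using uniq by blast
  then show False using jk j k c(2) by (auto simp: n_def nth_eq_iff_index_eq)
qed

section \<open>Isomorphisms of relational structures\<close>

lemma rel_iso_comp:
  assumes "rel_iso A R B S f" "rel_iso B S C T g"
  shows "rel_iso A R C T (g \<circ> f)"
proof -
  have "f x \<in> B" if "x \<in> A" for x using assms(1) that by (auto simp: rel_iso_def bij_betw_def)
  then show ?thesis using assms by (auto simp: rel_iso_def intro: bij_betw_trans)
qed

lemma rel_aut_id: "rel_aut A R (\<lambda>x. x)"
  by (simp add: rel_iso_def bij_betw_def)

lemma rel_iso_in: "rel_iso A R B S f \<Longrightarrow> x \<in> A \<Longrightarrow> f x \<in> B"
  by (auto simp: rel_iso_def bij_betw_def)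

lemma rel_iso_inv:
  assumes "rel_iso A R B S f"
  shows "rel_iso B S A R (inv_into A f)"
proof -
  have b: "bij_betw f A B" using assms by (simp add: rel_iso_def)
  have "inv_into A f y \<in> A" "f (inv_into A f y) = y" if "y \<in> B" for y
    using b that by (metis bij_betw_def inv_into_into, metis bij_betw_def f_inv_into_f)
  then show ?thesis using assms b by (simp add: rel_iso_def bij_betw_inv_into)
qed

lemma rel_iso_converse: "rel_iso A (R\<inverse>) B (S\<inverse>) f \<longleftrightarrow> rel_iso A R B S f"
  by (auto simp: rel_iso_def)

text \<open>The length is kept because \<open>automorphism_limit\<close> moves finite balls of a
  given radius. Membership of \<open>b\<close> is carried along since \<open>f\<close> is controlled
  on \<open>A\<close> only.\<close>

lemma rel_iso_relpow:
  assumes f: "rel_iso A R B S f" and R: "R \<subseteq> A \<times> A" and a: "a \<in> A" and "(a, b) \<in> R ^^ n"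
  shows "(f a, f b) \<in> S ^^ n \<and> b \<in> A"
  using assms(4)
proof (induction n arbitrary: b)
  case (Suc n)
  then obtain c where c: "(a, c) \<in> R ^^ n" "(c, b) \<in> R" by auto
  with Suc.IH[of c] R f show ?case by (auto simp: rel_iso_def)
qed (use a in auto)

lemma rel_aut_rtrancl:
  assumes f: "rel_aut V E f" and EV: "E \<subseteq> V \<times> V" and uv: "u \<in> V" "v \<in> V"
  shows "(f u, f v) \<in> E\<^sup>* \<longleftrightarrow> (u, v) \<in> E\<^sup>*"
proof
  assume "(u, v) \<in> E\<^sup>*"
  then show "(f u, f v) \<in> E\<^sup>*"
    using rel_iso_relpow[OF f EV uv(1)] by (metis rtrancl_imp_relpow relpow_imp_rtrancl)
next
  assume *: "(f u, f v) \<in> E\<^sup>*"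
  let ?g = "inv_into V f"
  have "(?g (f u), ?g (f v)) \<in> E\<^sup>*"
    using * rel_iso_relpow[OF rel_iso_inv[OF f] EV] rel_iso_in[OF f uv(1)]
    by (metis rtrancl_imp_relpow relpow_imp_rtrancl)
  then show "(u, v) \<in> E\<^sup>*"
    using f uv by (simp add: rel_iso_def bij_betw_def inv_into_f_f)
qed

section \<open>Countability and Skolem hulls\<close>

lemma countable_rtrancl_Image:
  fixes R :: "'a rel"
  assumes "\<And>u. countable (R `` {u})"
  shows "countable (R\<^sup>* `` {v})"
proof -
  have "countable ((R ^^ n) `` {v})" for n
  proof (induction n)
    case (Suc n)
    have "(R ^^ Suc n) `` {v} = (\<Union>u \<in> (R ^^ n) `` {v}. R `` {u})" by auto
    then show ?case using Suc assms by auto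
  qed simp
  moreover have "R\<^sup>* `` {v} = (\<Union>n. (R ^^ n) `` {v})"
    by (auto simp: rtrancl_is_UN_relpow)
  ultimately show ?thesis by auto
qed

lemma countable_connected:
  assumes "connected_on V E" "E \<subseteq> V \<times> V" "\<And>u. u \<in> V \<Longrightarrow> countable (E `` {u}) \<and> countable (E\<inverse> `` {u})"
  shows "countable V"
proof -
  obtain v where v: "v \<in> V" using assms(1) by (auto simp: connected_on_def)
  have "countable ((E \<union> E\<inverse>) `` {u})" for u
  proof (cases "u \<in> V")
    case False
    with assms(2) have "(E \<union> E\<inverse>) `` {u} = {}" by auto
    then show ?thesis by simp
  qed (use assms(3) in \<open>simp add: Un_Image\<close>)
  then have "countable ((E \<union> E\<inverse>)\<^sup>* `` {v})" by (rule countable_rtrancl_Image)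
  moreover have "V \<subseteq> (E \<union> E\<inverse>)\<^sup>* `` {v}" using assms(1) v by (auto simp: connected_on_def)
  ultimately show ?thesis by (rule countable_subset[rotated])
qed

text \<open>The Skolem hull: \<open>h\<close> is applied to all finite lists over the current set,
  and this is repeated countably often.\<close>

lemma countable_closure:
  fixes h :: "'b list \<Rightarrow> 'b set"
  assumes "countable S0" "\<And>l. countable (h l)"
  obtains S where "S0 \<subseteq> S" "countable S" "\<And>l. set l \<subseteq> S \<Longrightarrow> h l \<subseteq> S"
proof -
  define T where "T = rec_nat S0 (\<lambda>_ S. S \<union> (\<Union>l\<in>lists S. h l))"
  have T: "T 0 = S0" "T (Suc n) = T n \<union> (\<Union>l\<in>lists (T n). h l)" for n
    by (simp_all add: T_def)
  have mono: "T m \<subseteq> T n" if "m \<le> n" for m n :: nat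
    using that by (rule lift_Suc_mono_le[rotated]) (simp add: T)
  have "countable (T n)" for n
    by (induction n) (use assms in \<open>auto simp: T intro!: countable_UN countable_lists\<close>)
  then have "countable (\<Union>n. T n)" by auto
  moreover have "h l \<subseteq> (\<Union>n. T n)" if "set l \<subseteq> (\<Union>n. T n)" for l
  proof -
    \<comment> \<open>The stages increase, so the finitely many entries of a list already lie in one
      of them.\<close>
    have "\<exists>n. set l \<subseteq> T n" using that
    proof (induction l)
      case (Cons a l)
      then obtain n m where "set l \<subseteq> T n" "a \<in> T m" by auto
      then have "set (a # l) \<subseteq> T (max n m)" using mono[of n "max n m"] mono[of m "max n m"] by auto
      then show ?case by blast
    qed auto
    then obtain n where "l \<in> lists (T n)" by auto
    then have "h l \<subseteq> T (Suc n)" by (auto simp: T)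
    then show ?thesis by blast
  qed
  moreover have "S0 \<subseteq> (\<Union>n. T n)" using T(1) by blast
  ultimately show thesis by (rule that[rotated])
qed

section \<open>Limits of automorphisms\<close>

lemma finite_relpow_Image:
  fixes R :: "'a rel"
  assumes "\<And>u. finite (R `` {u})"
  shows "finite ((R ^^ n) `` {v})"
proof (induction n)
  case (Suc n)
  have "(R ^^ Suc n) `` {v} = (\<Union>u \<in> (R ^^ n) `` {v}. R `` {u})" by auto
  then show ?case using Suc assms by auto
qed simp

text \<open>Values at any vertex are confined to a finite ball, so a diagonal sequence converges pointwise.\<close>

lemma automorphism_limit:
  fixes f :: "nat \<Rightarrow> 'a \<Rightarrow> 'a"
  assumes conn: "connected_on V E" and EV: "E \<subseteq> V \<times> V" and lf: "locally_finite V E"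
    and f: "\<And>n. rel_aut V E (f n)" and v0: "v0 \<in> V" "\<And>n. f n v0 = w0"
  obtains g where "rel_aut V E g"
    "\<And>S m. finite S \<Longrightarrow> S \<subseteq> V \<Longrightarrow> \<exists>n\<ge>m. \<forall>s\<in>S. g s = f n s"
proof -
  define R where "R = E \<union> E\<inverse>"
  have RV: "R \<subseteq> V \<times> V" using EV by (auto simp: R_def)
  have fR: "rel_aut V R (f n)" for n using f[of n] by (auto simp: R_def rel_iso_def)
  have fin: "finite (R `` {u})" for u
  proof (cases "u \<in> V")
    case False
    with RV have "R `` {u} = {}" by auto
    then show ?thesis by simp
  qed (use lf in \<open>simp add: R_def locally_finite_def Un_Image\<close>)
  have w0: "w0 \<in> V" using rel_iso_in[OF f[of 0] v0(1)] v0(2) by simp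
  have con: "\<exists>k. (u, v) \<in> R ^^ k" if "u \<in> V" "v \<in> V" for u v
    using conn that by (auto simp: connected_on_def R_def rtrancl_is_UN_relpow)
  have "countable V"
    using lf by (intro countable_connected[OF conn EV]) (auto simp: locally_finite_def countable_finite)
  define e where "e = from_nat_into V"
  have e: "range e = V" unfolding e_def using \<open>countable V\<close> v0(1) by (intro range_from_nat_into) auto
  have fval: "finite (range (\<lambda>n. f n v))" if v: "v \<in> V" for v
  proof -
    obtain k where "(v0, v) \<in> R ^^ k" using con v0 v by blast
    then have "(w0, f n v) \<in> R ^^ k" for n
      using rel_iso_relpow[OF fR RV v0(1)] v0(2) by metis
    then have "range (\<lambda>n. f n v) \<subseteq> (R ^^ k) `` {w0}" by auto
    then show ?thesis using finite_relpow_Image[OF fin] finite_subset by blast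
  qed
  \<comment> \<open>\<open>P k s\<close> says that along \<open>s\<close> the images of the
    \<open>k\<close>-th vertex are constant. It passes to subsequences, as the diagonal construction
    requires.\<close>
  define P where "P = (\<lambda>k (s::nat \<Rightarrow> nat). \<exists>c. \<forall>i. f (s i) (e k) = (c::'a))"
  interpret subseqs P
  proof
    fix n and s :: "nat \<Rightarrow> nat" assume "strict_mono s"
    have "finite (range (\<lambda>i. f (s i) (e n)))"
      by (rule finite_subset[OF _ fval[of "e n"]]) (use e in auto)
    then obtain c where "infinite {i. f (s i) (e n) = c}"
      using inf_img_fin_domE[of "\<lambda>i. f (s i) (e n)" UNIV] by (auto simp: vimage_def)
    then obtain r :: "nat \<Rightarrow> nat" where "strict_mono r" "\<And>i. r i \<in> {i. f (s i) (e n) = c}"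
      using infinite_enumerate by blast
    then show "\<exists>r'. strict_mono r' \<and> P n (s \<circ> r')" by (intro exI[of _ r]) (auto simp: P_def)
  qed
  \<comment> \<open>Only after its first \<open>k + 1\<close> terms is the diagonal sequence a
    subsequence of the one that stabilises the \<open>k\<close>-th vertex.\<close>
  have "P k (diagseq \<circ> ((+) (Suc k)))" for k
    by (rule diagseq_holds) (auto simp: P_def)
  then obtain c where c: "\<And>k i. f (diagseq (Suc k + i)) (e k) = c k"
    unfolding P_def o_def by metis
  have ev: "\<exists>c N. \<forall>i\<ge>N. f (diagseq i) v = c" if "v \<in> V" for v
  proof -
    obtain k where k: "v = e k" using e \<open>v \<in> V\<close> by blast
    have "f (diagseq i) v = c k" if "i \<ge> Suc k" for i
      using c[of k "i - Suc k"] that k by simp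
    then show ?thesis by blast
  qed
  then obtain g where g: "\<And>v. v \<in> V \<Longrightarrow> \<exists>N. \<forall>i\<ge>N. f (diagseq i) v = g v" by metis
  have lim: "\<exists>n\<ge>m. \<forall>s\<in>S. g s = f n s" if S: "finite S" "S \<subseteq> V" for S m
  proof -
    have "\<exists>N. \<forall>s\<in>S. \<forall>i\<ge>N. f (diagseq i) s = g s" using S
    proof (induction S rule: finite_induct)
      case (insert x S)
      then obtain N N' where "\<forall>s\<in>S. \<forall>i\<ge>N. f (diagseq i) s = g s" "\<forall>i\<ge>N'. f (diagseq i) x = g x"
        using g[of x] by auto
      then show ?case by (intro exI[of _ "max N N'"]) auto
    qed auto
    then obtain N where N: "\<And>s i. s \<in> S \<Longrightarrow> i \<ge> N \<Longrightarrow> f (diagseq i) s = g s" by blast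
    have "diagseq (max N m) \<ge> m" using seq_suble[OF subseq_diagseq, of "max N m"] by linarith
    then show ?thesis using N[of _ "max N m"] by (intro exI[of _ "diagseq (max N m)"]) auto
  qed
  have gV: "g v \<in> V" if "v \<in> V" for v
    using lim[of "{v}" 0] that rel_iso_in[OF f] by auto
  have pair: "\<exists>n. g u = f n u \<and> g v = f n v" if "u \<in> V" "v \<in> V" for u v
    using lim[of "{u, v}" 0] that by auto
  have inj: "inj_on g V"
    using pair f unfolding inj_on_def rel_iso_def bij_betw_def by metis
  have surj: "V \<subseteq> g ` V"
  proof
    fix w assume w: "w \<in> V"
    then obtain k where k: "(w0, w) \<in> R ^^ k" using con w0 by blast
    let ?B = "(R ^^ k) `` {v0}"
    have BV: "?B \<subseteq> V" using rel_iso_relpow[OF fR RV v0(1)] by auto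
    obtain n where n: "\<forall>s\<in>?B. g s = f n s"
      using lim[OF finite_relpow_Image[OF fin] BV] by blast
    let ?h = "inv_into V (f n)"
    have h: "rel_aut V R ?h" by (rule rel_iso_inv[OF fR])
    have "?h w0 = v0" using v0 f[of n] by (metis bij_betw_inv_into_left rel_iso_def)
    then have "(v0, ?h w) \<in> R ^^ k" using rel_iso_relpow[OF h RV w0 k] by simp
    then have "g (?h w) = f n (?h w)" using n by auto
    also have "\<dots> = w" using w f[of n] by (metis bij_betw_inv_into_right rel_iso_def)
    finally show "w \<in> g ` V" using rel_iso_in[OF h w] by (metis image_eqI)
  qed
  have "rel_aut V E g"
    unfolding rel_iso_def bij_betw_def
  proof (intro conjI ballI)
    show "g ` V = V" using gV surj by auto
    fix u v assume "u \<in> V" "v \<in> V"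
    then show "(u, v) \<in> E \<longleftrightarrow> (g u, g v) \<in> E"
      using pair[of u v] f unfolding rel_iso_def by metis
  qed (rule inj)
  then show thesis using lim by (rule that)
qed

section \<open>Strong transitivity and duality\<close>

text \<open>One half of strong transitivity, isolated because the other half is this same property
  of the reversed digraph.\<close>

definition Y_transitive :: "'a set \<Rightarrow> 'a rel \<Rightarrow> bool" where
  "Y_transitive V E \<longleftrightarrow> (\<forall>x y x' y'. Y_configuration E x y \<and> Y_configuration E x' y' \<longrightarrow>
     (\<exists>f. rel_aut V E f \<and> (\<forall>i. f (x i) = x' i \<and> f (y i) = y' i)))"

lemma directed_line_converse: "directed_line (E\<inverse>) x \<longleftrightarrow> directed_line E (\<lambda>i. x (- i))"
  unfolding directed_line_def
proof safe
  fix i assume "\<forall>i. (x i, x (i + 1)) \<in> E\<inverse>"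
  then have "(x (- (i + 1)), x (- (i + 1) + 1)) \<in> E\<inverse>" by blast
  then show "(x (- i), x (- (i + 1))) \<in> E" by simp
next
  fix i assume "\<forall>i. (x (- i), x (- (i + 1))) \<in> E"
  then have "(x (- (- (i + 1))), x (- (- (i + 1) + 1))) \<in> E" by blast
  then show "(x (i + 1), x i) \<in> E" by (simp add: add.commute)
qed

lemma Y_bar_configuration_converse:
  "Y_bar_configuration E x y \<longleftrightarrow> Y_configuration (E\<inverse>) (\<lambda>i. x (- i)) (\<lambda>i. y (- i))"
proof -
  have inj: "inj (\<lambda>i. z (- i)) \<longleftrightarrow> inj z" for z :: "int \<Rightarrow> 'a"
    unfolding inj_def by (metis minus_minus)
  have "(\<forall>i j. x i = y j \<longleftrightarrow> i = j \<and> i \<le> 0) \<longleftrightarrow> (\<forall>i j. x (- i) = y (- j) \<longleftrightarrow> i = j \<and> 0 \<le> i)"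
    by (metis minus_minus neg_0_le_iff_le)
  then show ?thesis
    by (simp add: Y_bar_configuration_def Y_configuration_def directed_line_converse inj)
qed

lemma strongly_transitive_iff:
  "strongly_transitive V E \<longleftrightarrow> Y_transitive V E \<and> Y_transitive V (E\<inverse>)"
proof -
  have "(\<forall>x y x' y'. Y_bar_configuration E x y \<and> Y_bar_configuration E x' y' \<longrightarrow>
      (\<exists>f. rel_aut V E f \<and> (\<forall>i. f (x i) = x' i \<and> f (y i) = y' i))) \<longleftrightarrow> Y_transitive V (E\<inverse>)"
    (is "?L \<longleftrightarrow> ?R")
  proof
    assume L: ?L
    show ?R unfolding Y_transitive_def
    proof (intro allI impI)
      fix x y x' y' :: "int \<Rightarrow> 'a" assume "Y_configuration (E\<inverse>) x y \<and> Y_configuration (E\<inverse>) x' y'"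
      then have "Y_bar_configuration E (\<lambda>i. x (- i)) (\<lambda>i. y (- i)) \<and>
          Y_bar_configuration E (\<lambda>i. x' (- i)) (\<lambda>i. y' (- i))"
        by (simp add: Y_bar_configuration_converse)
      then obtain f where "rel_aut V E f" "\<forall>i. f (x (- i)) = x' (- i) \<and> f (y (- i)) = y' (- i)"
        using L by meson
      then show "\<exists>f. rel_aut V (E\<inverse>) f \<and> (\<forall>i. f (x i) = x' i \<and> f (y i) = y' i)"
        by (metis minus_minus rel_iso_converse)
    qed
  next
    assume R: ?R
    show ?L
    proof (intro allI impI)
      fix x y x' y' :: "int \<Rightarrow> 'a" assume "Y_bar_configuration E x y \<and> Y_bar_configuration E x' y'"
      then obtain f where "rel_aut V (E\<inverse>) f" "\<forall>i. f (x (- i)) = x' (- i) \<and> f (y (- i)) = y' (- i)"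
        using R unfolding Y_bar_configuration_converse Y_transitive_def by meson
      then show "\<exists>f. rel_aut V E f \<and> (\<forall>i. f (x i) = x' i \<and> f (y i) = y' i)"
        by (metis minus_minus rel_iso_converse)
    qed
  qed
  then show ?thesis by (simp add: strongly_transitive_def Y_transitive_def)
qed

section \<open>Ends of a digraph\<close>

definition ray :: "'a rel \<Rightarrow> (nat \<Rightarrow> 'a) \<Rightarrow> bool" where
  "ray E x \<longleftrightarrow> (\<forall>i. (x i, x (Suc i)) \<in> E)"

text \<open>An end is represented by the set of the vertices above a ray.\<close>

definition end_of :: "'a rel \<Rightarrow> (nat \<Rightarrow> 'a) \<Rightarrow> 'a set" where
  "end_of E x = {v. \<exists>i. (v, x i) \<in> E\<^sup>*}"

definition is_end :: "'a rel \<Rightarrow> 'a set \<Rightarrow> bool" where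
  "is_end E F \<longleftrightarrow> (\<exists>x. ray E x \<and> F = end_of E x)"

lemma ray_rtrancl: "ray E x \<Longrightarrow> i \<le> j \<Longrightarrow> (x i, x j) \<in> E\<^sup>*"
  by (rule dec_induct[of i j]) (auto simp: ray_def intro: rtrancl_into_rtrancl)

lemma end_of_self: "x i \<in> end_of E x"
  by (auto simp: end_of_def)

lemma is_end_up: "is_end E F \<Longrightarrow> v \<in> F \<Longrightarrow> (u, v) \<in> E\<^sup>* \<Longrightarrow> u \<in> F"
  by (auto simp: is_end_def end_of_def) (meson rtrancl_trans)

lemma is_end_down: "is_end (E\<inverse>) F \<Longrightarrow> v \<in> F \<Longrightarrow> (v, u) \<in> E\<^sup>* \<Longrightarrow> u \<in> F"
  using is_end_up[of "E\<inverse>" F v u] by (simp add: rtrancl_converse)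

lemma is_end_directed:
  assumes "is_end E F" "u \<in> F" "v \<in> F"
  obtains w where "w \<in> F" "(u, w) \<in> E\<^sup>*" "(v, w) \<in> E\<^sup>*"
proof -
  obtain x i j where x: "ray E x" "F = end_of E x" "(u, x i) \<in> E\<^sup>*" "(v, x j) \<in> E\<^sup>*"
    using assms by (auto simp: is_end_def end_of_def)
  then have "(u, x (max i j)) \<in> E\<^sup>*" "(v, x (max i j)) \<in> E\<^sup>*"
    using ray_rtrancl[OF x(1)] by (meson max.cobounded1 max.cobounded2 rtrancl_trans)+
  then show thesis using that x(2) end_of_self by metis
qed

lemma is_end_nonempty: "is_end E F \<Longrightarrow> F \<noteq> {}"
  by (auto simp: is_end_def end_of_def)

lemma is_end_subset:
  assumes "is_end E F" "E \<subseteq> V \<times> V"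
  shows "F \<subseteq> V"
proof
  fix v assume "v \<in> F"
  then obtain x i where x: "ray E x" "(v, x i) \<in> E\<^sup>*" using assms(1) by (auto simp: is_end_def end_of_def)
  have "x i \<in> V" using x(1) assms(2) by (auto simp: ray_def)
  with x(2) show "v \<in> V" using assms(2) by (metis converse_rtranclE mem_Sigma_iff subsetD)
qed

text \<open>Neither dropping an initial part of a ray nor prepending a path to it changes the set of
  vertices above it. Hence every member of an end starts a ray to it.\<close>

lemma is_end_from:
  assumes "is_end E F" "c \<in> F"
  obtains x where "ray E x" "x 0 = c" "F = end_of E x"
proof -
  obtain z k where z: "ray E z" "F = end_of E z" and k: "(c, z k) \<in> E\<^sup>*"
    using assms by (auto simp: is_end_def end_of_def)
  from k have "\<exists>x. ray E x \<and> x 0 = c \<and> end_of E x = end_of E z"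
  proof (induction rule: converse_rtrancl_induct)
    case base
    have "end_of E (\<lambda>i. z (k + i)) = end_of E z"
    proof -
      have "\<exists>j. (v, z (k + j)) \<in> E\<^sup>*" if "(v, z i) \<in> E\<^sup>*" for v i
        using that ray_rtrancl[OF z(1), of i "k + i"] by (meson le_add2 rtrancl_trans)
      then show ?thesis by (auto simp: end_of_def)
    qed
    with z(1) show ?case by (intro exI[of _ "\<lambda>i. z (k + i)"]) (auto simp: ray_def)
  next
    case (step c' c)
    then obtain x where x: "ray E x" "x 0 = c" "end_of E x = end_of E z" by blast
    define x' where "x' = case_nat c' x"
    have r: "ray E x'" using x step by (auto simp: ray_def x'_def split: nat.split)
    have "end_of E x' = end_of E x"
    proof (intro set_eqI iffI)
      fix v assume "v \<in> end_of E x'"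
      then obtain i where "(v, x' i) \<in> E\<^sup>*" by (auto simp: end_of_def)
      then have "(v, x' (Suc i)) \<in> E\<^sup>*" using r by (meson ray_def rtrancl.rtrancl_into_rtrancl)
      then show "v \<in> end_of E x" by (auto simp: end_of_def x'_def)
    next
      fix v assume "v \<in> end_of E x"
      then obtain i where "(v, x' (Suc i)) \<in> E\<^sup>*" by (auto simp: end_of_def x'_def)
      then show "v \<in> end_of E x'" by (auto simp: end_of_def)
    qed
    then show ?case using r x by (intro exI[of _ x']) (simp add: x'_def)
  qed
  then show thesis using that z(2) by metis
qed

lemma end_of_image:
  assumes g: "rel_aut V E g" and EV: "E \<subseteq> V \<times> V" and x: "ray E x"
  shows "g ` end_of E x = end_of E (g \<circ> x)" "ray E (g \<circ> x)"
proof -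
  have xV: "x i \<in> V" for i using x EV by (auto simp: ray_def)
  have end_sub: "end_of E x \<subseteq> V" using x by (intro is_end_subset[OF _ EV]) (auto simp: is_end_def)
  show r: "ray E (g \<circ> x)" using x g xV by (auto simp: ray_def rel_iso_def)
  have end_sub': "end_of E (g \<circ> x) \<subseteq> V"
    using r by (intro is_end_subset[OF _ EV]) (auto simp: is_end_def)
  show "g ` end_of E x = end_of E (g \<circ> x)"
  proof (intro set_eqI iffI)
    fix w assume "w \<in> g ` end_of E x"
    then obtain v i where v: "v \<in> V" "w = g v" "(v, x i) \<in> E\<^sup>*" using end_sub by (auto simp: end_of_def)
    then have "(w, g (x i)) \<in> E\<^sup>*" using rel_aut_rtrancl[OF g EV v(1) xV] by simp
    then show "w \<in> end_of E (g \<circ> x)" by (auto simp: end_of_def)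
  next
    fix w assume w: "w \<in> end_of E (g \<circ> x)"
    then have "w \<in> V" using end_sub' by auto
    then obtain v where v: "v \<in> V" "w = g v" using g by (metis bij_betw_def imageE rel_iso_def)
    from w obtain i where "(w, g (x i)) \<in> E\<^sup>*" by (auto simp: end_of_def)
    then have "(v, x i) \<in> E\<^sup>*" using rel_aut_rtrancl[OF g EV v(1) xV] v by simp
    then show "w \<in> g ` end_of E x" using v by (auto simp: end_of_def)
  qed
qed

lemma is_end_image:
  "rel_aut V E g \<Longrightarrow> E \<subseteq> V \<times> V \<Longrightarrow> is_end E F \<Longrightarrow> is_end E (g ` F)"
  unfolding is_end_def using end_of_image[of V E g] by metis

text \<open>Both halves are counted away from the common start at index 0; the ascending half
  \<open>y\<close> is thus a ray of the reversed digraph, and facts about rays apply to either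
  half.\<close>

definition line :: "(nat \<Rightarrow> 'a) \<Rightarrow> (nat \<Rightarrow> 'a) \<Rightarrow> int \<Rightarrow> 'a" where
  "line x y i = (if i \<ge> 0 then x (nat i) else y (nat (- i)))"

lemma line_minus: "x 0 = y 0 \<Longrightarrow> line x y (- int n) = y n"
  by (auto simp: line_def)

lemma directed_line_line:
  assumes "ray E x" "ray (E\<inverse>) y" "x 0 = y 0"
  shows "directed_line E (line x y)"
  unfolding directed_line_def
proof
  fix i :: int
  consider "i \<ge> 0" | "i = - 1" | "i < - 1" by linarith
  then show "(line x y i, line x y (i + 1)) \<in> E"
  proof cases
    case 1
    then have "nat (i + 1) = Suc (nat i)" by simp
    with 1 assms show ?thesis by (simp add: line_def ray_def)
  next
    case 2
    then show ?thesis using assms by (auto simp: line_def ray_def dest: spec[of _ 0])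
  next
    case 3
    then have "nat (- i) = Suc (nat (- (i + 1)))" by simp
    with 3 assms show ?thesis by (simp add: line_def ray_def)
  qed
qed

section \<open>Digraphs with unique paths\<close>

text \<open>The assumptions come in pairs exchanged by reversing \<open>E\<close>, so the locale
  contains its own dual. \<open>parent\<close> and \<open>child\<close> express uniqueness of
  directed paths step by step, from the lower and from the upper end.\<close>

locale path_digraph =
  fixes V :: "'v set" and E :: "'v rel"
  assumes EV: "E \<subseteq> V \<times> V"
    and acyc: "acyclic E"
    and parent: "(w1, w) \<in> E \<Longrightarrow> (w2, w) \<in> E \<Longrightarrow> (u, w1) \<in> E\<^sup>* \<Longrightarrow> (u, w2) \<in> E\<^sup>* \<Longrightarrow> w1 = w2"
    and child: "(w, w1) \<in> E \<Longrightarrow> (w, w2) \<in> E \<Longrightarrow> (w1, u) \<in> E\<^sup>* \<Longrightarrow> (w2, u) \<in> E\<^sup>* \<Longrightarrow> w1 = w2"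
    and meet: "(x, a) \<in> E\<^sup>* \<Longrightarrow> (y, a) \<in> E\<^sup>* \<Longrightarrow>
      \<exists>z. (x, z) \<in> E\<^sup>* \<and> (y, z) \<in> E\<^sup>* \<and> (\<forall>b. (x, b) \<in> E\<^sup>* \<and> (y, b) \<in> E\<^sup>* \<longrightarrow> (z, b) \<in> E\<^sup>*)"
    and join: "(a, x) \<in> E\<^sup>* \<Longrightarrow> (a, y) \<in> E\<^sup>* \<Longrightarrow>
      \<exists>z. (z, x) \<in> E\<^sup>* \<and> (z, y) \<in> E\<^sup>* \<and> (\<forall>b. (b, x) \<in> E\<^sup>* \<and> (b, y) \<in> E\<^sup>* \<longrightarrow> (b, z) \<in> E\<^sup>*)"
    and out2: "v \<in> V \<Longrightarrow> \<exists>w1 w2. w1 \<noteq> w2 \<and> (v, w1) \<in> E \<and> (v, w2) \<in> E"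
    and in2: "v \<in> V \<Longrightarrow> \<exists>w1 w2. w1 \<noteq> w2 \<and> (w1, v) \<in> E \<and> (w2, v) \<in> E"
begin

lemma dual: "path_digraph V (E\<inverse>)"
proof
  show "E\<inverse> \<subseteq> V \<times> V" using EV by auto
  show "acyclic (E\<inverse>)" using acyc by simp
  show "w1 = w2" if "(w1, w) \<in> E\<inverse>" "(w2, w) \<in> E\<inverse>" "(u, w1) \<in> (E\<inverse>)\<^sup>*" "(u, w2) \<in> (E\<inverse>)\<^sup>*" for w1 w2 w u
    using that child[of w w1 w2 u] by (simp add: rtrancl_converse)
  show "w1 = w2" if "(w, w1) \<in> E\<inverse>" "(w, w2) \<in> E\<inverse>" "(w1, u) \<in> (E\<inverse>)\<^sup>*" "(w2, u) \<in> (E\<inverse>)\<^sup>*" for w1 w2 w u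
    using that parent[of w1 w w2 u] by (simp add: rtrancl_converse)
qed (simp_all add: rtrancl_converse join meet in2 out2)

lemma antisym_path: "(a, b) \<in> E\<^sup>* \<Longrightarrow> (b, a) \<in> E\<^sup>* \<Longrightarrow> a = b"
  using acyc by (metis acyclic_def rtranclD rtrancl_trancl_trancl)

text \<open>Going up from \<open>v\<close> inside the descendants of \<open>r\<close> leaves one
  choice of parent at each step, so the ways up to \<open>p\<close> and to \<open>q\<close> coincide
  until one of them stops.\<close>

lemma interval_chain:
  assumes "(q, v) \<in> E\<^sup>*" "(p, v) \<in> E\<^sup>*" "(r, p) \<in> E\<^sup>*" "(r, q) \<in> E\<^sup>*"
  shows "(p, q) \<in> E\<^sup>* \<or> (q, p) \<in> E\<^sup>*"
  using assms
proof (induction rule: rtrancl_induct)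
  case (step v' v)
  consider "p = v" | p' where "(p, p') \<in> E\<^sup>*" "(p', v) \<in> E"
    using step.prems(1) by (meson rtranclE)
  then show ?case
  proof cases
    case 1
    then show ?thesis using step.hyps by (auto intro: rtrancl_into_rtrancl)
  next
    case 2
    then have "p' = v'" using step by (meson parent rtrancl_trans)
    then show ?thesis using step 2 by blast
  qed
qed auto

lemma edge_between:
  assumes "(a, b) \<in> E" "(a, z) \<in> E\<^sup>*" "(z, b) \<in> E\<^sup>*"
  shows "z = a \<or> z = b"
  using assms(3)
proof (cases rule: rtranclE)
  case (step p)
  then have "p = a" using assms parent[of p b a a] by (meson rtrancl.rtrancl_refl rtrancl_trans)
  then show ?thesis using step antisym_path assms by blast
qed simp

text \<open>The meet \<open>z\<close> of \<open>p\<close> and \<open>v\<close> lies above both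
  \<open>a1\<close> and \<open>a2\<close>. On the paths from \<open>v\<close> to these vertices it
  is either \<open>v\<close> itself or below \<open>w1\<close>, and likewise for \<open>w2\<close>;
  being below both children contradicts \<open>child\<close>, so \<open>z\<close> is
  \<open>v\<close>.\<close>

lemma above_branch:
  assumes v: "(v, w1) \<in> E" "(v, w2) \<in> E" "w1 \<noteq> w2"
    and a: "(w1, a1) \<in> E\<^sup>*" "(p, a1) \<in> E\<^sup>*" "(w2, a2) \<in> E\<^sup>*" "(p, a2) \<in> E\<^sup>*"
  shows "(p, v) \<in> E\<^sup>*"
proof -
  have va: "(v, a1) \<in> E\<^sup>*" "(v, a2) \<in> E\<^sup>*" using v a by (meson converse_rtrancl_into_rtrancl)+
  obtain z where z: "(p, z) \<in> E\<^sup>*" "(v, z) \<in> E\<^sup>*" "(z, a1) \<in> E\<^sup>*" "(z, a2) \<in> E\<^sup>*"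
    using meet[OF a(2) va(1)] va a by metis
  have "z = v \<or> (w, z) \<in> E\<^sup>*" if "(v, w) \<in> E" "(w, a) \<in> E\<^sup>*" "(z, a) \<in> E\<^sup>*" for w a
    using interval_chain[of w a z v] edge_between[OF that(1)] that z by blast
  from this[OF v(1) a(1) z(3)] this[OF v(2) a(3) z(4)] have "z = v"
    using child[OF v(1,2)] v(3) by blast
  with z show ?thesis by simp
qed

text \<open>Rays to the two ends are started at the common vertex \<open>a\<close> and followed to
  the last vertex \<open>c\<close> before they first differ; \<open>above_branch\<close> at
  \<open>c\<close> shows that nothing but the ancestors of \<open>c\<close> lies in both
  ends.\<close>

lemma ends_diverge:
  assumes F: "is_end E F1" "is_end E F2" "F1 \<noteq> F2" and a: "a \<in> F1" "a \<in> F2"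
  obtains c x1 x2 where "ray E x1" "ray E x2" "x1 0 = c" "x2 0 = c" "x1 1 \<noteq> x2 1"
    "F1 = end_of E x1" "F2 = end_of E x2" "F1 \<inter> F2 = {v. (v, c) \<in> E\<^sup>*}"
proof -
  obtain z1 where z1: "ray E z1" "z1 0 = a" "F1 = end_of E z1" using is_end_from[OF F(1) a(1)] .
  obtain z2 where z2: "ray E z2" "z2 0 = a" "F2 = end_of E z2" using is_end_from[OF F(2) a(2)] .
  have "z1 \<noteq> z2" using F(3) z1 z2 by blast
  then have "\<exists>k. z1 k \<noteq> z2 k" by (simp add: fun_eq_iff)
  then obtain k where k: "z1 k \<noteq> z2 k" "\<forall>j<k. z1 j = z2 j"
    using exists_least_iff[of "\<lambda>k. z1 k \<noteq> z2 k"] by blast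
  \<comment> \<open>Both rays start at \<open>a\<close>, so the first difference cannot be at index
    0.\<close>
  then obtain m where m: "k = Suc m" using z1 z2 by (cases k) auto
  define c where "c = z1 m"
  have c: "z2 m = c" "z1 m = c" using k m by (auto simp: c_def)
  have shift: "end_of E (\<lambda>i. z (m + i)) = end_of E z \<and> ray E (\<lambda>i. z (m + i))" if "ray E z" for z
  proof -
    have "\<exists>j. (v, z (m + j)) \<in> E\<^sup>*" if "(v, z i) \<in> E\<^sup>*" for v i
      using that ray_rtrancl[OF \<open>ray E z\<close>, of i "m + i"] by (meson le_add2 rtrancl_trans)
    then show ?thesis using that by (auto simp: end_of_def ray_def)
  qed
  have e: "(c, z1 (Suc m)) \<in> E" "(c, z2 (Suc m)) \<in> E"
    using z1(1) z2(1) c by (metis ray_def)+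
  have "F1 \<inter> F2 \<subseteq> {v. (v, c) \<in> E\<^sup>*}"
  proof
    fix v assume v: "v \<in> F1 \<inter> F2"
    obtain a1 where a1: "(z1 (Suc m), a1) \<in> E\<^sup>*" "(v, a1) \<in> E\<^sup>*"
      using is_end_directed[OF F(1)] v z1(3) end_of_self[of z1 "Suc m" E] by blast
    obtain a2 where a2: "(z2 (Suc m), a2) \<in> E\<^sup>*" "(v, a2) \<in> E\<^sup>*"
      using is_end_directed[OF F(2)] v z2(3) end_of_self[of z2 "Suc m" E] by blast
    show "v \<in> {v. (v, c) \<in> E\<^sup>*}" using above_branch[OF e _ a1 a2] k m by simp
  qed
  moreover have "{v. (v, c) \<in> E\<^sup>*} \<subseteq> F1 \<inter> F2"
    using is_end_up[OF F(1), of c] is_end_up[OF F(2), of c] c z1(3) z2(3)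
      end_of_self[of z1 m E] end_of_self[of z2 m E] by auto
  ultimately have "F1 \<inter> F2 = {v. (v, c) \<in> E\<^sup>*}" by blast
  then show thesis
    using that[of "\<lambda>i. z1 (m + i)" "\<lambda>i. z2 (m + i)" c] shift[OF z1(1)] shift[OF z2(1)] c k m z1 z2
    by simp
qed

lemma ex_end:
  assumes "v \<in> V"
  obtains F where "is_end E F" "v \<in> F"
proof -
  have "\<exists>x. \<forall>n. (x n \<in> V \<and> (n = 0 \<longrightarrow> x n = v)) \<and> (x n, x (Suc n)) \<in> E"
  proof (rule dependent_nat_choice)
    show "\<exists>x. x \<in> V \<and> (0 = (0::nat) \<longrightarrow> x = v)" using assms by blast
    show "\<exists>y. (y \<in> V \<and> (Suc n = 0 \<longrightarrow> y = v)) \<and> (x, y) \<in> E" if "x \<in> V \<and> (n = 0 \<longrightarrow> x = v)" for x n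
      using out2[of x] that EV by auto
  qed
  then obtain x where "ray E x" "x 0 = v" by (auto simp: ray_def)
  then show thesis using that[of "end_of E x"] end_of_self[of x 0 E] by (auto simp: is_end_def)
qed

text \<open>An end is directed downwards, whereas a dual end contains both children of each of its
  vertices, and these have no common descendant. So the bare set tells a lower point from an upper
  one, and no automorphism can mix the levels.\<close>

lemma end_not_dual_end: "is_end E F \<Longrightarrow> \<not> is_end (E\<inverse>) F"
proof
  assume F: "is_end E F" "is_end (E\<inverse>) F"
  then obtain v where v: "v \<in> F" using is_end_nonempty by blast
  then have "v \<in> V" using is_end_subset[OF F(1) EV] by auto
  then obtain w1 w2 where w: "w1 \<noteq> w2" "(v, w1) \<in> E" "(v, w2) \<in> E" using out2 by blast
  then have "w1 \<in> F" "w2 \<in> F" using is_end_down[OF F(2) v] by auto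
  then obtain u where "(w1, u) \<in> E\<^sup>*" "(w2, u) \<in> E\<^sup>*" using is_end_directed[OF F(1)] by metis
  with child w show False by blast
qed

section \<open>Lines and \<open>Y\<close>-configurations\<close>

lemma ray_inj:
  assumes x: "ray E x" shows "x i = x j \<longleftrightarrow> i = j"
proof -
  have "x i \<noteq> x j" if "i < j" for i j
  proof
    assume eq: "x i = x j"
    have "(x i, x (Suc i)) \<in> E" using x by (simp add: ray_def)
    moreover have "(x (Suc i), x j) \<in> E\<^sup>*" using ray_rtrancl[OF x] that by simp
    ultimately have "(x i, x i) \<in> E\<^sup>+" using eq by (metis rtrancl_into_trancl2)
    then show False using acyc by (auto simp: acyclic_def)
  qed
  then show ?thesis by (metis linorder_neqE_nat)
qed

lemma line_above:
  assumes x: "ray E x" and y: "ray (E\<inverse>) y" "x 0 = y 0" and i: "i < 0"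
  shows "(line x y i, y 1) \<in> E\<^sup>*" "(y 1, x 0) \<in> E" "line x y i \<noteq> x j"
proof -
  show a: "(line x y i, y 1) \<in> E\<^sup>*"
    using ray_rtrancl[OF y(1), of 1 "nat (- i)"] i by (simp add: line_def rtrancl_converse)
  show b: "(y 1, x 0) \<in> E" using y by (auto simp: ray_def dest: spec[of _ 0])
  have c: "(x 0, x j) \<in> E\<^sup>*" using ray_rtrancl[OF x] by simp
  show "line x y i \<noteq> x j"
  proof
    assume "line x y i = x j"
    with a b c have "(x 0, x 0) \<in> E\<^sup>+" by (metis rtrancl_trans rtrancl_into_trancl1)
    then show False using acyc by (auto simp: acyclic_def)
  qed
qed

lemma inj_line:
  assumes x: "ray E x" and y: "ray (E\<inverse>) y" "x 0 = y 0"
  shows "inj (line x y)"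
proof (rule injI)
  fix i j assume eq: "line x y i = line x y j"
  interpret d: path_digraph V "E\<inverse>" by (rule dual)
  consider "i \<ge> 0" "j \<ge> 0" | "i < 0" "j < 0" | "i < 0" "j \<ge> 0" | "i \<ge> 0" "j < 0" by linarith
  then show "i = j"
  proof cases
    case 1
    then show ?thesis using eq ray_inj[OF x] by (simp add: line_def)
  next
    case 2
    then show ?thesis using eq d.ray_inj[OF y(1)] by (auto simp: line_def)
  next
    case 3
    then have "line x y i = x (nat j)" using eq by (simp add: line_def)
    then show ?thesis using line_above(3)[OF x y 3(1)] by blast
  next
    case 4
    then have "line x y j = x (nat i)" using eq by (simp add: line_def)
    then show ?thesis using line_above(3)[OF x y 4(2)] by blast
  qed
qed

text \<open>It is enough that the branches differ at their first step: a vertex common to both would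
  be an ancestor of the two parents \<open>y1 1\<close> and \<open>y2 1\<close> of
  \<open>x 0\<close>, and \<open>parent\<close> would identify them.\<close>

lemma Y_configuration_line:
  assumes x: "ray E x" and y: "ray (E\<inverse>) y1" "ray (E\<inverse>) y2" "x 0 = y1 0" "x 0 = y2 0" "y1 1 \<noteq> y2 1"
  shows "Y_configuration E (line x y1) (line x y2)"
  unfolding Y_configuration_def
proof (intro conjI allI)
  fix i j
  have "line x y1 i \<noteq> line x y2 j" if "i < 0" "j < 0"
  proof
    assume "line x y1 i = line x y2 j"
    then have "y1 1 = y2 1"
      using line_above[OF x y(1,3) that(1)] line_above[OF x y(2,4) that(2)] parent by metis
    with y show False by blast
  qed
  moreover have "line x y1 i \<noteq> line x y2 j" if "i < 0" "j \<ge> 0"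
    using line_above(3)[OF x y(1,3) that(1)] that(2) by (simp add: line_def)
  moreover have "line x y1 i \<noteq> line x y2 j" if "i \<ge> 0" "j < 0"
    using line_above(3)[OF x y(2,4) that(2)] that(1) by (metis line_def)
  moreover have "line x y1 i = line x y2 j \<longleftrightarrow> i = j" if "i \<ge> 0" "j \<ge> 0"
    using ray_inj[OF x] that by (simp add: line_def eq_nat_nat_iff)
  ultimately show "line x y1 i = line x y2 j \<longleftrightarrow> i = j \<and> 0 \<le> i"
    by (metis linorder_not_le)
qed (rule directed_line_line inj_line x y)+

text \<open>Turns transitivity on labelled configurations into transitivity on triples of ends, by
  choosing representing rays that together form a configuration.\<close>

lemma ends_transitive:
  assumes Y: "Y_transitive V E"
    and F: "is_end E F" "is_end (E\<inverse>) I" "is_end (E\<inverse>) J" "I \<noteq> J" "F \<inter> I \<noteq> {}" "F \<inter> J \<noteq> {}"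
    and F': "is_end E F'" "is_end (E\<inverse>) I'" "is_end (E\<inverse>) J'" "I' \<noteq> J'" "F' \<inter> I' \<noteq> {}" "F' \<inter> J' \<noteq> {}"
  shows "\<exists>g. rel_aut V E g \<and> g ` F = F' \<and> g ` I = I' \<and> g ` J = J'"
proof -
  interpret d: path_digraph V "E\<inverse>" by (rule dual)
  have conf: "\<exists>x y z. ray E x \<and> ray (E\<inverse>) y \<and> ray (E\<inverse>) z \<and> x 0 = y 0 \<and> x 0 = z 0 \<and> y 1 \<noteq> z 1 \<and>
      F = end_of E x \<and> I = end_of (E\<inverse>) y \<and> J = end_of (E\<inverse>) z"
    if F: "is_end E F" "is_end (E\<inverse>) I" "is_end (E\<inverse>) J" "I \<noteq> J" "F \<inter> I \<noteq> {}" "F \<inter> J \<noteq> {}" for F I J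
  proof -
    obtain p q where pq: "p \<in> F" "p \<in> I" "q \<in> F" "q \<in> J" using F by blast
    then obtain t where t: "t \<in> F" "(p, t) \<in> E\<^sup>*" "(q, t) \<in> E\<^sup>*" using is_end_directed[OF F(1)] by metis
    have tI: "t \<in> I" "t \<in> J" using is_end_down[OF F(2) pq(2) t(2)] is_end_down[OF F(3) pq(4) t(3)] by auto
    \<comment> \<open>Read upside down, \<open>ends_diverge\<close> gives the vertex
      \<open>c\<close> at which the two ascending rays separate. It is above \<open>t\<close>, hence
      belongs to \<open>F\<close>, and one descending ray from \<open>c\<close> completes both
      lines.\<close>
    obtain c y z where yz: "ray (E\<inverse>) y" "ray (E\<inverse>) z" "y 0 = c" "z 0 = c" "y 1 \<noteq> z 1"
      "I = end_of (E\<inverse>) y" "J = end_of (E\<inverse>) z" "I \<inter> J = {v. (v, c) \<in> (E\<inverse>)\<^sup>*}"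
      by (rule d.ends_diverge[OF F(2,3,4) \<open>t \<in> I\<close> \<open>t \<in> J\<close>])
    have "(c, t) \<in> E\<^sup>*" using yz(8) \<open>t \<in> I\<close> \<open>t \<in> J\<close> by (auto simp: rtrancl_converse)
    then have "c \<in> F" using is_end_up[OF F(1) t(1)] by blast
    then obtain x where x: "ray E x" "x 0 = c" "F = end_of E x" using is_end_from[OF F(1)] by blast
    have "x 0 = y 0" "x 0 = z 0" using x(2) yz(3,4) by simp_all
    then show ?thesis using x(1,3) yz(1,2,5,6,7) by blast
  qed
  obtain x y z where l: "ray E x" "ray (E\<inverse>) y" "ray (E\<inverse>) z" "x 0 = y 0" "x 0 = z 0" "y 1 \<noteq> z 1"
    "F = end_of E x" "I = end_of (E\<inverse>) y" "J = end_of (E\<inverse>) z" using conf[OF F] by (elim exE conjE) (rule that)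
  obtain x' y' z' where l': "ray E x'" "ray (E\<inverse>) y'" "ray (E\<inverse>) z'" "x' 0 = y' 0" "x' 0 = z' 0" "y' 1 \<noteq> z' 1"
    "F' = end_of E x'" "I' = end_of (E\<inverse>) y'" "J' = end_of (E\<inverse>) z'" using conf[OF F'] by (elim exE conjE) (rule that)
  obtain g where g: "rel_aut V E g"
    "\<And>i. g (line x y i) = line x' y' i \<and> g (line x z i) = line x' z' i"
    using Y Y_configuration_line[OF l(1-6)] Y_configuration_line[OF l'(1-6)]
    unfolding Y_transitive_def by meson
  have 0: "g (x n) = x' n" for n using g(2)[of "int n"] by (simp add: line_def)
  have 1: "g (y n) = y' n \<and> g (z n) = z' n" for n
    using g(2)[of "- int n"] l(4,5) l'(4,5) by (simp add: line_minus)
  have "g \<circ> x = x'" "g \<circ> y = y'" "g \<circ> z = z'" using 0 1 by auto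
  moreover have "rel_aut V (E\<inverse>) g" using g(1) by (simp add: rel_iso_converse)
  ultimately show ?thesis
    using g(1) l l' end_of_image(1)[OF g(1) EV l(1)] end_of_image(1)[OF _ d.EV l(2)]
      end_of_image(1)[OF _ d.EV l(3)] by (intro exI[of _ g]) simp
qed

end

section \<open>The two-level order of a set of ends\<close>

text \<open>Ends are accessed through a labelling \<open>\<phi>\<close>, so that the points of the
  order may have any type; in the application they are natural numbers.\<close>

definition end_order :: "'c set \<Rightarrow> 'c set \<Rightarrow> ('c \<Rightarrow> 'v set) \<Rightarrow> 'c rel" where
  "end_order X Y \<phi> = Id_on (X \<union> Y) \<union> {(x, y) \<in> X \<times> Y. \<phi> x \<inter> \<phi> y \<noteq> {}}"

text \<open>In \<open>homX\<close> and \<open>homY\<close> the automorphism must also permute the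
  chosen ends, since otherwise it would not act on the order. The assumptions again form pairs under
  reversal, which exchanges \<open>X\<close> and \<open>Y\<close>.\<close>

locale end_poset = path_digraph V E for V :: "'v set" and E +
  fixes X Y :: "'c set" and \<phi> :: "'c \<Rightarrow> 'v set"
  assumes disj: "X \<inter> Y = {}"
    and endX: "x \<in> X \<Longrightarrow> is_end E (\<phi> x)"
    and endY: "y \<in> Y \<Longrightarrow> is_end (E\<inverse>) (\<phi> y)"
    and inj_phi: "inj_on \<phi> (X \<union> Y)"
    and covX: "v \<in> V \<Longrightarrow> \<exists>x\<in>X. v \<in> \<phi> x"
    and covY: "v \<in> V \<Longrightarrow> \<exists>y\<in>Y. v \<in> \<phi> y"
    and conn: "connected_on V E"
    and homX: "\<lbrakk>x \<in> X; y1 \<in> Y; y2 \<in> Y; y1 \<noteq> y2; \<phi> x \<inter> \<phi> y1 \<noteq> {}; \<phi> x \<inter> \<phi> y2 \<noteq> {};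
      x' \<in> X; y1' \<in> Y; y2' \<in> Y; y1' \<noteq> y2'; \<phi> x' \<inter> \<phi> y1' \<noteq> {}; \<phi> x' \<inter> \<phi> y2' \<noteq> {}\<rbrakk> \<Longrightarrow>
      \<exists>g. rel_aut V E g \<and> (`) g ` \<phi> ` (X \<union> Y) = \<phi> ` (X \<union> Y) \<and>
        g ` \<phi> x = \<phi> x' \<and> g ` \<phi> y1 = \<phi> y1' \<and> g ` \<phi> y2 = \<phi> y2'"
    and homY: "\<lbrakk>y \<in> Y; x1 \<in> X; x2 \<in> X; x1 \<noteq> x2; \<phi> y \<inter> \<phi> x1 \<noteq> {}; \<phi> y \<inter> \<phi> x2 \<noteq> {};
      y' \<in> Y; x1' \<in> X; x2' \<in> X; x1' \<noteq> x2'; \<phi> y' \<inter> \<phi> x1' \<noteq> {}; \<phi> y' \<inter> \<phi> x2' \<noteq> {}\<rbrakk> \<Longrightarrow>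
      \<exists>g. rel_aut V E g \<and> (`) g ` \<phi> ` (X \<union> Y) = \<phi> ` (X \<union> Y) \<and>
        g ` \<phi> y = \<phi> y' \<and> g ` \<phi> x1 = \<phi> x1' \<and> g ` \<phi> x2 = \<phi> x2'"
begin

abbreviation r :: "'c rel" where "r \<equiv> end_order X Y \<phi>"

text \<open>The candidate for the ramification point at \<open>v\<close>: the ideal of the lower
  points below it.\<close>

definition L :: "'v \<Rightarrow> 'c set" where "L v = {x \<in> X. v \<in> \<phi> x}"

lemma dual_poset: "end_poset V (E\<inverse>) Y X \<phi>"
proof -
  interpret d: path_digraph V "E\<inverse>" by (rule dual)
  show ?thesis
  proof
    show "Y \<inter> X = {}" using disj by auto
    show "inj_on \<phi> (Y \<union> X)" using inj_phi by (simp add: Un_commute)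
    show "connected_on V (E\<inverse>)" using conn by (simp add: connected_on_def Un_commute)
  qed (simp_all add: endX endY covX covY rel_iso_converse Un_commute[of Y X] homX homY)
qed

lemma in_r: "(a, b) \<in> r \<longleftrightarrow> a = b \<and> a \<in> X \<union> Y \<or> a \<in> X \<and> b \<in> Y \<and> \<phi> a \<inter> \<phi> b \<noteq> {}"
  by (auto simp: end_order_def)

lemma end_order_converse: "end_order Y X \<phi> = r\<inverse>"
  by (auto simp: end_order_def)

lemma Field_r: "Field r = X \<union> Y"
  by (auto simp: Field_def in_r)

lemma phi_V: "a \<in> X \<union> Y \<Longrightarrow> \<phi> a \<subseteq> V"
  using is_end_subset[OF endX EV] is_end_subset[OF endY, of _ V] EV by blast

lemma phi_nonempty: "a \<in> X \<union> Y \<Longrightarrow> \<phi> a \<noteq> {}"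
  using is_end_nonempty[OF endX] is_end_nonempty[OF endY] by blast

lemma partial_order_r: "Partial_order r"
proof -
  have "Refl r" by (auto simp: refl_on_def Field_r in_r)
  moreover have "trans r" using disj by (auto simp: trans_def in_r)
  moreover have "antisym r" using disj by (auto simp: antisym_def in_r)
  moreover have "r \<subseteq> Field r \<times> Field r" by (auto intro: FieldI1 FieldI2)
  ultimately show ?thesis by (simp add: partial_order_on_def preorder_on_def)
qed

lemma under_X: "x \<in> X \<Longrightarrow> under r x = {x}"
  using disj by (auto simp: under_def in_r)

text \<open>Two ends that leave \<open>v\<close> through different children pin it down. By
  \<open>above_branch\<close> only ancestors of \<open>v\<close> lie in both, and an upper point
  related to both contains such an ancestor and is closed downwards.\<close>

lemma branching:
  assumes "v \<in> V"
  obtains x1 x2 where "x1 \<in> X" "x2 \<in> X" "x1 \<noteq> x2" "v \<in> \<phi> x1" "v \<in> \<phi> x2"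
    "\<And>p. p \<in> \<phi> x1 \<Longrightarrow> p \<in> \<phi> x2 \<Longrightarrow> (p, v) \<in> E\<^sup>*"
    "\<And>b. b \<in> Y \<Longrightarrow> \<phi> x1 \<inter> \<phi> b \<noteq> {} \<Longrightarrow> \<phi> x2 \<inter> \<phi> b \<noteq> {} \<Longrightarrow> v \<in> \<phi> b"
proof -
  obtain w1 w2 where w: "w1 \<noteq> w2" "(v, w1) \<in> E" "(v, w2) \<in> E" using out2 assms by blast
  then have "w1 \<in> V" "w2 \<in> V" using EV by auto
  then obtain x1 x2 where x: "x1 \<in> X" "x2 \<in> X" "w1 \<in> \<phi> x1" "w2 \<in> \<phi> x2" using covX by meson
  have ne: "x1 \<noteq> x2"
  proof
    assume "x1 = x2"
    then obtain u where "(w1, u) \<in> E\<^sup>*" "(w2, u) \<in> E\<^sup>*"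
      using is_end_directed[OF endX[OF x(1)] x(3)] x(4) by metis
    with child w show False by blast
  qed
  have v: "v \<in> \<phi> x1" "v \<in> \<phi> x2"
    using is_end_up[OF endX[OF x(1)] x(3)] is_end_up[OF endX[OF x(2)] x(4)] w by auto
  have p: "(p, v) \<in> E\<^sup>*" if p: "p \<in> \<phi> x1" "p \<in> \<phi> x2" for p
  proof -
    obtain a1 where "(w1, a1) \<in> E\<^sup>*" "(p, a1) \<in> E\<^sup>*"
      using is_end_directed[OF endX[OF x(1)] x(3) p(1)] by metis
    moreover obtain a2 where "(w2, a2) \<in> E\<^sup>*" "(p, a2) \<in> E\<^sup>*"
      using is_end_directed[OF endX[OF x(2)] x(4) p(2)] by metis
    ultimately show ?thesis using above_branch w by metis
  qed
  have "v \<in> \<phi> b" if b: "b \<in> Y" "\<phi> x1 \<inter> \<phi> b \<noteq> {}" "\<phi> x2 \<inter> \<phi> b \<noteq> {}" for b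
  proof -
    obtain u1 u2 where u: "u1 \<in> \<phi> x1" "u1 \<in> \<phi> b" "u2 \<in> \<phi> x2" "u2 \<in> \<phi> b" using b by blast
    obtain p where q: "p \<in> \<phi> b" "(p, u1) \<in> E\<^sup>*" "(p, u2) \<in> E\<^sup>*"
      using is_end_directed[OF endY[OF b(1)] u(2,4)] by (auto simp: rtrancl_converse)
    have "p \<in> \<phi> x1" "p \<in> \<phi> x2"
      using is_end_up[OF endX[OF x(1)] u(1) q(2)] is_end_up[OF endX[OF x(2)] u(3) q(3)] by auto
    then show ?thesis using p is_end_down[OF endY[OF b(1)] q(1)] by blast
  qed
  with x ne v p that show thesis by blast
qed

lemma branching_Y:
  assumes "v \<in> V"
  obtains y1 y2 where "y1 \<in> Y" "y2 \<in> Y" "y1 \<noteq> y2" "v \<in> \<phi> y1" "v \<in> \<phi> y2"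
    "\<And>b. b \<in> X \<Longrightarrow> \<phi> y1 \<inter> \<phi> b \<noteq> {} \<Longrightarrow> \<phi> y2 \<inter> \<phi> b \<noteq> {} \<Longrightarrow> v \<in> \<phi> b"
  using end_poset.branching[OF dual_poset assms] by metis

lemma Above_L: "v \<in> V \<Longrightarrow> Above r (L v) = {y \<in> Y. v \<in> \<phi> y}"
proof (intro set_eqI iffI)
  fix b assume v: "v \<in> V" and b: "b \<in> Above r (L v)"
  obtain x1 x2 where x: "x1 \<in> X" "x2 \<in> X" "x1 \<noteq> x2" "v \<in> \<phi> x1" "v \<in> \<phi> x2"
    "\<And>b. b \<in> Y \<Longrightarrow> \<phi> x1 \<inter> \<phi> b \<noteq> {} \<Longrightarrow> \<phi> x2 \<inter> \<phi> b \<noteq> {} \<Longrightarrow> v \<in> \<phi> b"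
    using branching[OF v] by metis
  then have "(x1, b) \<in> r" "(x2, b) \<in> r" using b by (auto simp: Above_def L_def)
  then show "b \<in> {y \<in> Y. v \<in> \<phi> y}" using x disj by (auto simp: in_r)
next
  fix b assume "v \<in> V" "b \<in> {y \<in> Y. v \<in> \<phi> y}"
  then show "b \<in> Above r (L v)" by (auto simp: Above_def L_def Field_r in_r)
qed

lemma Under_Y:
  assumes v: "v \<in> V" shows "Under r {y \<in> Y. v \<in> \<phi> y} = L v"
proof -
  interpret d: end_poset V "E\<inverse>" Y X \<phi> by (rule dual_poset)
  have "Above (r\<inverse>) {y \<in> Y. v \<in> \<phi> y} = L v"
    using d.Above_L[OF v] by (simp add: d.L_def L_def end_order_converse)
  then show ?thesis by (simp add: Above_def Under_def)
qed

lemma L_ideal: "v \<in> V \<Longrightarrow> L v \<in> ideals r"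
  using covX[of v] covY[of v] by (auto simp: ideals_def Above_L Under_Y) (auto simp: L_def)

lemma L_subset_iff: "v \<in> V \<Longrightarrow> L v \<subseteq> L w \<longleftrightarrow> (w, v) \<in> E\<^sup>*"
proof
  assume v: "v \<in> V" and sub: "L v \<subseteq> L w"
  obtain x1 x2 where x: "x1 \<in> X" "x2 \<in> X" "v \<in> \<phi> x1" "v \<in> \<phi> x2"
    "\<And>p. p \<in> \<phi> x1 \<Longrightarrow> p \<in> \<phi> x2 \<Longrightarrow> (p, v) \<in> E\<^sup>*"
    using branching[OF v] by metis
  then have "w \<in> \<phi> x1" "w \<in> \<phi> x2" using sub by (auto simp: L_def)
  with x show "(w, v) \<in> E\<^sup>*" by blast
next
  assume "(w, v) \<in> E\<^sup>*"
  then show "L v \<subseteq> L w" using is_end_up[OF endX] by (auto simp: L_def)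
qed

lemma L_not_embedded: "v \<in> V \<Longrightarrow> L v \<notin> embedded r"
proof
  assume v: "v \<in> V" and "L v \<in> embedded r"
  then obtain a where a: "a \<in> X \<union> Y" "L v = under r a" by (auto simp: embedded_def Field_r)
  then have "a \<in> L v" by (auto simp: under_def in_r)
  then have "L v = {a}" using a under_X by (auto simp: L_def)
  moreover obtain x1 x2 where "x1 \<in> L v" "x2 \<in> L v" "x1 \<noteq> x2"
    using branching[OF v] by (metis (no_types, lifting) L_def mem_Collect_eq)
  ultimately show False by auto
qed

text \<open>The end \<open>\<phi> x\<close> is directed downwards and the dual ends are closed
  downwards, so the two intersection vertices can be pushed down to a common one.\<close>

lemma common_ray_point:
  assumes "x \<in> X" "a \<in> Y" "b \<in> Y" "\<phi> x \<inter> \<phi> a \<noteq> {}" "\<phi> x \<inter> \<phi> b \<noteq> {}"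
  obtains t where "t \<in> \<phi> x" "t \<in> \<phi> a" "t \<in> \<phi> b"
proof -
  obtain p q where pq: "p \<in> \<phi> x" "p \<in> \<phi> a" "q \<in> \<phi> x" "q \<in> \<phi> b" using assms by blast
  then obtain t where t: "t \<in> \<phi> x" "(p, t) \<in> E\<^sup>*" "(q, t) \<in> E\<^sup>*"
    using is_end_directed[OF endX[OF assms(1)]] by metis
  then show thesis
    using that is_end_down[OF endY[OF assms(2)] pq(2)] is_end_down[OF endY[OF assms(3)] pq(4)] by blast
qed

lemma common_ray_point_Y:
  assumes "y \<in> Y" "a \<in> X" "b \<in> X" "\<phi> y \<inter> \<phi> a \<noteq> {}" "\<phi> y \<inter> \<phi> b \<noteq> {}"
  obtains t where "t \<in> \<phi> y" "t \<in> \<phi> a" "t \<in> \<phi> b"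
  using end_poset.common_ray_point[OF dual_poset assms] by metis

section \<open>Ramification points are the ideals \<open>L v\<close>\<close>

lemma in_completion: "(I, J) \<in> completion r \<longleftrightarrow> I \<in> ideals r \<and> J \<in> ideals r \<and> I \<subseteq> J"
  by (simp add: completion_def)

text \<open>Having an ideal below both forces \<open>a\<close> and \<open>b\<close> to be upper
  points. Their dual ends meet, hence separate at a vertex \<open>c\<close>; a lower point related
  to both shares a vertex with both, which is below \<open>c\<close>, so the meet is
  \<open>L c\<close>.\<close>

lemma meet_is_L:
  assumes inc: "incomparable r a b" and x: "is_meet (completion r) (under r a) (under r b) x"
  shows "x \<in> L ` V"
proof -
  have ab: "a \<in> X \<union> Y" "b \<in> X \<union> Y" "(a, b) \<notin> r" "(b, a) \<notin> r"
    using inc by (auto simp: incomparable_def Field_r)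
  have x': "x \<in> ideals r" "x \<subseteq> under r a" "x \<subseteq> under r b" "under r a \<in> ideals r" "under r b \<in> ideals r"
    and least: "\<And>z. z \<in> ideals r \<Longrightarrow> z \<subseteq> under r a \<Longrightarrow> z \<subseteq> under r b \<Longrightarrow> z \<subseteq> x"
    using x by (auto simp: is_meet_def in_completion)
  obtain z where z: "z \<in> x" using x'(1) by (auto simp: ideals_def)
  have "a \<in> Y"
  proof (rule ccontr)
    assume "a \<notin> Y"
    then have "z = a" using ab z x'(2) under_X by auto
    then show False using z x'(3) ab by (auto simp: under_def)
  qed
  moreover have "b \<in> Y"
  proof (rule ccontr)
    assume "b \<notin> Y"
    then have "z = b" using ab z x'(3) under_X by auto
    then show False using z x'(2) ab by (auto simp: under_def)
  qed
  ultimately have Y: "a \<in> Y" "b \<in> Y" by auto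
  have "a \<noteq> b" using ab by (auto simp: in_r)
  have zX: "z \<in> X \<and> \<phi> z \<inter> \<phi> a \<noteq> {} \<and> \<phi> z \<inter> \<phi> b \<noteq> {}" if "z \<in> x" for z
  proof -
    have "(z, a) \<in> r" "(z, b) \<in> r" using that x'(2,3) by (auto simp: under_def)
    then show ?thesis using ab by (auto simp: in_r)
  qed
  obtain t where t: "t \<in> \<phi> a" "t \<in> \<phi> b" using common_ray_point zX[OF z] Y by metis
  interpret d: path_digraph V "E\<inverse>" by (rule dual)
  have "\<phi> a \<noteq> \<phi> b" using inj_phi Y \<open>a \<noteq> b\<close> by (auto simp: inj_on_def)
  then obtain c where "\<phi> a \<inter> \<phi> b = {v. (v, c) \<in> (E\<inverse>)\<^sup>*}"
    using d.ends_diverge[OF endY[OF Y(1)] endY[OF Y(2)] _ t] by metis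
  then have c: "\<phi> a \<inter> \<phi> b = {v. (c, v) \<in> E\<^sup>*}" by (simp add: rtrancl_converse)
  then have cab: "c \<in> \<phi> a" "c \<in> \<phi> b" by auto
  then have cV: "c \<in> V" using phi_V ab by auto
  have "L c \<subseteq> under r a" "L c \<subseteq> under r b" using cab Y by (auto simp: under_def L_def in_r)
  then have "L c \<subseteq> x" using least L_ideal[OF cV] by blast
  moreover have "x \<subseteq> L c"
  proof
    fix z assume "z \<in> x"
    then obtain t where t: "t \<in> \<phi> z" "t \<in> \<phi> a" "t \<in> \<phi> b" "z \<in> X"
      using common_ray_point zX Y by metis
    then have "(c, t) \<in> E\<^sup>*" using c by auto
    then show "z \<in> L c" using is_end_up[OF endX t(1)] t(4) by (auto simp: L_def)
  qed
  ultimately show ?thesis using cV by auto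
qed

text \<open>Now two lower points separate at \<open>c\<close>. That \<open>L c\<close> is contained
  in the join is seen through upper bounds: each upper bound of \<open>x\<close> shares a vertex
  with both ends and so contains \<open>c\<close>, and \<open>x\<close> is recovered from its upper
  bounds.\<close>

lemma join_is_L:
  assumes inc: "incomparable r a b" and x: "is_join (completion r) (under r a) (under r b) x"
  shows "x \<in> L ` V"
proof -
  have ab: "a \<in> X \<union> Y" "b \<in> X \<union> Y" "(a, b) \<notin> r" "(b, a) \<notin> r"
    using inc by (auto simp: incomparable_def Field_r)
  have x': "x \<in> ideals r" "under r a \<subseteq> x" "under r b \<subseteq> x"
    and least: "\<And>z. z \<in> ideals r \<Longrightarrow> under r a \<subseteq> z \<Longrightarrow> under r b \<subseteq> z \<Longrightarrow> x \<subseteq> z"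
    using x by (auto simp: is_join_def in_completion)
  obtain u where u: "u \<in> Above r x" using x'(1) by (auto simp: ideals_def)
  have abx: "a \<in> x" "b \<in> x" using x' ab by (auto simp: under_def in_r)
  then have abu: "(a, u) \<in> r" "(b, u) \<in> r" using u by (auto simp: Above_def)
  then have X: "a \<in> X" "b \<in> X" using ab disj by (auto simp: in_r)
  have "a \<noteq> b" using ab by (auto simp: in_r)
  have uY: "u \<in> Y \<and> \<phi> u \<inter> \<phi> a \<noteq> {} \<and> \<phi> u \<inter> \<phi> b \<noteq> {}" if "u \<in> Above r x" for u
  proof -
    have "(a, u) \<in> r" "(b, u) \<in> r" using that abx by (auto simp: Above_def)
    then show ?thesis using ab by (auto simp: in_r)
  qed
  obtain t where t: "t \<in> \<phi> a" "t \<in> \<phi> b" using common_ray_point_Y uY[OF u] X by metis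
  have "\<phi> a \<noteq> \<phi> b" using inj_phi X \<open>a \<noteq> b\<close> by (auto simp: inj_on_def)
  then obtain c where c: "\<phi> a \<inter> \<phi> b = {v. (v, c) \<in> E\<^sup>*}"
    using ends_diverge[OF endX[OF X(1)] endX[OF X(2)] _ t] by metis
  then have cab: "c \<in> \<phi> a" "c \<in> \<phi> b" by auto
  then have cV: "c \<in> V" using phi_V ab by auto
  have "under r a \<subseteq> L c" "under r b \<subseteq> L c" using cab X by (auto simp: under_X L_def)
  then have "x \<subseteq> L c" using least L_ideal[OF cV] by blast
  moreover have "L c \<subseteq> x"
  proof
    fix z assume z: "z \<in> L c"
    have "(z, u) \<in> r" if u: "u \<in> Above r x" for u
    proof -
      obtain t where t: "t \<in> \<phi> u" "t \<in> \<phi> a" "t \<in> \<phi> b" "u \<in> Y"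
        using common_ray_point_Y uY[OF u] X by metis
      then have "(t, c) \<in> E\<^sup>*" using c by auto
      then have "c \<in> \<phi> u" using is_end_down[OF endY t(1)] t(4) by blast
      then show ?thesis using z t(4) by (auto simp: in_r L_def)
    qed
    then have "z \<in> Under r (Above r x)" using z by (auto simp: Under_def L_def Field_r)
    then show "z \<in> x" using x'(1) by (simp add: ideals_def)
  qed
  ultimately show ?thesis using cV by auto
qed

text \<open>Two dual ends arriving at \<open>v\<close> through different parents have
  \<open>L v\<close> as their meet.\<close>

lemma L_ramification:
  assumes v: "v \<in> V" shows "L v \<in> ramification_points r"
proof -
  obtain y1 y2 where y: "y1 \<in> Y" "y2 \<in> Y" "y1 \<noteq> y2" "v \<in> \<phi> y1" "v \<in> \<phi> y2"
    "\<And>b. b \<in> X \<Longrightarrow> \<phi> y1 \<inter> \<phi> b \<noteq> {} \<Longrightarrow> \<phi> y2 \<inter> \<phi> b \<noteq> {} \<Longrightarrow> v \<in> \<phi> b"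
    using branching_Y[OF v] by metis
  have inc: "incomparable r y1 y2"
    using y disj by (auto simp: incomparable_def Field_r in_r)
  have "under r y \<in> ideals r" if "y \<in> Y" for y
  proof -
    have "Above r (under r y) = {y}"
      using that disj by (auto simp: Above_def under_def in_r Field_r)
    then show ?thesis using that by (auto simp: ideals_def under_def Under_def in_r Field_r)
  qed
  moreover have "L v \<subseteq> under r y1" "L v \<subseteq> under r y2" using y by (auto simp: L_def under_def in_r)
  moreover have "z \<subseteq> L v" if z: "z \<subseteq> under r y1" "z \<subseteq> under r y2" for z
  proof
    fix t assume "t \<in> z"
    then have "(t, y1) \<in> r" "(t, y2) \<in> r" using z by (auto simp: under_def)
    then show "t \<in> L v" using y disj by (auto simp: in_r L_def Int_commute)
  qed
  ultimately have "is_meet (completion r) (under r y1) (under r y2) (L v)"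
    using L_ideal[OF v] y(1,2) by (auto simp: is_meet_def in_completion)
  with inc show ?thesis by (auto simp: ramification_points_def)
qed

lemma ram_verts_eq: "ram_verts r = L ` V"
  unfolding ram_verts_def M_plus_def
  using L_ramification L_not_embedded meet_is_L join_is_L
  by (fastforce simp: ramification_points_def[of r])

text \<open>Reachability of \<open>v\<close> from \<open>u\<close> becomes
  \<open>L v \<subseteq> L u\<close>, and by \<open>edge_between\<close> the edges of the digraph
  are precisely the covers of reachability.\<close>

lemma rel_iso_L: "rel_iso V E (ram_verts r) (ram_edges r) L"
  unfolding rel_iso_def
proof (intro conjI ballI)
  have "inj_on L V"
    by (rule inj_onI) (metis L_subset_iff antisym_path order_refl)
  then show "bij_betw L V (ram_verts r)" by (simp add: bij_betw_def ram_verts_eq)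
  fix u v assume uv: "u \<in> V" "v \<in> V"
  have psub: "L w \<subset> L z \<longleftrightarrow> (z, w) \<in> E\<^sup>* \<and> z \<noteq> w" if "z \<in> V" "w \<in> V" for z w
    using that L_subset_iff antisym_path by (metis psubset_eq rtrancl.rtrancl_refl subset_antisym)
  show "(u, v) \<in> E \<longleftrightarrow> (L u, L v) \<in> ram_edges r"
  proof
    assume e: "(u, v) \<in> E"
    then have "u \<noteq> v" using acyc by (auto simp: acyclic_def)
    then show "(L u, L v) \<in> ram_edges r"
      using e uv psub edge_between[OF e] by (auto simp: ram_edges_def ram_verts_eq)
  next
    assume "(L u, L v) \<in> ram_edges r"
    then have uv': "(u, v) \<in> E\<^sup>*" "u \<noteq> v" and b: "\<And>z. z \<in> V \<Longrightarrow> \<not> (L v \<subset> L z \<and> L z \<subset> L u)"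
      using psub uv by (auto simp: ram_edges_def ram_verts_eq)
    then obtain z where z: "(u, z) \<in> E" "(z, v) \<in> E\<^sup>*" by (metis converse_rtranclE)
    then have "z \<in> V" "u \<noteq> z" using EV acyc by (auto simp: acyclic_def)
    then have "z = v" using b[of z] psub uv z by (metis r_into_rtrancl)
    with z show "(u, v) \<in> E" by simp
  qed
qed

section \<open>The order is two-level, connected and homogeneous\<close>

lemma ex_neighbour: "x \<in> X \<Longrightarrow> \<exists>y\<in>Y. (x, y) \<in> r"
proof -
  assume x: "x \<in> X"
  then obtain v where v: "v \<in> \<phi> x" "v \<in> V" using phi_nonempty[of x] phi_V[of x] by blast
  then obtain y where y: "y \<in> Y" "v \<in> \<phi> y" using covY by blast
  then have "(x, y) \<in> r" using x v by (auto simp: in_r)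
  then show ?thesis using y by blast
qed

lemma ex_neighbour_Y: "y \<in> Y \<Longrightarrow> \<exists>x\<in>X. (x, y) \<in> r"
proof -
  assume y: "y \<in> Y"
  then obtain v where v: "v \<in> \<phi> y" "v \<in> V" using phi_nonempty[of y] phi_V[of y] by blast
  then obtain x where x: "x \<in> X" "v \<in> \<phi> x" using covX by blast
  then have "(x, y) \<in> r" using y v by (auto simp: in_r)
  then show ?thesis using x by blast
qed

text \<open>Every chain, even the empty one, fits inside a related pair \<open>{x, y}\<close>, so a
  maximal chain equals such a pair.\<close>

lemma two_level_r: "two_level r"
  unfolding two_level_def
proof (intro conjI allI impI partial_order_r)
  fix C assume C: "pred_on.maxchain (Field r) (\<lambda>x y. (x, y) \<in> r) C"
  interpret pred_on "Field r" "\<lambda>x y. (x, y) \<in> r" .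
  have "chain C" and max: "\<And>S. chain S \<Longrightarrow> \<not> C \<subset> S"
    using C unfolding maxchain_def by blast+
  then have "C \<subseteq> Field r \<and> (\<forall>a\<in>C. \<forall>b\<in>C. (a, b) \<in> r \<or> (b, a) \<in> r \<or> a = b)"
    unfolding chain_def by blast
  then have ch: "C \<subseteq> X \<union> Y" "\<And>a b. a \<in> C \<Longrightarrow> b \<in> C \<Longrightarrow> (a, b) \<in> r \<or> (b, a) \<in> r"
    unfolding Field_r in_r by blast+
  have eqX: "a = b" if "a \<in> C" "b \<in> C" "a \<in> X" "b \<in> X" for a b
    using ch(2)[OF that(1,2)] that disj by (auto simp: in_r)
  have eqY: "a = b" if "a \<in> C" "b \<in> C" "a \<in> Y" "b \<in> Y" for a b
    using ch(2)[OF that(1,2)] that disj by (auto simp: in_r)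
  have "\<exists>x\<in>X. \<exists>y\<in>Y. (x, y) \<in> r \<and> C \<subseteq> {x, y}"
  proof (cases "C \<inter> X = {}")
    case True
    then have CY: "C \<subseteq> Y" using ch by auto
    obtain v where "v \<in> V" using conn by (auto simp: connected_on_def)
    then obtain y where y: "y \<in> Y" "C \<subseteq> {y}"
      using covY eqY CY by (cases "C = {}") blast+
    then show ?thesis using ex_neighbour_Y by blast
  next
    case False
    then obtain x where x: "x \<in> C" "x \<in> X" by auto
    show ?thesis
    proof (cases "C \<inter> Y = {}")
      case True
      then have "C \<subseteq> {x}" using ch(1) eqX x by blast
      then show ?thesis using ex_neighbour x by blast
    next
      case False
      then obtain y where y: "y \<in> C" "y \<in> Y" by auto
      then have "(x, y) \<in> r" using ch(2)[OF x(1) y(1)] x disj by (auto simp: in_r)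
      moreover have "C \<subseteq> {x, y}" using ch(1) eqX eqY x y by blast
      ultimately show ?thesis using x y by blast
    qed
  qed
  then obtain x y where xy: "x \<in> X" "y \<in> Y" "(x, y) \<in> r" "C \<subseteq> {x, y}" by blast
  have "chain {x, y}" unfolding chain_def using xy by (auto simp: Field_r in_r)
  then have "C = {x, y}" using max xy(4) by blast
  moreover have "x \<noteq> y" using xy disj by auto
  ultimately show "card C = 2" by simp
qed

text \<open>Points whose ends share a vertex are linked through a pair \<open>x\<close>,
  \<open>y\<close> at that vertex. Along a walk in the digraph one passes from vertex to vertex by
  an end that contains both vertices of the current edge.\<close>

lemma connected_r: "connected_poset r"
proof -
  let ?R = "(r \<union> r\<inverse>)\<^sup>*"
  have sym: "(b, a) \<in> ?R" if "(a, b) \<in> ?R" for a b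
    using that sym_rtrancl[of "r \<union> r\<inverse>"] by (metis sym_Un_converse symD)
  have share: "(a, b) \<in> ?R" if "a \<in> X \<union> Y" "b \<in> X \<union> Y" "v \<in> \<phi> a" "v \<in> \<phi> b" for a b v
  proof -
    have "v \<in> V" using that phi_V by blast
    then obtain x where x: "x \<in> X" "v \<in> \<phi> x" using covX by blast
    obtain y where y: "y \<in> Y" "v \<in> \<phi> y" using covY \<open>v \<in> V\<close> by blast
    have xy: "(x, y) \<in> r" using x y by (auto simp: in_r)
    have "(c, x) \<in> ?R" if "c \<in> X \<union> Y" "v \<in> \<phi> c" for c
    proof (cases "c \<in> X")
      case True
      then have "(c, y) \<in> r" using y that by (auto simp: in_r)
      then have "(c, y) \<in> r \<union> r\<inverse>" "(y, x) \<in> r \<union> r\<inverse>" using xy by auto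
      then show ?thesis by (meson r_into_rtrancl rtrancl_trans)
    next
      case False
      then have "(x, c) \<in> r" using x that by (auto simp: in_r)
      then show ?thesis by auto
    qed
    then show ?thesis using that sym by (meson rtrancl_trans)
  qed
  have "(a, b) \<in> ?R" if "(u, v) \<in> (E \<union> E\<inverse>)\<^sup>*" "a \<in> X \<union> Y" "b \<in> X \<union> Y" "u \<in> \<phi> a" "v \<in> \<phi> b" for u v a b
    using that
  proof (induction arbitrary: b rule: rtrancl_induct)
    case base
    then show ?case using share by blast
  next
    case (step v v')
    then have V: "v \<in> V" "v' \<in> V" using EV by auto
    have "\<exists>c\<in>X \<union> Y. v \<in> \<phi> c \<and> v' \<in> \<phi> c"
    proof (cases "(v, v') \<in> E")
      case True
      obtain x where x: "x \<in> X" "v' \<in> \<phi> x" using covX V by blast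
      then have "v \<in> \<phi> x" using is_end_up[OF endX x(2)] True by blast
      with x show ?thesis by blast
    next
      case False
      then have e: "(v', v) \<in> E" using step by auto
      obtain x where x: "x \<in> X" "v \<in> \<phi> x" using covX V by blast
      then have "v' \<in> \<phi> x" using is_end_up[OF endX x(2)] e by blast
      with x show ?thesis by blast
    qed
    then obtain c where c: "c \<in> X \<union> Y" "v \<in> \<phi> c" "v' \<in> \<phi> c" by blast
    have "(a, c) \<in> ?R" using step c by blast
    moreover have "(c, b) \<in> ?R" using share[OF c(1) step.prems(2) c(3) step.prems(4)] .
    ultimately show ?case by (rule rtrancl_trans)
  qed
  moreover have "\<exists>u\<in>V. u \<in> \<phi> a" if "a \<in> X \<union> Y" for a
    using phi_V[OF that] phi_nonempty[OF that] by blast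
  ultimately have "(a, b) \<in> ?R" if "a \<in> X \<union> Y" "b \<in> X \<union> Y" for a b
    using conn that unfolding connected_on_def by meson
  moreover have "X \<noteq> {}" using conn covX by (auto simp: connected_on_def)
  ultimately show ?thesis by (simp add: connected_poset_def connected_on_def Field_r)
qed

text \<open>Since \<open>\<phi>\<close> is injective, permuting the ends permutes the labels; the
  levels survive by \<open>end_not_dual_end\<close>, and adjacency because images under an injection
  commute with intersections.\<close>

lemma induced_automorphism:
  assumes g: "rel_aut V E g" and perm: "(`) g ` \<phi> ` (X \<union> Y) = \<phi> ` (X \<union> Y)"
  obtains G where "rel_aut (Field r) r G" "\<And>a. a \<in> X \<union> Y \<Longrightarrow> G a \<in> X \<union> Y \<and> \<phi> (G a) = g ` \<phi> a"
proof -
  have "\<exists>b. b \<in> X \<union> Y \<and> \<phi> b = g ` \<phi> a" if "a \<in> X \<union> Y" for a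
  proof -
    have "g ` \<phi> a \<in> \<phi> ` (X \<union> Y)" using perm that by blast
    then show ?thesis by (metis imageE)
  qed
  then obtain G where G: "\<And>a. a \<in> X \<union> Y \<Longrightarrow> G a \<in> X \<union> Y \<and> \<phi> (G a) = g ` \<phi> a" by metis
  have injg: "inj_on g V" using g by (simp add: rel_iso_def bij_betw_def)
  have gc: "rel_aut V (E\<inverse>) g" using g by (simp add: rel_iso_converse)
  have EV': "E\<inverse> \<subseteq> V \<times> V" using EV by auto
  have GX: "G a \<in> X" if "a \<in> X" for a
  proof (rule ccontr)
    assume "G a \<notin> X"
    then have "is_end (E\<inverse>) (g ` \<phi> a)" using G[of a] endY[of "G a"] that by auto
    then show False using end_not_dual_end[OF is_end_image[OF g EV endX[OF that]]] by blast
  qed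
  have GY: "G a \<in> Y" if "a \<in> Y" for a
  proof (rule ccontr)
    assume "G a \<notin> Y"
    then have "is_end E (g ` \<phi> a)" using G[of a] endX[of "G a"] that by auto
    then show False using end_not_dual_end is_end_image[OF gc EV' endY[OF that]] by blast
  qed
  have inj: "inj_on G (X \<union> Y)"
  proof (rule inj_onI)
    fix a b assume ab: "a \<in> X \<union> Y" "b \<in> X \<union> Y" "G a = G b"
    then have "g ` \<phi> a = g ` \<phi> b" using G by metis
    then have "\<phi> a = \<phi> b" using inj_on_image_eq_iff[OF injg phi_V[OF ab(1)] phi_V[OF ab(2)]] by blast
    then show "a = b" using inj_phi ab by (auto simp: inj_on_def)
  qed
  have "G ` (X \<union> Y) = X \<union> Y"
  proof
    show "G ` (X \<union> Y) \<subseteq> X \<union> Y" using G by blast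
    show "X \<union> Y \<subseteq> G ` (X \<union> Y)"
    proof
      fix b assume b: "b \<in> X \<union> Y"
      then have "\<phi> b \<in> (`) g ` \<phi> ` (X \<union> Y)" using perm by blast
      then obtain a where a: "a \<in> X \<union> Y" "\<phi> b = g ` \<phi> a" by (metis (no_types, lifting) imageE)
      then have "\<phi> b = \<phi> (G a)" "G a \<in> X \<union> Y" using G by auto
      then have "b = G a" using inj_onD[OF inj_phi _ b] by blast
      then show "b \<in> G ` (X \<union> Y)" using a by blast
    qed
  qed
  moreover have "(a, b) \<in> r \<longleftrightarrow> (G a, G b) \<in> r" if ab: "a \<in> X \<union> Y" "b \<in> X \<union> Y" for a b
  proof -
    have "\<phi> (G a) \<inter> \<phi> (G b) = g ` (\<phi> a \<inter> \<phi> b)"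
      using inj_on_image_Int[OF injg phi_V[OF ab(1)] phi_V[OF ab(2)]] G ab by metis
    then have "\<phi> (G a) \<inter> \<phi> (G b) \<noteq> {} \<longleftrightarrow> \<phi> a \<inter> \<phi> b \<noteq> {}" by simp
    moreover have "G a = G b \<longleftrightarrow> a = b" using inj ab by (auto simp: inj_on_def)
    moreover have "G a \<in> X \<longleftrightarrow> a \<in> X" "G b \<in> Y \<longleftrightarrow> b \<in> Y" using GX GY ab disj by blast+
    ultimately show ?thesis using ab G[OF ab(1)] unfolding in_r by blast
  qed
  ultimately have "rel_aut (Field r) r G" using inj by (simp add: rel_iso_def bij_betw_def Field_r)
  then show thesis using G that by blast
qed

text \<open>Connectedness gives each of the three points a neighbour on the other level, so they
  split as one against two, and the single point is related to both others.\<close>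

lemma connected_three_cases:
  assumes A: "A \<subseteq> Field r" "card A = 3" "connected_poset (Restr r A)"
  obtains (X) x y1 y2 where "A = {x, y1, y2}" "x \<in> X" "y1 \<in> Y" "y2 \<in> Y" "y1 \<noteq> y2" "(x, y1) \<in> r" "(x, y2) \<in> r"
  | (Y) y x1 x2 where "A = {y, x1, x2}" "y \<in> Y" "x1 \<in> X" "x2 \<in> X" "x1 \<noteq> x2" "(x1, y) \<in> r" "(x2, y) \<in> r"
proof -
  obtain p q s where A3: "A = {p, q, s}" "p \<noteq> q" "p \<noteq> s" "q \<noteq> s"
    using A(2) by (auto simp: card_3_iff)
  have "(a, a) \<in> Restr r A" if "a \<in> A" for a using A(1) that by (auto simp: in_r Field_r)
  then have FA: "Field (Restr r A) = A" unfolding Field_def by blast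
  have nb: "\<exists>b\<in>A. b \<noteq> a \<and> ((a, b) \<in> r \<and> a \<in> X \<and> b \<in> Y \<or> (b, a) \<in> r \<and> b \<in> X \<and> a \<in> Y)" if a: "a \<in> A" for a
  proof -
    have "p \<in> A" "q \<in> A" using A3(1) by auto
    then obtain b where b: "b \<in> A" "b \<noteq> a" using A3(2) by metis
    let ?S = "Restr r A \<union> (Restr r A)\<inverse>"
    have "(a, b) \<in> ?S\<^sup>*" using A(3) a b FA by (simp add: connected_poset_def connected_on_def)
    \<comment> \<open>Removing the reflexive pairs guarantees that the first step of the walk leads
      to a different point.\<close>
    then have "(a, b) \<in> (?S - Id)\<^sup>*" by (simp add: rtrancl_r_diff_Id)
    then obtain c where "(a, c) \<in> ?S - Id" using b by (metis converse_rtranclE)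
    then show ?thesis by (auto simp: in_r)
  qed
  have nb': "a \<in> X \<Longrightarrow> (\<exists>b\<in>A. b \<in> Y \<and> (a, b) \<in> r)" "a \<in> Y \<Longrightarrow> (\<exists>b\<in>A. b \<in> X \<and> (b, a) \<in> r)" if "a \<in> A" for a
    using nb[OF that] disj by blast+
  have cls: "a \<in> X \<and> a \<notin> Y \<or> a \<in> Y \<and> a \<notin> X" if "a \<in> A" for a using A(1) that disj by (auto simp: Field_r)
  have one: "\<lbrakk>c \<in> X; a \<in> Y; b \<in> Y; a \<noteq> b; A = {c, a, b}\<rbrakk> \<Longrightarrow> thesis" for a b c
    using nb'[of a] nb'[of b] cls[of a] cls[of b] X[of c a b] by blast
  have two: "\<lbrakk>c \<in> Y; a \<in> X; b \<in> X; a \<noteq> b; A = {c, a, b}\<rbrakk> \<Longrightarrow> thesis" for a b c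
    using nb'[of a] nb'[of b] cls[of a] cls[of b] Y[of c a b] by blast
  have eqs: "A = {q, p, s}" "A = {s, p, q}" using A3(1) by auto
  have "\<not> (p \<in> X \<and> q \<in> X \<and> s \<in> X)" "\<not> (p \<in> Y \<and> q \<in> Y \<and> s \<in> Y)"
    using nb'[of p] cls A3 by blast+
  moreover have "p \<in> X \<or> p \<in> Y" "q \<in> X \<or> q \<in> Y" "s \<in> X \<or> s \<in> Y" using cls A3(1) by blast+
  ultimately show thesis
    using one[of p q s] one[of q p s] one[of s p q] two[of p q s] two[of q p s] two[of s p q] A3 eqs
    by argo
qed

lemma three_CS_homogeneous_r: "three_CS_homogeneous r"
  unfolding three_CS_homogeneous_def
proof (intro allI impI, elim conjE)
  fix A B f
  assume A: "A \<subseteq> Field r" "card A = 3" "connected_poset (Restr r A)"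
    and B: "B \<subseteq> Field r" and f: "rel_iso A (Restr r A) B (Restr r B) f"
  have ext: "\<exists>g. rel_aut (Field r) r g \<and> (\<forall>a\<in>{a, b, c}. g a = f a)"
    if g: "rel_aut V E g" "(`) g ` \<phi> ` (X \<union> Y) = \<phi> ` (X \<union> Y)"
      and abc: "{a, b, c} \<subseteq> X \<union> Y" "f ` {a, b, c} \<subseteq> X \<union> Y" "g ` \<phi> a = \<phi> (f a)" "g ` \<phi> b = \<phi> (f b)" "g ` \<phi> c = \<phi> (f c)"
    for g a b c
  proof -
    obtain G where G: "rel_aut (Field r) r G" "\<And>a. a \<in> X \<union> Y \<Longrightarrow> G a \<in> X \<union> Y \<and> \<phi> (G a) = g ` \<phi> a"
      using induced_automorphism[OF g] by blast
    have "G z = f z" if "z \<in> {a, b, c}" for z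
    proof -
      have "\<phi> (G z) = \<phi> (f z)" "G z \<in> X \<union> Y" "f z \<in> X \<union> Y" using G(2) abc that by auto
      then show ?thesis using inj_onD[OF inj_phi] by blast
    qed
    with G(1) show ?thesis by blast
  qed
  have inj: "inj_on f A" and fB: "f ` A \<subseteq> X \<union> Y" and pres: "\<And>a b. a \<in> A \<Longrightarrow> b \<in> A \<Longrightarrow> (a, b) \<in> r \<Longrightarrow> (f a, f b) \<in> r"
    using f B by (auto simp: rel_iso_def bij_betw_def Field_r)
  have adj: "f a \<in> X \<and> f b \<in> Y \<and> \<phi> (f a) \<inter> \<phi> (f b) \<noteq> {}" if "a \<in> A" "b \<in> A" "(a, b) \<in> r" "a \<noteq> b" for a b
  proof -
    have "f a \<noteq> f b" using inj that by (auto simp: inj_on_def)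
    then show ?thesis using pres[OF that(1-3)] by (auto simp: in_r)
  qed
  from A show "\<exists>g. rel_aut (Field r) r g \<and> (\<forall>a\<in>A. g a = f a)"
  proof (cases rule: connected_three_cases)
    case (X x y1 y2)
    have ne: "x \<noteq> y1" "x \<noteq> y2" using X disj by auto
    have a1: "f x \<in> X \<and> f y1 \<in> Y \<and> \<phi> (f x) \<inter> \<phi> (f y1) \<noteq> {}" using adj[of x y1] X ne by simp
    have a2: "f x \<in> X \<and> f y2 \<in> Y \<and> \<phi> (f x) \<inter> \<phi> (f y2) \<noteq> {}" using adj[of x y2] X ne by simp
    have "f y1 \<noteq> f y2" using inj X by (auto simp: inj_on_def)
    moreover have "\<phi> x \<inter> \<phi> y1 \<noteq> {}" "\<phi> x \<inter> \<phi> y2 \<noteq> {}" using X ne by (auto simp: in_r)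
    ultimately obtain g where g: "rel_aut V E g" "(`) g ` \<phi> ` (X \<union> Y) = \<phi> ` (X \<union> Y)"
      "g ` \<phi> x = \<phi> (f x)" "g ` \<phi> y1 = \<phi> (f y1)" "g ` \<phi> y2 = \<phi> (f y2)"
      using homX[of x y1 y2 "f x" "f y1" "f y2"] X a1 a2 by auto
    show ?thesis using ext[OF g(1,2) _ _ g(3-5)] X fB by auto
  next
    case (Y y x1 x2)
    have ne: "x1 \<noteq> y" "x2 \<noteq> y" using Y disj by auto
    have a1: "f x1 \<in> X \<and> f y \<in> Y \<and> \<phi> (f y) \<inter> \<phi> (f x1) \<noteq> {}" using adj[of x1 y] Y ne by (simp add: Int_commute)
    have a2: "f x2 \<in> X \<and> f y \<in> Y \<and> \<phi> (f y) \<inter> \<phi> (f x2) \<noteq> {}" using adj[of x2 y] Y ne by (simp add: Int_commute)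
    have "f x1 \<noteq> f x2" using inj Y by (auto simp: inj_on_def)
    moreover have "\<phi> y \<inter> \<phi> x1 \<noteq> {}" "\<phi> y \<inter> \<phi> x2 \<noteq> {}" using Y ne by (auto simp: in_r)
    ultimately obtain g where g: "rel_aut V E g" "(`) g ` \<phi> ` (X \<union> Y) = \<phi> ` (X \<union> Y)"
      "g ` \<phi> y = \<phi> (f y)" "g ` \<phi> x1 = \<phi> (f x1)" "g ` \<phi> x2 = \<phi> (f x2)"
      using homY[of y x1 x2 "f y" "f x1" "f x2"] Y a1 a2 by auto
    show ?thesis using ext[OF g(1,2) _ _ g(3-5)] Y fB by auto
  qed
qed

end

section \<open>From the digraph to the two-level order\<close>

lemma two_to_countableE:
  assumes "two_to_countable S"
  obtains a b where "a \<in> S" "b \<in> S" "a \<noteq> b"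
proof (rule ccontr)
  assume "\<not> thesis"
  with that have "\<forall>a\<in>S. \<forall>b\<in>S. a = b" by blast
  then have "S = {} \<or> (\<exists>a. S = {a})" by blast
  then show False using assms by (auto simp: two_to_countable_def)
qed

lemma rtrancl_cases_V: "E \<subseteq> V \<times> V \<Longrightarrow> (x, a) \<in> E\<^sup>* \<Longrightarrow> x = a \<or> x \<in> V \<and> a \<in> V"
  by (metis converse_rtranclE mem_Sigma_iff rtranclE subsetD)

lemma path_digraph_if_locally_tree_like:
  assumes D: "is_digraph V E" and T: "locally_tree_like V E" and I: "intersection_property V E"
  shows "path_digraph V E"
proof -
  have EV: "E \<subseteq> V \<times> V" using D by (simp add: is_digraph_def)
  have tree: "digraph_tree (desc E u) (Restr E (desc E u))"
    and tree': "digraph_tree (anc E u) (Restr E (anc E u))" if "u \<in> V" for u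
    using T that by (auto simp: locally_tree_like_def)
  have ac: "acyclic E"
    using tree_desc_acyclic[OF _ _ EV tree] D by (simp add: is_digraph_def)
  have parent: "w1 = w2"
    if "(w1, w) \<in> E" "(w2, w) \<in> E" "(u, w1) \<in> E\<^sup>*" "(u, w2) \<in> E\<^sup>*" for w1 w2 w u
  proof -
    have "u \<in> V" using rtrancl_cases_V[OF EV that(3)] that(1) EV by auto
    then show ?thesis using tree_desc_unique_parent[OF ac tree that] by simp
  qed
  have child: "w1 = w2"
    if "(w, w1) \<in> E" "(w, w2) \<in> E" "(w1, u) \<in> E\<^sup>*" "(w2, u) \<in> E\<^sup>*" for w1 w2 w u
  proof -
    have "u \<in> V" using rtrancl_cases_V[OF EV that(3)] that(1) EV by auto
    then have "digraph_tree (desc (E\<inverse>) u) (Restr (E\<inverse>) (desc (E\<inverse>) u))"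
      using tree' by (simp add: digraph_tree_converse Restr_converse flip: anc_eq_desc_converse)
    then show ?thesis
      using tree_desc_unique_parent[of "E\<inverse>" u w1 w w2] ac that by (simp add: rtrancl_converse)
  qed
  have meet: "\<exists>z. (x, z) \<in> E\<^sup>* \<and> (y, z) \<in> E\<^sup>* \<and> (\<forall>b. (x, b) \<in> E\<^sup>* \<and> (y, b) \<in> E\<^sup>* \<longrightarrow> (z, b) \<in> E\<^sup>*)"
    if "(x, a) \<in> E\<^sup>*" "(y, a) \<in> E\<^sup>*" for x y a
  proof (cases "x = a \<or> y = a")
    case True
    then show ?thesis using that by auto
  next
    case False
    then have "x \<in> V" "y \<in> V" using rtrancl_cases_V[OF EV] that by blast+
    moreover have "a \<in> desc E x \<inter> desc E y" using that by (auto simp: desc_def)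
    ultimately obtain z where z: "z \<in> desc E x \<inter> desc E y" "desc E x \<inter> desc E y = desc E z"
      using I unfolding intersection_property_def by blast
    then have "b \<in> desc E z" if "(x, b) \<in> E\<^sup>*" "(y, b) \<in> E\<^sup>*" for b
      using that by (auto simp: desc_def)
    with z(1) show ?thesis by (auto simp: desc_def)
  qed
  have antisym: "u = v" if "(u, v) \<in> E\<^sup>*" "(v, u) \<in> E\<^sup>*" for u v
    using ac that by (metis acyclic_def rtranclD rtrancl_trancl_trancl)
  \<comment> \<open>Joins come from meets: for a lowest common ancestor \<open>w\<close> of
    \<open>x\<close> and \<open>y\<close> and any common ancestor \<open>b\<close>, the meet of
    \<open>w\<close> and \<open>b\<close> is still above \<open>x\<close> and \<open>y\<close>,
    hence equals \<open>w\<close>.\<close>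
  have join: "\<exists>z. (z, x) \<in> E\<^sup>* \<and> (z, y) \<in> E\<^sup>* \<and> (\<forall>b. (b, x) \<in> E\<^sup>* \<and> (b, y) \<in> E\<^sup>* \<longrightarrow> (b, z) \<in> E\<^sup>*)"
    if "(a, x) \<in> E\<^sup>*" "(a, y) \<in> E\<^sup>*" for a x y
  proof -
    \<comment> \<open>The path from \<open>a\<close> to \<open>x\<close> is followed while it stays
      above \<open>y\<close>. Where the next vertex \<open>a'\<close> fails to reach
      \<open>y\<close>, no other child helps, since by \<open>child\<close> only \<open>a'\<close>
      leads to \<open>x\<close>.\<close>
    have "\<exists>w. (w, x) \<in> E\<^sup>* \<and> (w, y) \<in> E\<^sup>* \<and> \<not> (\<exists>w'. (w, w') \<in> E \<and> (w', x) \<in> E\<^sup>* \<and> (w', y) \<in> E\<^sup>*)"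
      using that
    proof (induction rule: converse_rtrancl_induct)
      case base
      have "(w', x) \<notin> E\<^sup>*" if "(x, w') \<in> E" for w'
        using that ac by (metis acyclic_def rtrancl_into_trancl2)
      then show ?case using base by blast
    next
      case (step a a')
      show ?case
      proof (cases "(a', y) \<in> E\<^sup>*")
        case True
        then show ?thesis using step by blast
      next
        case False
        then have "\<not> (\<exists>w'. (a, w') \<in> E \<and> (w', x) \<in> E\<^sup>* \<and> (w', y) \<in> E\<^sup>*)"
          using child[OF step.hyps(1) _ step.hyps(2)] by blast
        moreover have "(a, x) \<in> E\<^sup>*" using step.hyps by (meson converse_rtrancl_into_rtrancl)
        ultimately show ?thesis using step.prems by blast
      qed
    qed
    then obtain w where w: "(w, x) \<in> E\<^sup>*" "(w, y) \<in> E\<^sup>*"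
      "\<And>w'. (w, w') \<in> E \<Longrightarrow> (w', x) \<in> E\<^sup>* \<Longrightarrow> (w', y) \<in> E\<^sup>* \<Longrightarrow> False" by blast
    have "(b, w) \<in> E\<^sup>*" if b: "(b, x) \<in> E\<^sup>*" "(b, y) \<in> E\<^sup>*" for b
    proof -
      obtain z where z: "(w, z) \<in> E\<^sup>*" "(b, z) \<in> E\<^sup>*" "(z, x) \<in> E\<^sup>*" "(z, y) \<in> E\<^sup>*"
        using meet[OF w(1) b(1)] w b by blast
      have "z = w"
      proof (rule ccontr)
        assume "z \<noteq> w"
        then obtain w' where "(w, w') \<in> E" "(w', z) \<in> E\<^sup>*" using z(1) by (metis converse_rtranclE)
        then show False using w(3) z(3,4) by (meson rtrancl_trans)
      qed
      with z show ?thesis by simp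
    qed
    with w show ?thesis by blast
  qed
  have out2: "\<exists>w1 w2. w1 \<noteq> w2 \<and> (v, w1) \<in> E \<and> (v, w2) \<in> E" if "v \<in> V" for v
  proof -
    have "two_to_countable (E `` {v})" using T that by (simp add: locally_tree_like_def)
    then show ?thesis by (rule two_to_countableE) auto
  qed
  have in2: "\<exists>w1 w2. w1 \<noteq> w2 \<and> (w1, v) \<in> E \<and> (w2, v) \<in> E" if "v \<in> V" for v
  proof -
    have "two_to_countable (E\<inverse> `` {v})" using T that by (simp add: locally_tree_like_def)
    then show ?thesis by (rule two_to_countableE) auto
  qed
  show ?thesis
    by (rule path_digraph.intro) (fact EV ac parent child meet join out2 in2)+
qed

text \<open>
  Only countably many ends may become points of the order; closing a countable covering set of ends
  under chosen automorphisms keeps it homogeneous.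
\<close>

lemma (in path_digraph) homogeneous_ends:
  assumes "countable V"
  obtains S where "countable S" "\<And>s. s \<in> S \<Longrightarrow> is_end E s \<or> is_end (E\<inverse>) s"
    "\<And>v. v \<in> V \<Longrightarrow> \<exists>s\<in>S. is_end E s \<and> v \<in> s" "\<And>v. v \<in> V \<Longrightarrow> \<exists>s\<in>S. is_end (E\<inverse>) s \<and> v \<in> s"
    "\<And>g A B C A' B' C'. \<lbrakk>{A, B, C, A', B', C'} \<subseteq> S; rel_aut V E g; g ` A = A'; g ` B = B'; g ` C = C'\<rbrakk> \<Longrightarrow>
      \<exists>g. rel_aut V E g \<and> (`) g ` S = S \<and> g ` A = A' \<and> g ` B = B' \<and> g ` C = C'"
proof -
  interpret d: path_digraph V "E\<inverse>" by (rule dual)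
  have EV': "E\<inverse> \<subseteq> V \<times> V" using EV by auto
  have "\<exists>F. is_end E F \<and> v \<in> F" if "v \<in> V" for v using ex_end[OF that] by blast
  then obtain f where f: "\<And>v. v \<in> V \<Longrightarrow> is_end E (f v) \<and> v \<in> f v" by metis
  have "\<exists>F. is_end (E\<inverse>) F \<and> v \<in> F" if "v \<in> V" for v using d.ex_end[OF that] by blast
  then obtain f' where f': "\<And>v. v \<in> V \<Longrightarrow> is_end (E\<inverse>) (f' v) \<and> v \<in> f' v" by metis
  \<comment> \<open>A list codes the data: entries 0 to 2 are a triple of ends, entries 3 to 5 its
    target, and entry 6 is the end to be moved.\<close>
  define P where "P = (\<lambda>l g. rel_aut V E g \<and> g ` (l ! 0) = l ! 3 \<and> g ` (l ! 1) = l ! 4 \<and> g ` (l ! 2) = l ! 5)"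
  define G where "G = (\<lambda>l. SOME g. P l g)"
  \<comment> \<open>Closure under the inverse as well makes the chosen automorphism map the set onto
    itself, not merely into itself.\<close>
  define h where "h = (\<lambda>l. {G l ` (l ! 6), inv_into V (G l) ` (l ! 6)})"
  obtain T where T: "f ` V \<union> f' ` V \<subseteq> T" "countable T" "\<And>l. set l \<subseteq> T \<Longrightarrow> h l \<subseteq> T"
    using countable_closure[of "f ` V \<union> f' ` V" h] assms by (auto simp: h_def)
  \<comment> \<open>For lists that admit no suitable automorphism \<open>G\<close> is arbitrary and
    \<open>h\<close> may produce sets that are not ends; these are discarded here.\<close>
  define S where "S = {s \<in> T. is_end E s \<or> is_end (E\<inverse>) s}"
  have SV: "s \<subseteq> V" if "s \<in> S" for s
    using that is_end_subset[OF _ EV] is_end_subset[OF _ EV'] by (auto simp: S_def)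
  have closed: "\<exists>g. rel_aut V E g \<and> (`) g ` S = S \<and> g ` A = A' \<and> g ` B = B' \<and> g ` C = C'"
    if A: "{A, B, C, A', B', C'} \<subseteq> S" and g: "rel_aut V E g" "g ` A = A'" "g ` B = B'" "g ` C = C'"
    for g A B C A' B' C'
  proof -
    define k where "k = G [A, B, C, A', B', C']"
    have "P [A, B, C, A', B', C'] g" using g by (simp add: P_def)
    then have "P [A, B, C, A', B', C'] k" unfolding k_def G_def by (rule someI[of "P [A, B, C, A', B', C']"])
    then have k: "rel_aut V E k" "k ` A = A'" "k ` B = B'" "k ` C = C'" by (auto simp: P_def)
    \<comment> \<open>\<open>P\<close> never reads entry 6, so one and the same automorphism is
      chosen for every \<open>s\<close>.\<close>
    have Geq: "G [A, B, C, A', B', C', s] = k" for s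
      by (simp add: G_def k_def P_def)
    let ?i = "inv_into V k"
    have i: "rel_aut V E ?i" by (rule rel_iso_inv[OF k(1)])
    have inT: "{k ` s, ?i ` s} \<subseteq> T" if "s \<in> S" for s
      using T(3)[of "[A, B, C, A', B', C', s]"] A that by (simp add: h_def Geq S_def)
    have ends: "is_end E (j ` s) \<or> is_end (E\<inverse>) (j ` s)" if "rel_aut V E j" "s \<in> S" for j s
    proof -
      have "rel_aut V (E\<inverse>) j" using that(1) by (simp add: rel_iso_converse)
      then show ?thesis
        using that is_end_image[OF that(1) EV] is_end_image[of V "E\<inverse>" j, OF _ EV'] by (auto simp: S_def)
    qed
    have kS: "k ` s \<in> S" and iS: "?i ` s \<in> S" if "s \<in> S" for s
      using inT[OF that] ends[OF k(1) that] ends[OF i that] by (auto simp: S_def)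
    have "s = k ` ?i ` s" if "s \<in> S" for s
    proof -
      have "k ` V = V" using k(1) by (simp add: rel_iso_def bij_betw_def)
      then have "k (?i x) = x" if "x \<in> s" for x
        using f_inv_into_f[of x k V] SV[OF \<open>s \<in> S\<close>] that by auto
      then show ?thesis by (auto simp: image_image)
    qed
    then have "(`) k ` S = S" using kS iS by blast
    with k show ?thesis by blast
  qed
  show thesis
  proof (rule that[OF _ _ _ _ closed])
    show "countable S" using T(2) by (auto simp: S_def)
    show "is_end E s \<or> is_end (E\<inverse>) s" if "s \<in> S" for s using that by (simp add: S_def)
    show "\<exists>s\<in>S. is_end E s \<and> v \<in> s" if "v \<in> V" for v
      using f[OF that] T(1) that by (intro bexI[of _ "f v"]) (auto simp: S_def)
    show "\<exists>s\<in>S. is_end (E\<inverse>) s \<and> v \<in> s" if "v \<in> V" for v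
      using f'[OF that] T(1) that by (intro bexI[of _ "f' v"]) (auto simp: S_def)
  qed
qed

lemma (in path_digraph) ex_end_poset:
  assumes V: "countable V" and conn: "connected_on V E"
    and tr: "Y_transitive V E" "Y_transitive V (E\<inverse>)"
  obtains X Y :: "nat set" and \<phi> where "end_poset V E X Y \<phi>"
proof -
  interpret d: path_digraph V "E\<inverse>" by (rule dual)
  obtain S where S: "countable S" "\<And>s. s \<in> S \<Longrightarrow> is_end E s \<or> is_end (E\<inverse>) s"
    "\<And>v. v \<in> V \<Longrightarrow> \<exists>s\<in>S. is_end E s \<and> v \<in> s" "\<And>v. v \<in> V \<Longrightarrow> \<exists>s\<in>S. is_end (E\<inverse>) s \<and> v \<in> s"
    and hom: "\<And>g A B C A' B' C'. \<lbrakk>{A, B, C, A', B', C'} \<subseteq> S; rel_aut V E g; g ` A = A'; g ` B = B'; g ` C = C'\<rbrakk> \<Longrightarrow>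
      \<exists>g. rel_aut V E g \<and> (`) g ` S = S \<and> g ` A = A' \<and> g ` B = B' \<and> g ` C = C'"
    using homogeneous_ends[OF V] by blast
  define \<phi> where "\<phi> = from_nat_into S"
  define X where "X = to_nat_on S ` {s \<in> S. is_end E s}"
  define Y where "Y = to_nat_on S ` {s \<in> S. is_end (E\<inverse>) s}"
  have phi: "\<phi> (to_nat_on S s) = s" if "s \<in> S" for s
    using that S(1) by (simp add: \<phi>_def)
  have XS: "\<phi> x \<in> S \<and> is_end E (\<phi> x)" if "x \<in> X" for x using that phi by (auto simp: X_def)
  have YS: "\<phi> y \<in> S \<and> is_end (E\<inverse>) (\<phi> y)" if "y \<in> Y" for y using that phi by (auto simp: Y_def)
  have img: "\<phi> ` (X \<union> Y) = S"
  proof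
    show "\<phi> ` (X \<union> Y) \<subseteq> S" using XS YS by auto
    show "S \<subseteq> \<phi> ` (X \<union> Y)"
    proof
      fix s assume s: "s \<in> S"
      then have "to_nat_on S s \<in> X \<union> Y" using S(2) by (auto simp: X_def Y_def)
      then show "s \<in> \<phi> ` (X \<union> Y)" using phi[OF s] by (metis imageI)
    qed
  qed
  have inj: "inj_on \<phi> (X \<union> Y)"
    by (rule inj_on_inverseI[of _ "to_nat_on S"]) (auto simp: X_def Y_def phi)
  have "end_poset V E X Y \<phi>"
  proof
    show "X \<inter> Y = {}" using XS YS end_not_dual_end by blast
    show "\<exists>x\<in>X. v \<in> \<phi> x" if v: "v \<in> V" for v
    proof -
      obtain s where "s \<in> S" "is_end E s" "v \<in> s" using S(3)[OF v] by blast
      then show ?thesis by (intro bexI[of _ "to_nat_on S s"]) (auto simp: phi X_def)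
    qed
    show "\<exists>y\<in>Y. v \<in> \<phi> y" if v: "v \<in> V" for v
    proof -
      obtain s where "s \<in> S" "is_end (E\<inverse>) s" "v \<in> s" using S(4)[OF v] by blast
      then show ?thesis by (intro bexI[of _ "to_nat_on S s"]) (auto simp: phi Y_def)
    qed
  next
    fix x y1 y2 x' y1' y2'
    assume a: "x \<in> X" "y1 \<in> Y" "y2 \<in> Y" "y1 \<noteq> y2" "\<phi> x \<inter> \<phi> y1 \<noteq> {}" "\<phi> x \<inter> \<phi> y2 \<noteq> {}"
      and b: "x' \<in> X" "y1' \<in> Y" "y2' \<in> Y" "y1' \<noteq> y2'" "\<phi> x' \<inter> \<phi> y1' \<noteq> {}" "\<phi> x' \<inter> \<phi> y2' \<noteq> {}"
    have "\<phi> y1 \<noteq> \<phi> y2" "\<phi> y1' \<noteq> \<phi> y2'" using inj a b by (auto simp: inj_on_def)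
    then obtain g where g: "rel_aut V E g" "g ` \<phi> x = \<phi> x'" "g ` \<phi> y1 = \<phi> y1'" "g ` \<phi> y2 = \<phi> y2'"
      using ends_transitive[OF tr(1), of "\<phi> x" "\<phi> y1" "\<phi> y2" "\<phi> x'" "\<phi> y1'" "\<phi> y2'"] a b XS YS by blast
    show "\<exists>g. rel_aut V E g \<and> (`) g ` \<phi> ` (X \<union> Y) = \<phi> ` (X \<union> Y) \<and>
        g ` \<phi> x = \<phi> x' \<and> g ` \<phi> y1 = \<phi> y1' \<and> g ` \<phi> y2 = \<phi> y2'"
      unfolding img by (rule hom[OF _ g]) (use a b XS YS in simp)
  next
    fix y x1 x2 y' x1' x2'
    assume a: "y \<in> Y" "x1 \<in> X" "x2 \<in> X" "x1 \<noteq> x2" "\<phi> y \<inter> \<phi> x1 \<noteq> {}" "\<phi> y \<inter> \<phi> x2 \<noteq> {}"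
      and b: "y' \<in> Y" "x1' \<in> X" "x2' \<in> X" "x1' \<noteq> x2'" "\<phi> y' \<inter> \<phi> x1' \<noteq> {}" "\<phi> y' \<inter> \<phi> x2' \<noteq> {}"
    have "\<phi> x1 \<noteq> \<phi> x2" "\<phi> x1' \<noteq> \<phi> x2'" using inj a b by (auto simp: inj_on_def)
    then obtain g where "rel_aut V (E\<inverse>) g" and g: "g ` \<phi> y = \<phi> y'" "g ` \<phi> x1 = \<phi> x1'" "g ` \<phi> x2 = \<phi> x2'"
      using d.ends_transitive[OF tr(2), of "\<phi> y" "\<phi> x1" "\<phi> x2" "\<phi> y'" "\<phi> x1'" "\<phi> x2'", unfolded converse_converse]
        a b XS YS by blast
    then have g': "rel_aut V E g" by (simp add: rel_iso_converse)
    show "\<exists>g. rel_aut V E g \<and> (`) g ` \<phi> ` (X \<union> Y) = \<phi> ` (X \<union> Y) \<and>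
        g ` \<phi> y = \<phi> y' \<and> g ` \<phi> x1 = \<phi> x1' \<and> g ` \<phi> x2 = \<phi> x2'"
      unfolding img by (rule hom[OF _ g' g]) (use a b XS YS in simp)
  qed (use XS YS inj conn in auto)
  then show thesis by (rule that)
qed

theorem two_level_order_of_digraph:
  assumes D: "is_digraph V E" "connected_on V E" and T: "locally_tree_like V E"
    and I: "intersection_property V E" and S: "strongly_transitive V E"
  obtains M :: "nat rel" and f where "two_level M" "connected_poset M" "three_CS_homogeneous M"
    "rel_iso (ram_verts M) (ram_edges M) V E f"
proof -
  interpret path_digraph V E by (rule path_digraph_if_locally_tree_like[OF D(1) T I])
  have "countable V"
    using T by (intro countable_connected[OF D(2) EV]) (auto simp: locally_tree_like_def two_to_countable_def)
  then obtain X Y :: "nat set" and \<phi> where "end_poset V E X Y \<phi>"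
    using ex_end_poset D(2) S by (metis strongly_transitive_iff)
  then interpret end_poset V E X Y \<phi> .
  show thesis
    by (rule that[OF two_level_r connected_r three_CS_homogeneous_r rel_iso_inv[OF rel_iso_L]])
qed

section \<open>Closed sets of a bipartite graph\<close>

definition two_points :: "'a set \<Rightarrow> bool" where
  "two_points S \<longleftrightarrow> (\<exists>a\<in>S. \<exists>b\<in>S. a \<noteq> b)"

definition polar :: "'a rel \<Rightarrow> 'a set \<Rightarrow> 'a set" where
  "polar A S = {z. \<forall>s\<in>S. (s, z) \<in> A}"

text \<open>Two points in \<open>J\<close> exclude the principal ideals of lower points, two points
  in its polar those of upper points.\<close>

definition closed_sets :: "'a set \<Rightarrow> 'a rel \<Rightarrow> 'a set set" where
  "closed_sets X A = {J. J \<subseteq> X \<and> two_points J \<and> two_points (polar A J) \<and> polar A (polar A J) = J}"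

text \<open>The recipe of \<open>ram_edges\<close> for an arbitrary family of sets, so that it also
  applies after the two parts of the graph are exchanged.\<close>

definition cover_edges :: "'a set set \<Rightarrow> 'a set rel" where
  "cover_edges C = {(J, K). J \<in> C \<and> K \<in> C \<and> K \<subset> J \<and> \<not> (\<exists>Z\<in>C. K \<subset> Z \<and> Z \<subset> J)}"

lemma two_points_mono: "two_points S \<Longrightarrow> S \<subseteq> T \<Longrightarrow> two_points T"
  by (auto simp: two_points_def)

lemma two_points_image: "two_points S \<Longrightarrow> inj_on f S \<Longrightarrow> two_points (f ` S)"
  by (auto simp: two_points_def inj_on_def)

lemma two_points_nonempty: "two_points S \<Longrightarrow> S \<noteq> {}"
  by (auto simp: two_points_def)

lemma two_points_other: "two_points S \<Longrightarrow> \<exists>b\<in>S. b \<noteq> a"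
  by (metis two_points_def)

lemma two_to_countableI: "two_points S \<Longrightarrow> countable S \<Longrightarrow> two_to_countable S"
proof -
  assume S: "two_points S" "countable S"
  then obtain a b where ab: "a \<in> S" "b \<in> S" "a \<noteq> b" by (auto simp: two_points_def)
  have "2 \<le> card S" if "finite S"
    using card_mono[OF that, of "{a, b}"] ab by simp
  with S show ?thesis by (auto simp: two_to_countable_def)
qed

lemma image_subset_image_iff:
  assumes "inj_on f S" "J \<subseteq> S" "K \<subseteq> S"
  shows "f ` J \<subseteq> f ` K \<longleftrightarrow> J \<subseteq> K"
proof
  assume sub: "f ` J \<subseteq> f ` K"
  show "J \<subseteq> K"
  proof
    fix z assume "z \<in> J"
    then show "z \<in> K" using sub assms inj_on_image_mem_iff[OF assms(1) _ assms(3), of z] by blast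
  qed
qed blast

lemma polar_antimono: "S \<subseteq> T \<Longrightarrow> polar A T \<subseteq> polar A S"
  by (auto simp: polar_def)

lemma rel_iso_cover_edges:
  assumes f: "bij_betw f C D" and mono: "\<And>J K. J \<in> C \<Longrightarrow> K \<in> C \<Longrightarrow> f J \<subseteq> f K \<longleftrightarrow> J \<subseteq> K"
  shows "rel_iso C (cover_edges C) D (cover_edges D) f"
  unfolding rel_iso_def
proof (intro conjI ballI f)
  fix J K assume JK: "J \<in> C" "K \<in> C"
  have D: "D = f ` C" using f by (simp add: bij_betw_def)
  have psub: "f J \<subset> f K \<longleftrightarrow> J \<subset> K" if "J \<in> C" "K \<in> C" for J K
    using mono[OF that] mono[OF that(2,1)] by (simp add: less_le_not_le)
  show "(J, K) \<in> cover_edges C \<longleftrightarrow> (f J, f K) \<in> cover_edges D"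
    using JK psub by (auto simp: cover_edges_def D)
qed

lemma rel_iso_cover_edges_antitone:
  assumes f: "bij_betw f C D" and mono: "\<And>J K. J \<in> C \<Longrightarrow> K \<in> C \<Longrightarrow> f J \<subseteq> f K \<longleftrightarrow> K \<subseteq> J"
  shows "rel_iso C ((cover_edges C)\<inverse>) D (cover_edges D) f"
  unfolding rel_iso_def
proof (intro conjI ballI f)
  fix J K assume JK: "J \<in> C" "K \<in> C"
  have D: "D = f ` C" using f by (simp add: bij_betw_def)
  have psub: "f J \<subset> f K \<longleftrightarrow> K \<subset> J" if "J \<in> C" "K \<in> C" for J K
    using mono[OF that] mono[OF that(2,1)] by (simp add: less_le_not_le)
  show "(J, K) \<in> (cover_edges C)\<inverse> \<longleftrightarrow> (f J, f K) \<in> cover_edges D"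
    using JK psub by (auto simp: cover_edges_def D)
qed

text \<open>Serves to pull the property back along the polarity from the graph with exchanged
  parts.\<close>

lemma Y_transitive_transport:
  assumes h: "rel_iso V E V' E' h" and EV: "E \<subseteq> V \<times> V" and Y: "Y_transitive V' E'"
  shows "Y_transitive V E"
  unfolding Y_transitive_def
proof (intro allI impI, elim conjE)
  fix x y x' y'
  assume c: "Y_configuration E x y" "Y_configuration E x' y'"
  have inj: "inj_on h V" using h by (simp add: rel_iso_def bij_betw_def)
  have inV: "z i \<in> V" if "directed_line E z" for z and i :: int
    using that EV unfolding directed_line_def by blast
  have map: "Y_configuration E' (h \<circ> x) (h \<circ> y)" if "Y_configuration E x y" for x y
  proof -
    have V: "x i \<in> V" "y i \<in> V" for i using that inV by (auto simp: Y_configuration_def)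
    have eq: "h u = h v \<longleftrightarrow> u = v" if "u \<in> V" "v \<in> V" for u v using inj that by (auto simp: inj_on_def)
    show ?thesis using that h V
      by (simp add: Y_configuration_def directed_line_def inj_def eq rel_iso_def)
  qed
  obtain f where f: "rel_aut V' E' f" "\<And>i. f (h (x i)) = h (x' i) \<and> f (h (y i)) = h (y' i)"
    using Y map[OF c(1)] map[OF c(2)] unfolding Y_transitive_def o_def by blast
  let ?k = "inv_into V h"
  have "rel_aut V E (?k \<circ> (f \<circ> h))"
    by (intro rel_iso_comp[OF rel_iso_comp[OF h f(1)]] rel_iso_inv h)
  moreover have "?k (h z) = z" if "z \<in> V" for z using inj that by simp
  then have "(?k \<circ> (f \<circ> h)) (x i) = x' i \<and> (?k \<circ> (f \<circ> h)) (y i) = y' i" for i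
    using f(2) c(2) inV[of x' i] inV[of y' i] by (simp add: Y_configuration_def)
  ultimately show "\<exists>f. rel_aut V E f \<and> (\<forall>i. f (x i) = x' i \<and> f (y i) = y' i)" by blast
qed

lemma locally_finite_transport:
  assumes h: "rel_iso V E V' E' h" and EV: "E \<subseteq> V \<times> V" "E' \<subseteq> V' \<times> V'" and lf: "locally_finite V E"
  shows "locally_finite V' E'"
  unfolding locally_finite_def
proof
  fix v assume "v \<in> V'"
  then obtain u where u: "u \<in> V" "v = h u" using h by (metis bij_betw_def imageE rel_iso_def)
  have V': "V' = h ` V" using h by (simp add: rel_iso_def bij_betw_def)
  have "E' `` {v} \<subseteq> h ` (E `` {u})" "E'\<inverse> `` {v} \<subseteq> h ` (E\<inverse> `` {u})"
    using EV(2) u h unfolding V' by (auto simp: rel_iso_def)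
  then show "finite (E' `` {v}) \<and> finite (E'\<inverse> `` {v})"
    using lf u(1) unfolding locally_finite_def by (meson finite_imageI finite_subset)
qed

section \<open>The polarity of adjacency\<close>

locale bipartite =
  fixes X Y :: "'a set" and A :: "'a rel"
  assumes disj: "X \<inter> Y = {}" and AXY: "A \<subseteq> X \<times> Y \<union> Y \<times> X" and symA: "sym A"
begin

abbreviation pol where "pol \<equiv> polar A"
abbreviation "C \<equiv> closed_sets X A"
abbreviation "E \<equiv> cover_edges C"

lemma A_commute: "(a, b) \<in> A \<longleftrightarrow> (b, a) \<in> A"
  using symA by (auto dest: symD)

lemma bipartite_dual: "bipartite Y X A"
  using disj AXY symA by unfold_locales auto

lemma polar_polar: "S \<subseteq> pol (pol S)"
  unfolding polar_def using A_commute by blast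

lemma polar_polar_polar: "pol (pol (pol S)) = pol S"
  using polar_polar[of "pol S"] polar_antimono[OF polar_polar[of S], of A] by blast

lemma polar_subset_Y: "S \<subseteq> X \<Longrightarrow> S \<noteq> {} \<Longrightarrow> pol S \<subseteq> Y"
  using AXY disj by (auto simp: polar_def)

lemma subset_polar_iff: "S \<subseteq> pol T \<longleftrightarrow> T \<subseteq> pol S"
  unfolding polar_def using A_commute by blast

lemma closedD:
  assumes "J \<in> C"
  shows "J \<subseteq> X" "J \<noteq> {}" "two_points J" "two_points (pol J)" "pol (pol J) = J" "pol J \<subseteq> Y" "pol J \<noteq> {}"
  using assms polar_subset_Y[of J] two_points_nonempty by (auto simp: closed_sets_def)

lemma closed_point: "J \<in> C \<Longrightarrow> \<exists>x. x \<in> J"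
  using closedD(2) by blast

lemma polar_point: "J \<in> C \<Longrightarrow> \<exists>y. y \<in> pol J"
  using closedD(7) by blast

lemma polar_closed: "J \<in> C \<Longrightarrow> pol J \<in> closed_sets Y A"
  unfolding closed_sets_def[of Y] mem_Collect_eq by (intro conjI) (simp_all add: closedD)

lemma polar_subset_polar_iff: "J \<in> C \<Longrightarrow> K \<in> C \<Longrightarrow> pol J \<subseteq> pol K \<longleftrightarrow> K \<subseteq> J"
  by (metis closedD(5) polar_antimono)

lemma E_subset: "E \<subseteq> C \<times> C"
  by (auto simp: cover_edges_def)

lemma E_psubset: "(J, K) \<in> E \<Longrightarrow> K \<subset> J"
  by (simp add: cover_edges_def)

lemma edge_A: "x \<in> J \<Longrightarrow> y \<in> pol J \<Longrightarrow> (x, y) \<in> A"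
  by (simp add: polar_def)

lemma bij_polar: "bij_betw pol C (closed_sets Y A)"
proof (rule bij_betw_imageI)
  interpret d: bipartite Y X A by (rule bipartite_dual)
  show "inj_on pol C" by (rule inj_onI) (metis closedD(5))
  show "pol ` C = closed_sets Y A"
    using polar_closed d.polar_closed d.closedD(5) by (metis subsetI subset_antisym image_subset_iff image_eqI)
qed

text \<open>Exchanging the parts of the graph amounts to reversing the digraph; this is the source
  of duality for the converse direction.\<close>

lemma rel_iso_polar: "rel_iso C (E\<inverse>) (closed_sets Y A) (cover_edges (closed_sets Y A)) pol"
  by (rule rel_iso_cover_edges_antitone[OF bij_polar polar_subset_polar_iff])

end

text \<open>\<open>chain\<close> is the interval \<open>1 + \<int> + 1\<close> without its two
  extreme points, the principal ideals of \<open>x\<close> and \<open>y\<close>. The indexing is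
  decreasing, so that \<open>i\<close> to \<open>i + 1\<close> follows the direction of the
  edges.\<close>

locale dense_bipartite = bipartite +
  assumes conn: "connected_on (X \<union> Y) A"
    and arc2: "locally_arc_transitive (X \<union> Y) A 2"
    and count: "countable (X \<union> Y)"
    and nonempty: "A \<noteq> {}"
    and chain: "x \<in> X \<Longrightarrow> y \<in> Y \<Longrightarrow> (x, y) \<in> A \<Longrightarrow>
      \<exists>l :: int \<Rightarrow> 'a set. range l = {J \<in> C. x \<in> J \<and> y \<in> pol J} \<and> (\<forall>i j. l i \<subset> l j \<longleftrightarrow> j < i)"
begin

lemma dense_dual: "dense_bipartite Y X A"
proof -
  interpret d: bipartite Y X A by (rule bipartite_dual)
  show ?thesis
  proof
    fix y x assume yx: "y \<in> Y" "x \<in> X" "(y, x) \<in> A"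
    then have "(x, y) \<in> A" using A_commute[of x y] by simp
    then obtain l :: "int \<Rightarrow> 'a set" where
      l: "range l = {J \<in> C. x \<in> J \<and> y \<in> pol J}" "\<And>i j. l i \<subset> l j \<longleftrightarrow> j < i"
      using chain[OF yx(2,1)] by metis
    have lC: "l i \<in> C" for i using l(1) by blast
    \<comment> \<open>The polarity reverses inclusion; negating the index keeps the new chain
      decreasing.\<close>
    have "pol (l i) \<in> range (\<lambda>i. pol (l (- i)))" for i
      by (rule range_eqI[of _ _ "- i"]) simp
    then have "range (\<lambda>i. pol (l (- i))) = pol ` range l" by blast
    also have "\<dots> = {K \<in> closed_sets Y A. y \<in> K \<and> x \<in> pol K}"
    proof (intro set_eqI iffI)
      fix K assume "K \<in> {K \<in> closed_sets Y A. y \<in> K \<and> x \<in> pol K}"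
      then have "pol K \<in> range l" "K = pol (pol K)"
        using l(1) d.polar_closed d.closedD(5) by auto
      then show "K \<in> pol ` range l" by blast
    next
      fix K assume "K \<in> pol ` range l"
      then obtain J where "J \<in> range l" "K = pol J" by blast
      then show "K \<in> {K \<in> closed_sets Y A. y \<in> K \<and> x \<in> pol K}"
        unfolding l(1) using polar_closed closedD(5) by auto
    qed
    finally have "range (\<lambda>i. pol (l (- i))) = {K \<in> closed_sets Y A. y \<in> K \<and> x \<in> pol K}" .
    moreover have "pol (l (- i)) \<subset> pol (l (- j)) \<longleftrightarrow> j < i" for i j
      using polar_subset_polar_iff[OF lC lC] l(2)[of "- j" "- i"] by (simp add: less_le_not_le)
    ultimately show "\<exists>l :: int \<Rightarrow> 'a set. range l = {K \<in> closed_sets Y A. y \<in> K \<and> x \<in> pol K} \<and>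
        (\<forall>i j. l i \<subset> l j \<longleftrightarrow> j < i)" by blast
  qed (use conn arc2 count nonempty in \<open>simp_all add: Un_commute\<close>)
qed

text \<open>Neighbours in the chain are covers in the whole family, because a closed set between
  them still contains \<open>x\<close> and is still bounded by \<open>y\<close>.\<close>

lemma chain_at:
  assumes "J \<in> C" "x \<in> J" "y \<in> pol J"
  obtains l :: "int \<Rightarrow> 'a set" and i where "\<And>i. l i \<in> C \<and> x \<in> l i \<and> y \<in> pol (l i)"
    "\<And>K. K \<in> C \<Longrightarrow> x \<in> K \<Longrightarrow> y \<in> pol K \<Longrightarrow> \<exists>i. K = l i"
    "\<And>i j. l i \<subset> l j \<longleftrightarrow> j < i" "J = l i" "\<And>i. (l i, l (i + 1)) \<in> E"
proof -
  have "x \<in> X" "y \<in> Y" using assms closedD(1,6)[OF assms(1)] by blast+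
  then obtain l :: "int \<Rightarrow> 'a set" where l: "range l = {J \<in> C. x \<in> J \<and> y \<in> pol J}"
    "\<And>i j. l i \<subset> l j \<longleftrightarrow> j < i"
    using chain[of x y] edge_A[OF assms(2,3)] by metis
  have mem: "K \<in> range l \<longleftrightarrow> K \<in> C \<and> x \<in> K \<and> y \<in> pol K" for K
    unfolding l(1) by simp
  have at: "l i \<in> C \<and> x \<in> l i \<and> y \<in> pol (l i)" for i
    using mem[of "l i"] by simp
  have ex: "\<exists>i. K = l i" if "K \<in> C" "x \<in> K" "y \<in> pol K" for K
    using mem[of K] that by (simp add: image_iff)
  obtain i where i: "J = l i" using ex[OF assms] by blast
  have "(l i, l (i + 1)) \<in> E" for i
  proof -
    have False if Z: "Z \<in> C" "l (i + 1) \<subset> Z" "Z \<subset> l i" for Z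
    proof -
      have "x \<in> Z" "y \<in> pol Z"
        using polar_antimono[of Z "l i" A] Z at[of i] at[of "i + 1"] by blast+
      then obtain k where "Z = l k" using ex Z(1) by blast
      then show False using Z(2,3) l(2) by auto
    qed
    then show ?thesis using at[of i] at[of "i + 1"] l(2)[of "i + 1" i] by (auto simp: cover_edges_def)
  qed
  then show thesis using that[OF at ex l(2) i] by blast
qed

lemma comparable:
  assumes "J \<in> C" "K \<in> C" "x \<in> J" "x \<in> K" "y \<in> pol J" "y \<in> pol K"
  shows "J \<subseteq> K \<or> K \<subseteq> J"
proof (rule chain_at[OF assms(1,3,5)])
  fix l :: "int \<Rightarrow> 'a set" and i
  assume l: "\<And>K. K \<in> C \<Longrightarrow> x \<in> K \<Longrightarrow> y \<in> pol K \<Longrightarrow> \<exists>i. K = l i"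
    "\<And>i j. l i \<subset> l j \<longleftrightarrow> j < i" "J = l i"
  obtain j where "K = l j" using l(1) assms by blast
  then show ?thesis using l(2)[of i j] l(2)[of j i] l(3) by (cases i j rule: linorder_cases) auto
qed

text \<open>Both covers contain \<open>x\<close> and inherit an upper bound from \<open>J\<close>,
  so they lie in one chain. Thus a cover below \<open>J\<close> is known from any one of its
  points.\<close>

lemma cover_down_unique:
  assumes "(J, K) \<in> E" "(J, K') \<in> E" "x \<in> K" "x \<in> K'"
  shows "K = K'"
proof -
  have C: "J \<in> C" "K \<in> C" "K' \<in> C" "K \<subset> J" "K' \<subset> J" using assms by (auto simp: cover_edges_def)
  then obtain y where "y \<in> pol J" using closed_point polar_point by blast
  then have "y \<in> pol K" "y \<in> pol K'" using polar_antimono[of K J A] polar_antimono[of K' J A] C by auto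
  then have "K \<subseteq> K' \<or> K' \<subseteq> K" using comparable[OF C(2,3) assms(3,4)] by blast
  then show ?thesis using assms(1,2) C by (auto simp: cover_edges_def)
qed

lemma cover_up_unique:
  assumes "(K, J) \<in> E" "(K', J) \<in> E" "y \<in> pol K" "y \<in> pol K'"
  shows "K = K'"
proof -
  have C: "J \<in> C" "K \<in> C" "K' \<in> C" "J \<subset> K" "J \<subset> K'" using assms by (auto simp: cover_edges_def)
  then obtain x where "x \<in> J" using closed_point polar_point by blast
  then have "K \<subseteq> K' \<or> K' \<subseteq> K"
    using comparable[OF C(2,3) _ _ assms(3,4)] C(4,5) by blast
  then show ?thesis using assms(1,2) C by (auto simp: cover_edges_def)
qed

lemma ex_cover_below:
  assumes J: "J \<in> C" "x \<in> J"
  shows "\<exists>K. (J, K) \<in> E \<and> x \<in> K"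
proof -
  obtain y where "y \<in> pol J" using closedD(7)[OF J(1)] by blast
  then show ?thesis by (rule chain_at[OF J]) blast
qed

lemma ex_cover_above:
  assumes J: "J \<in> C" "y \<in> pol J"
  shows "\<exists>K. (K, J) \<in> E \<and> y \<in> pol K"
proof -
  obtain x where "x \<in> J" using closedD(2)[OF J(1)] by blast
  from chain_at[OF J(1) this J(2)] obtain l :: "int \<Rightarrow> 'a set" and i where
    l: "\<And>i. y \<in> pol (l i)" "J = l i" "\<And>i. (l i, l (i + 1)) \<in> E" by metis
  then have "(l (i - 1), J) \<in> E" using l(3)[of "i - 1"] by simp
  then show ?thesis using l(1) by blast
qed

lemma rtrancl_subset: "(J, K) \<in> E\<^sup>* \<Longrightarrow> K \<subseteq> J"
  by (induction rule: rtrancl_induct) (use E_psubset in blast)+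

lemma trancl_psubset: "(J, K) \<in> E\<^sup>+ \<Longrightarrow> K \<subset> J"
  by (induction rule: trancl_induct) (use E_psubset in blast)+

lemma acyclic_E: "acyclic E"
  using trancl_psubset by (blast intro: acyclicI)

text \<open>A point of the smaller set and an upper bound of the larger one put both into a single
  integer-indexed chain, where only finitely many covering steps separate them.\<close>

lemma subset_rtrancl:
  assumes "J \<in> C" "K \<in> C" "K \<subseteq> J"
  shows "(J, K) \<in> E\<^sup>*"
proof -
  obtain x where xK: "x \<in> K" using closedD(2)[OF assms(2)] by blast
  obtain y where yJ: "y \<in> pol J" using closedD(7)[OF assms(1)] by blast
  have xJ: "x \<in> J" and yK: "y \<in> pol K" using xK yJ polar_antimono[OF assms(3), of A] assms(3) by auto
  show ?thesis
  proof (rule chain_at[OF assms(1) xJ yJ])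
    fix l :: "int \<Rightarrow> 'a set" and i
    assume l: "\<And>K. K \<in> C \<Longrightarrow> x \<in> K \<Longrightarrow> y \<in> pol K \<Longrightarrow> \<exists>i. K = l i"
      "\<And>i j. l i \<subset> l j \<longleftrightarrow> j < i" "J = l i" "\<And>i. (l i, l (i + 1)) \<in> E"
    obtain j where j: "K = l j" using l(1) assms xK yK by blast
    have "\<not> J \<subset> K" using assms(3) by blast
    then have "i \<le> j" using l(2)[of i j] l(3) j by simp
    then have "(l i, l j) \<in> E\<^sup>*"
      by (induction rule: int_ge_induct) (auto intro: rtrancl_into_rtrancl l(4))
    then show ?thesis using l(3) j by simp
  qed
qed

lemma rtrancl_iff: "J \<in> C \<Longrightarrow> (J, K) \<in> E\<^sup>* \<longleftrightarrow> K \<in> C \<and> K \<subseteq> J"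
proof
  assume J: "J \<in> C" and JK: "(J, K) \<in> E\<^sup>*"
  from JK have "K \<in> C"
    by (induction rule: rtrancl_induct) (use J E_subset in blast)+
  then show "K \<in> C \<and> K \<subseteq> J" using rtrancl_subset[OF JK] by blast
qed (blast intro: subset_rtrancl)

section \<open>Intersection property and local tree structure\<close>

lemma is_digraph_E: "is_digraph C E"
  unfolding is_digraph_def irrefl_def
proof (intro conjI allI asymI E_subset)
  show "(J, J) \<notin> E" for J using E_psubset by blast
  show "(K, J) \<notin> E" if "(J, K) \<in> E" for J K using E_psubset[OF that] E_psubset[of K J] by blast
qed

text \<open>The witness is \<open>J \<inter> K\<close>: it is closed under the polarity, has two
  points because a common descendant does, and has two upper bounds because \<open>J\<close>
  does.\<close>

lemma intersection_property_E: "intersection_property C E"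
  unfolding intersection_property_def
proof (intro ballI impI)
  fix J K assume J: "J \<in> C" and K: "K \<in> C" and ne: "desc E J \<inter> desc E K \<noteq> {}"
  then have "\<exists>L. L \<in> C \<and> L \<subseteq> J \<inter> K" by (auto simp: desc_def rtrancl_iff)
  then obtain L where L: "L \<in> C" "L \<subseteq> J \<inter> K" by blast
  have "pol J \<subseteq> pol (J \<inter> K)" "pol K \<subseteq> pol (J \<inter> K)" by (simp_all add: polar_antimono)
  then have "pol (pol (J \<inter> K)) \<subseteq> J \<inter> K"
    using polar_antimono[of "pol J" "pol (J \<inter> K)" A] polar_antimono[of "pol K" "pol (J \<inter> K)" A]
      closedD(5)[OF J] closedD(5)[OF K] by simp
  moreover have "two_points (pol (J \<inter> K))"
    using two_points_mono[OF closedD(4)[OF J]] \<open>pol J \<subseteq> pol (J \<inter> K)\<close> by blast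
  moreover have "two_points (J \<inter> K)" using two_points_mono[OF closedD(3)[OF L(1)] L(2)] .
  ultimately have Z: "J \<inter> K \<in> C"
    using polar_polar[of "J \<inter> K"] closedD(1)[OF J] by (auto simp: closed_sets_def)
  show "\<exists>Z\<in>desc E J \<inter> desc E K. desc E J \<inter> desc E K = desc E Z"
    by (rule bexI[of _ "J \<inter> K"]) (use J K Z in \<open>auto simp: desc_def rtrancl_iff\<close>)
qed

text \<open>Different covers below \<open>J\<close> are disjoint, so choosing a point from each is
  injective; above \<open>J\<close> the same works with upper bounds.\<close>

lemma countable_covers:
  assumes J: "J \<in> C"
  shows "countable (E `` {J})" "countable (E\<inverse> `` {J})"
proof -
  have "\<exists>x. x \<in> K" if "K \<in> E `` {J}" for K
    using that closed_point[of K] by (auto simp: cover_edges_def)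
  then obtain f where f: "\<And>K. K \<in> E `` {J} \<Longrightarrow> f K \<in> K" by metis
  have "inj_on f (E `` {J})"
    by (rule inj_onI) (metis Image_singleton_iff cover_down_unique f)
  moreover have "f ` (E `` {J}) \<subseteq> X \<union> Y"
  proof
    fix z assume "z \<in> f ` (E `` {J})"
    then obtain K where K: "K \<in> E `` {J}" "z = f K" by blast
    then have "K \<in> C" by (auto simp: cover_edges_def)
    then show "z \<in> X \<union> Y" using f[OF K(1)] K(2) closedD(1) by blast
  qed
  ultimately show "countable (E `` {J})" using count by (meson countable_image_inj_on countable_subset)
  have "\<exists>y. y \<in> pol K" if "K \<in> E\<inverse> `` {J}" for K
    using that polar_point[of K] by (auto simp: cover_edges_def)
  then obtain g where g: "\<And>K. K \<in> E\<inverse> `` {J} \<Longrightarrow> g K \<in> pol K" by metis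
  have "inj_on g (E\<inverse> `` {J})"
    by (rule inj_onI) (metis Image_singleton_iff converse_iff cover_up_unique g)
  moreover have "g ` (E\<inverse> `` {J}) \<subseteq> X \<union> Y"
  proof
    fix z assume "z \<in> g ` (E\<inverse> `` {J})"
    then obtain K where K: "K \<in> E\<inverse> `` {J}" "z = g K" by blast
    then have "K \<in> C" by (auto simp: cover_edges_def)
    then show "z \<in> X \<union> Y" using g[OF K(1)] K(2) closedD(6) by blast
  qed
  ultimately show "countable (E\<inverse> `` {J})" using count by (meson countable_image_inj_on countable_subset)
qed

text \<open>A cover below \<open>J\<close> misses some point of \<open>J\<close>, and a cover
  through that point is a second one; dually with upper bounds.\<close>

lemma two_covers:
  assumes J: "J \<in> C"
  shows "two_points (E `` {J})" "two_points (E\<inverse> `` {J})"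
proof -
  obtain x K where K: "(J, K) \<in> E" "x \<in> K" using ex_cover_below closed_point polar_point J by blast
  then obtain x' where x': "x' \<in> J" "x' \<notin> K" using E_psubset by blast
  then obtain K' where "(J, K') \<in> E" "x' \<in> K'" using ex_cover_below J by blast
  with K x' show "two_points (E `` {J})" by (auto simp: two_points_def)
  obtain y K where K: "(K, J) \<in> E" "y \<in> pol K" using ex_cover_above closed_point polar_point J by blast
  have "K \<in> C" "\<not> K \<subseteq> J" using K by (auto simp: cover_edges_def)
  then obtain y' where y': "y' \<in> pol J" "y' \<notin> pol K" using polar_subset_polar_iff J by blast
  then obtain K' where "(K', J) \<in> E" "y' \<in> pol K'" using ex_cover_above J by blast
  then have "K \<in> E\<inverse> `` {J}" "K' \<in> E\<inverse> `` {J}" "K \<noteq> K'" using K(1) y'(2) by blast+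
  then show "two_points (E\<inverse> `` {J})" unfolding two_points_def by blast
qed

lemma locally_tree_like_E: "locally_tree_like C E"
  unfolding locally_tree_like_def
proof (intro conjI ballI)
  fix J assume J: "J \<in> C"
  show "two_to_countable (E `` {J})" "two_to_countable (E\<inverse> `` {J})"
    using two_covers countable_covers J by (auto intro: two_to_countableI)
  show "digraph_tree (desc E J) (Restr E (desc E J))"
  proof (rule unique_parent_imp_tree_desc[OF acyclic_E])
    fix w w1 w2 assume w: "(w1, w) \<in> E" "(w2, w) \<in> E" "(J, w1) \<in> E\<^sup>*" "(J, w2) \<in> E\<^sup>*"
    obtain y where "y \<in> pol J" using closed_point polar_point J by blast
    then have "y \<in> pol w1" "y \<in> pol w2"
      using polar_antimono[OF rtrancl_subset[OF w(3)]] polar_antimono[OF rtrancl_subset[OF w(4)]] by blast+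
    then show "w1 = w2" using cover_up_unique w by blast
  qed
  have "digraph_tree (desc (E\<inverse>) J) (Restr (E\<inverse>) (desc (E\<inverse>) J))"
  proof (rule unique_parent_imp_tree_desc)
    show "acyclic (E\<inverse>)" using acyclic_E by simp
    fix w w1 w2 assume "(w1, w) \<in> E\<inverse>" "(w2, w) \<in> E\<inverse>" "(J, w1) \<in> (E\<inverse>)\<^sup>*" "(J, w2) \<in> (E\<inverse>)\<^sup>*"
    then have w: "(w, w1) \<in> E" "(w, w2) \<in> E" "J \<subseteq> w1" "J \<subseteq> w2"
      using rtrancl_subset by (auto simp: rtrancl_converse)
    obtain x where "x \<in> J" using closed_point polar_point J by blast
    then show "w1 = w2" using cover_down_unique[OF w(1,2)] w(3,4) by blast
  qed
  then show "digraph_tree (anc E J) (Restr E (anc E J))"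
    by (simp add: digraph_tree_converse Restr_converse flip: anc_eq_desc_converse)
qed

section \<open>Automorphisms of the bipartite graph\<close>

text \<open>Preservation of the parts is built in: an automorphism exchanging them would send
  subsets of \<open>X\<close> into \<open>Y\<close> and not act on the closed sets.\<close>

definition aut :: "('a \<Rightarrow> 'a) \<Rightarrow> bool" where
  "aut g \<longleftrightarrow> rel_aut (X \<union> Y) A g \<and> g ` X = X \<and> g ` Y = Y"

lemma A_V: "(a, b) \<in> A \<Longrightarrow> a \<in> X \<union> Y \<and> b \<in> X \<union> Y"
  using AXY by auto

lemma A_alternates: "(a, b) \<in> A \<Longrightarrow> a \<in> X \<longleftrightarrow> b \<notin> X"
  using AXY disj by blast

text \<open>Along a walk from the fixed vertex each edge switches the part both of the vertex and of
  its image, so connectedness forces both parts to be preserved.\<close>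

lemma aut_if_fixes:
  assumes f: "rel_aut (X \<union> Y) A f" and v: "v \<in> X \<union> Y" "f v = v"
  shows "aut f"
proof -
  have *: "w \<in> X \<union> Y \<and> (f w \<in> X \<longleftrightarrow> w \<in> X)" if "(v, w) \<in> (A \<union> A\<inverse>)\<^sup>*" for w
    using that
  proof (induction rule: rtrancl_induct)
    case base
    then show ?case using v by simp
  next
    case (step w w')
    then have "(w, w') \<in> A" using A_commute[of w w'] by auto
    moreover have "\<forall>a\<in>X \<union> Y. \<forall>b\<in>X \<union> Y. (a, b) \<in> A \<longleftrightarrow> (f a, f b) \<in> A"
      using f by (simp add: rel_iso_def)
    ultimately have "w' \<in> X \<union> Y" "(f w, f w') \<in> A" using A_V[of w w'] by blast+
    then show ?case using step.IH A_alternates[of w w'] A_alternates[of "f w" "f w'"] \<open>(w, w') \<in> A\<close> by simp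
  qed
  have X: "f w \<in> X \<longleftrightarrow> w \<in> X" if w: "w \<in> X \<union> Y" for w
  proof -
    have "(v, w) \<in> (A \<union> A\<inverse>)\<^sup>*" using conn v(1) w unfolding connected_on_def by blast
    then show ?thesis using * by blast
  qed
  have img: "f ` (X \<union> Y) = X \<union> Y" using f by (simp add: rel_iso_def bij_betw_def)
  have "f ` X \<subseteq> X" using X by auto
  moreover have "f ` Y \<subseteq> Y"
  proof
    fix z assume "z \<in> f ` Y"
    then obtain w where "w \<in> Y" "z = f w" by blast
    then show "z \<in> Y" using X[of w] img disj by blast
  qed
  moreover have "X \<union> Y \<subseteq> f ` X \<union> f ` Y" using img by (simp add: image_Un)
  ultimately have sub: "f ` X \<subseteq> X" "f ` Y \<subseteq> Y" "X \<union> Y \<subseteq> f ` X \<union> f ` Y" by auto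
  have "X \<subseteq> f ` X"
  proof
    fix z assume z: "z \<in> X"
    then have "z \<in> f ` X \<or> z \<in> f ` Y" "z \<notin> Y" using sub(3) disj by auto
    then show "z \<in> f ` X" using sub(2) by auto
  qed
  moreover have "Y \<subseteq> f ` Y"
  proof
    fix z assume z: "z \<in> Y"
    then have "z \<in> f ` X \<or> z \<in> f ` Y" "z \<notin> X" using sub(3) disj by auto
    then show "z \<in> f ` Y" using sub(1) by auto
  qed
  ultimately have "f ` X = X" "f ` Y = Y" using sub by (simp_all add: subset_antisym)
  then show ?thesis using f by (simp add: aut_def)
qed

lemma aut_comp: "aut f \<Longrightarrow> aut g \<Longrightarrow> aut (g \<circ> f)"
  unfolding aut_def by (metis image_comp rel_iso_comp)

lemma aut_id: "aut (\<lambda>x. x)"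
  by (simp add: aut_def rel_aut_id)

lemma aut_inv:
  assumes "aut g" shows "aut (inv_into (X \<union> Y) g)"
proof -
  let ?h = "inv_into (X \<union> Y) g"
  have g: "inj_on g (X \<union> Y)" "g ` X = X" "g ` Y = Y"
    using assms by (simp_all add: aut_def rel_iso_def bij_betw_def)
  have "?h ` g ` X = X" "?h ` g ` Y = Y"
    using inv_into_image_cancel[OF g(1)] by auto
  then show ?thesis using g rel_iso_inv[of "X \<union> Y" A "X \<union> Y" A g] assms unfolding aut_def by simp
qed

lemma aut_A: "aut g \<Longrightarrow> a \<in> X \<union> Y \<Longrightarrow> b \<in> X \<union> Y \<Longrightarrow> (g a, g b) \<in> A \<longleftrightarrow> (a, b) \<in> A"
  unfolding aut_def rel_iso_def by blast

lemma polar_image: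
  assumes g: "aut g" and S: "S \<subseteq> X \<union> Y" "S \<noteq> {}"
  shows "pol (g ` S) = g ` pol S"
proof (intro set_eqI iffI)
  fix z assume "z \<in> g ` pol S"
  then obtain w where w: "w \<in> pol S" "z = g w" by blast
  moreover have "w \<in> X \<union> Y" using w S A_V by (auto simp: polar_def)
  ultimately show "z \<in> pol (g ` S)" using aut_A[OF g] S by (auto simp: polar_def)
next
  fix z assume z: "z \<in> pol (g ` S)"
  then have "z \<in> X \<union> Y" using S A_V by (auto simp: polar_def)
  moreover have "g ` (X \<union> Y) = X \<union> Y" using g by (simp add: aut_def rel_iso_def bij_betw_def)
  ultimately obtain w where w: "w \<in> X \<union> Y" "z = g w" by (metis imageE)
  then have "w \<in> pol S" using z S aut_A[OF g] by (auto simp: polar_def)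
  then show "z \<in> g ` pol S" using w by blast
qed

lemma aut_inj: "aut g \<Longrightarrow> inj_on g (X \<union> Y)"
  by (simp add: aut_def rel_iso_def bij_betw_def)

lemma image_closed:
  assumes g: "aut g" and J: "J \<in> C"
  shows "g ` J \<in> C"
proof -
  have J': "J \<subseteq> X \<union> Y" "J \<noteq> {}" "pol J \<subseteq> X \<union> Y" "pol J \<noteq> {}" using closedD[OF J] by auto
  have "two_points (g ` J)" "two_points (g ` pol J)"
    using two_points_image closedD(3,4)[OF J] inj_on_subset[OF aut_inj[OF g]] J' by blast+
  moreover have "g ` J \<subseteq> X" using closedD(1)[OF J] g by (auto simp: aut_def)
  ultimately show ?thesis
    using polar_image[OF g J'(1,2)] polar_image[OF g J'(3,4)] closedD(5)[OF J] by (simp add: closed_sets_def)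
qed

lemma rel_aut_image:
  assumes g: "aut g" shows "rel_aut C E ((`) g)"
proof (rule rel_iso_cover_edges)
  have sub: "J \<subseteq> X \<union> Y" if "J \<in> C" for J using closedD(1)[OF that] by blast
  show "g ` J \<subseteq> g ` K \<longleftrightarrow> J \<subseteq> K" if "J \<in> C" "K \<in> C" for J K
    using image_subset_image_iff[OF aut_inj[OF g] sub[OF that(1)] sub[OF that(2)]] .
  show "bij_betw ((`) g) C C"
  proof (rule bij_betw_imageI)
    show "inj_on ((`) g) C"
      by (rule inj_onI) (metis sub inj_on_image_eq_iff[OF aut_inj[OF g]])
    show "(`) g ` C = C"
    proof
      show "(`) g ` C \<subseteq> C" using image_closed[OF g] by blast
      show "C \<subseteq> (`) g ` C"
      proof
        fix K assume K: "K \<in> C"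
        let ?h = "inv_into (X \<union> Y) g"
        have "g ` (X \<union> Y) = X \<union> Y" using g by (simp add: aut_def rel_iso_def bij_betw_def)
        then have "g (?h z) = z" if "z \<in> K" for z
          using that sub[OF K] f_inv_into_f[of z g "X \<union> Y"] by blast
        then have "K = g ` ?h ` K" by (auto simp: image_image)
        then show "K \<in> (`) g ` C" using image_closed[OF aut_inv[OF g] K] by blast
      qed
    qed
  qed
qed

lemma arc_stabilizer:
  assumes "(v, a) \<in> A" "(a, b) \<in> A" "v \<noteq> b" "(v, a') \<in> A" "(a', b') \<in> A" "v \<noteq> b'"
  obtains f where "aut f" "f v = v" "f a = a'" "f b = b'"
proof -
  have arc: "graph_arc (X \<union> Y) A 2 [v, a, b]" if "(v, a) \<in> A" "(a, b) \<in> A" "v \<noteq> b" for a b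
    using that A_V by (auto simp: graph_arc_def less_Suc_eq numeral_2_eq_2)
  have v: "v \<in> X \<union> Y" using assms A_V by blast
  obtain f where f: "rel_aut (X \<union> Y) A f" "f v = v" "map f [v, a, b] = [v, a', b']"
    using arc2 arc[OF assms(1-3)] arc[OF assms(4-6)] v unfolding locally_arc_transitive_def
    by (metis list.sel(1))
  then show thesis using that[OF aut_if_fixes[OF f(1) v f(2)]] by simp
qed

lemma closed_at_edge: "(x, y) \<in> A \<Longrightarrow> x \<in> X \<Longrightarrow> \<exists>J\<in>C. x \<in> J \<and> y \<in> pol J"
proof -
  assume xy: "(x, y) \<in> A" "x \<in> X"
  then have "y \<in> Y" using AXY disj by auto
  then obtain l :: "int \<Rightarrow> 'a set" where l: "range l = {J \<in> C. x \<in> J \<and> y \<in> pol J}"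
    using chain[OF xy(2) _ xy(1)] by metis
  have "l 0 \<in> {J \<in> C. x \<in> J \<and> y \<in> pol J}" unfolding l[symmetric] by simp
  then show ?thesis by blast
qed

text \<open>Some closed set \<open>J\<close> at the edge of \<open>x\<close> and \<open>y\<close>
  has a further upper bound \<open>y1\<close>. The stabilizer of \<open>y\<close> takes the 2-arc
  \<open>y, x, y1\<close> to \<open>y, x, y'\<close>, so the image of \<open>J\<close> lies below
  both \<open>y\<close> and \<open>y'\<close> and supplies the two points.\<close>

lemma meet_closed:
  assumes "y \<in> Y" "y' \<in> Y" "y \<noteq> y'" "(x, y) \<in> A" "(x, y') \<in> A"
  shows "pol {y, y'} \<in> C"
proof -
  interpret d: bipartite Y X A by (rule bipartite_dual)
  have "x \<in> X" using assms AXY disj by auto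
  then obtain J where J: "J \<in> C" "x \<in> J" "y \<in> pol J" using closed_at_edge assms by blast
  obtain y1 where y1: "y1 \<in> pol J" "y1 \<noteq> y" using two_points_other closedD(4)[OF J(1)] by metis
  have A: "(y, x) \<in> A" "(x, y1) \<in> A" using edge_A[OF J(2) y1(1)] A_commute[of y x] assms by auto
  obtain f where f: "aut f" "f y = y" "f x = x" "f y1 = y'"
    using arc_stabilizer[OF A _ A(1) assms(5)] y1 assms by metis
  have JX: "J \<subseteq> X \<union> Y" "J \<noteq> {}" using closedD[OF J(1)] by auto
  have "f ` {y, y1} \<subseteq> f ` pol J" using J y1 by blast
  then have "{y, y'} \<subseteq> pol (f ` J)" using f polar_image[OF f(1) JX] by simp
  then have sub: "f ` J \<subseteq> pol {y, y'}" by (rule subset_polar_iff[THEN iffD1])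
  have "two_points (pol {y, y'})"
    by (rule two_points_mono[OF closedD(3)[OF image_closed[OF f(1) J(1)]] sub])
  moreover have "two_points (pol (pol {y, y'}))"
    using polar_polar[of "{y, y'}"] assms(3) by (auto simp: two_points_def)
  ultimately show ?thesis
    using d.polar_subset_Y[of "{y, y'}"] assms(1,2) polar_polar_polar by (auto simp: closed_sets_def)
qed

lemma ramify:
  assumes J: "J \<in> C" "y \<in> pol J"
  shows "\<exists>y1\<in>pol J. y1 \<noteq> y \<and> pol {y, y1} = J"
proof -
  obtain K where K: "(K, J) \<in> E" "y \<in> pol K" using ex_cover_above J by blast
  then have KC: "K \<in> C" "J \<subset> K" and between: "\<And>Z. Z \<in> C \<Longrightarrow> J \<subset> Z \<Longrightarrow> Z \<subset> K \<Longrightarrow> False"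
    by (auto simp: cover_edges_def)
  have "\<not> pol J \<subseteq> pol K" using polar_subset_polar_iff[OF J(1) KC(1)] KC(2) by auto
  then obtain y1 where y1: "y1 \<in> pol J" "y1 \<notin> pol K" by blast
  have ne: "y1 \<noteq> y" using K y1 by blast
  have Y: "y \<in> Y" "y1 \<in> Y" using closedD(6)[OF J(1)] J(2) y1(1) by auto
  obtain x where x: "x \<in> J" using closed_point polar_point J by blast
  let ?m = "pol {y, y1}"
  have "?m \<in> C"
    using meet_closed[OF Y ne[symmetric] edge_A[OF x J(2)] edge_A[OF x y1(1)]] .
  have "J \<subseteq> ?m" by (rule subset_polar_iff[THEN iffD1]) (use J y1 in simp)
  have ym: "y \<in> pol ?m" "y1 \<in> pol ?m" using polar_polar[of "{y, y1}"] by auto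
  have "\<not> K \<subseteq> ?m" using polar_antimono[of K ?m A] ym y1 by blast
  \<comment> \<open>Both sets contain \<open>x\<close> and are bounded by \<open>y\<close>. As
    \<open>y1\<close> bounds \<open>?m\<close> but not \<open>K\<close>, the meet is strictly inside
    the cover \<open>K\<close> and must be \<open>J\<close>.\<close>
  moreover have "K \<subseteq> ?m \<or> ?m \<subseteq> K"
    using comparable[OF KC(1) \<open>?m \<in> C\<close> _ _ K(2) ym(1)] x \<open>J \<subseteq> ?m\<close> KC(2) by blast
  ultimately have "?m = J" using between[OF \<open>?m \<in> C\<close>] \<open>J \<subseteq> ?m\<close> by blast
  then show ?thesis using y1 ne by blast
qed

section \<open>Transitivity on the 2-arcs that start in \<open>Y\<close>\<close>

lemma other_neighbour:
  assumes "(x, y) \<in> A" "x \<in> X"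
  obtains x' where "(x', y) \<in> A" "x' \<noteq> x"
proof -
  obtain J where J: "J \<in> C" "y \<in> pol J" using closed_at_edge assms by blast
  obtain x' where "x' \<in> J" "x' \<noteq> x" using two_points_other closedD(3)[OF J(1)] by metis
  then show thesis using that edge_A[OF _ J(2)] by blast
qed

text \<open>Vertex stabilizers suffice: the stabilizer of \<open>x\<close> permutes the neighbours
  of \<open>x\<close> transitively, and walks in the connected graph reach all of
  \<open>Y\<close>.\<close>

lemma transitive_on_Y:
  assumes y: "y \<in> Y" "y' \<in> Y"
  obtains g where "aut g" "g y = y'"
proof -
  interpret d: dense_bipartite Y X A by (rule dense_dual)
  have move: "\<exists>f. aut f \<and> f v = v'" if vv: "(x, v) \<in> A" "(x, v') \<in> A" "v \<in> Y" "v' \<in> Y" for x v v'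
  proof -
    have x: "x \<in> X" using vv AXY disj by auto
    \<comment> \<open>The hypothesis concerns 2-arcs, so the edges from \<open>x\<close> to
      \<open>v\<close> and to \<open>v'\<close> are each prolonged by one more vertex.\<close>
    obtain a where a: "(a, v) \<in> A" "a \<noteq> x" using other_neighbour vv x by metis
    obtain a' where a': "(a', v') \<in> A" "a' \<noteq> x" using other_neighbour vv x by metis
    show ?thesis using arc_stabilizer[of x v a v' a'] vv a a' A_commute by metis
  qed
  \<comment> \<open>At a vertex of \<open>X\<close> the claim is about all its neighbours, since
    automorphisms in \<open>aut\<close> never take \<open>y\<close> into \<open>X\<close>.\<close>
  have "(v \<in> Y \<longrightarrow> (\<exists>g. aut g \<and> g y = v)) \<and>
      (v \<in> X \<longrightarrow> (\<forall>w. (v, w) \<in> A \<longrightarrow> (\<exists>g. aut g \<and> g y = w)))" if "(y, v) \<in> (A \<union> A\<inverse>)\<^sup>*" for v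
    using that
  proof (induction rule: rtrancl_induct)
    case base
    then show ?case using aut_id y disj by auto
  next
    case (step v v')
    then have vv': "(v, v') \<in> A" "(v', v) \<in> A" using A_commute[of v v'] by auto
    show ?case
    proof (cases "v \<in> X")
      case True
      then have "v' \<notin> X" using A_alternates[OF vv'(1)] by simp
      then show ?thesis using step.IH True vv'(1) by blast
    next
      case False
      then have v: "v \<in> Y" "v' \<in> X" using vv'(1) AXY by blast+
      then obtain g where g: "aut g" "g y = v" using step.IH by blast
      have "\<exists>g. aut g \<and> g y = w" if w: "(v', w) \<in> A" for w
      proof -
        have "w \<in> Y" using w v AXY disj by blast
        then obtain f where "aut f" "f v = w" using move[OF vv'(2) w v(1)] by blast
        then show ?thesis using aut_comp[OF g(1)] g by (metis comp_apply)
      qed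
      then show ?thesis using v disj by blast
    qed
  qed
  moreover have "(y, y') \<in> (A \<union> A\<inverse>)\<^sup>*" using conn y unfolding connected_on_def by blast
  ultimately show thesis using that y by blast
qed

lemma transitive_on_arcs:
  assumes "y \<in> Y" "(y, x) \<in> A" "(x, y1) \<in> A" "y \<noteq> y1" "y' \<in> Y" "(y', x') \<in> A" "(x', y1') \<in> A" "y' \<noteq> y1'"
  obtains g where "aut g" "g y = y'" "g x = x'" "g y1 = y1'"
proof -
  obtain g where g: "aut g" "g y = y'" using transitive_on_Y assms by metis
  have V: "x \<in> X \<union> Y" "y \<in> X \<union> Y" "y1 \<in> X \<union> Y" using assms A_V by blast+
  then have "(y', g x) \<in> A" "(g x, g y1) \<in> A"
    using aut_A[OF g(1)] assms g(2) by blast+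
  moreover have "y' \<noteq> g y1" using inj_onD[OF aut_inj[OF g(1)]] V assms g(2) by metis
  ultimately obtain f where "aut f" "f y' = y'" "f (g x) = x'" "f (g y1) = y1'"
    using arc_stabilizer assms(6-8) by metis
  then show thesis using that[of "f \<circ> g"] aut_comp[OF g(1)] g(2) by simp
qed

section \<open>The digraph of closed sets\<close>

text \<open>Two closed sets with a common point are linked through the meet
  \<open>pol {y, y'}\<close> of upper bounds, two with a common upper bound through the join
  \<open>pol (pol {x, x'})\<close> of points. A walk in the graph then strings together closed sets
  at consecutive edges.\<close>

lemma connected_E: "connected_on C E"
proof -
  let ?R = "(E \<union> E\<inverse>)\<^sup>*"
  have sym: "(K, J) \<in> ?R" if "(J, K) \<in> ?R" for J K
    using that sym_rtrancl[of "E \<union> E\<inverse>"] by (metis sym_Un_converse symD)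
  have "(J, K) \<in> ?R" if "J \<in> C" "K \<in> C" "K \<subseteq> J" for J K
    using subset_rtrancl[OF that] rtrancl_mono[of E "E \<union> E\<inverse>"] by blast
  then have sub: "(J, K) \<in> ?R" if "J \<in> C" "K \<in> C" "J \<subseteq> K \<or> K \<subseteq> J" for J K
    using sym that by blast
  interpret d: dense_bipartite Y X A by (rule dense_dual)
  have shareX: "(J, K) \<in> ?R" if JK: "J \<in> C" "K \<in> C" "x \<in> J" "x \<in> K" for J K x
  proof -
    obtain y y' where y: "y \<in> pol J" "y' \<in> pol K" using polar_point[OF JK(1)] polar_point[OF JK(2)] by blast
    show ?thesis
    proof (cases "y = y'")
      case True
      then show ?thesis using sub comparable[OF JK] JK y by blast
    next
      case False
      have m: "pol {y, y'} \<in> C" "x \<in> pol {y, y'}" "y \<in> pol (pol {y, y'})" "y' \<in> pol (pol {y, y'})"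
        using meet_closed[of y y' x] edge_A[of x J y] edge_A[of x K y'] JK y False
          closedD(6)[OF JK(1)] closedD(6)[OF JK(2)] polar_polar[of "{y, y'}"] A_commute[of x] by (auto simp: polar_def)
      have "(J, pol {y, y'}) \<in> ?R" using sub[OF JK(1) m(1)] comparable[OF JK(1) m(1) JK(3) m(2) y(1) m(3)] by blast
      moreover have "(pol {y, y'}, K) \<in> ?R" using sub[OF m(1) JK(2)] comparable[OF m(1) JK(2) m(2) JK(4) m(4) y(2)] by blast
      ultimately show ?thesis by (rule rtrancl_trans)
    qed
  qed
  have shareY: "(J, K) \<in> ?R" if JK: "J \<in> C" "K \<in> C" "y \<in> pol J" "y \<in> pol K" for J K y
  proof -
    obtain x x' where x: "x \<in> J" "x' \<in> K" using closed_point[OF JK(1)] closed_point[OF JK(2)] by blast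
    show ?thesis
    proof (cases "x = x'")
      case True
      then show ?thesis using sub comparable[OF JK(1,2) _ _ JK(3,4)] JK x by blast
    next
      case False
      have X: "x \<in> X" "x' \<in> X" using x closedD(1) JK by blast+
      have e: "(y, x) \<in> A" "(y, x') \<in> A" using edge_A[OF x(1) JK(3)] edge_A[OF x(2) JK(4)] A_commute[of y] by auto
      have m: "pol (pol {x, x'}) \<in> C"
        using d.meet_closed[OF X False e] d.polar_closed by blast
      have ym: "y \<in> pol (pol (pol {x, x'}))" using e A_commute[of y] unfolding polar_polar_polar by (auto simp: polar_def)
      have xm: "x \<in> pol (pol {x, x'})" "x' \<in> pol (pol {x, x'})" using polar_polar[of "{x, x'}"] by auto
      have "(J, pol (pol {x, x'})) \<in> ?R" using sub[OF JK(1) m] comparable[OF JK(1) m x(1) xm(1) JK(3) ym] by blast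
      moreover have "(pol (pol {x, x'}), K) \<in> ?R" using sub[OF m JK(2)] comparable[OF m JK(2) xm(2) x(2) ym JK(4)] by blast
      ultimately show ?thesis by (rule rtrancl_trans)
    qed
  qed
  obtain a b where ab: "(a, b) \<in> A" using nonempty by auto
  then obtain J1 where "J1 \<in> C"
    using closed_at_edge[OF ab] closed_at_edge[of b a] A_alternates[OF ab] A_commute[of a b] by blast
  moreover have "(J0, J) \<in> ?R" if J: "J0 \<in> C" "J \<in> C" for J0 J
  proof -
    obtain x0 x where x: "x0 \<in> J0" "x \<in> J" using closed_point J by blast
    then have "(x0, x) \<in> (A \<union> A\<inverse>)\<^sup>*"
      using conn closedD(1)[OF J(1)] closedD(1)[OF J(2)] unfolding connected_on_def by blast
    \<comment> \<open>The induction covers closed sets that have the current vertex as a point and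
      those that have it as an upper bound; a closed set \<open>K\<close> at the next edge serves
      both of its vertices.\<close>
    then have "\<forall>J\<in>C. x \<in> J \<or> x \<in> pol J \<longrightarrow> (J0, J) \<in> ?R"
    proof (induction rule: rtrancl_induct)
      case base
      have "x0 \<notin> pol J" if "J \<in> C" for J
        using closedD(6)[OF that] closedD(1)[OF J(1)] x(1) disj by blast
      then show ?case using shareX J(1) x(1) by blast
    next
      case (step v w)
      then have vw: "(v, w) \<in> A" "(w, v) \<in> A" using A_commute[of v w] by auto
      then obtain K where K: "K \<in> C" "v \<in> K \<and> w \<in> pol K \<or> w \<in> K \<and> v \<in> pol K"
        using closed_at_edge[OF vw(1)] closed_at_edge[OF vw(2)] A_alternates[OF vw(1)] by blast
      then have "(J0, K) \<in> ?R" using step.IH by blast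
      have cl: "w \<in> L \<longrightarrow> w \<in> X" "w \<in> pol L \<longrightarrow> w \<notin> X" if "L \<in> C" for L
        using closedD(1,6)[OF that] disj by blast+
      have "(K, J) \<in> ?R" if "J \<in> C" "w \<in> J \<or> w \<in> pol J" for J
      proof -
        have "w \<in> J \<and> w \<in> K \<or> w \<in> pol J \<and> w \<in> pol K"
          using that(2) K(2) cl[OF K(1)] cl[OF that(1)] by blast
        then show ?thesis using shareX shareY K(1) that(1) by blast
      qed
      with \<open>(J0, K) \<in> ?R\<close> show ?case by (meson rtrancl_trans)
    qed
    then show ?thesis using J x by blast
  qed
  ultimately show ?thesis by (auto simp: connected_on_def)
qed

text \<open>A point of the last set lies in all earlier ones, and it selects the next cover at every
  step.\<close>

lemma descending_unique:
  assumes "\<And>i. i < n \<Longrightarrow> (J i, J (Suc i)) \<in> E" "\<And>i. i < n \<Longrightarrow> (K i, K (Suc i)) \<in> E"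
    and "J 0 = K 0" "x \<in> J n" "x \<in> K n" "i \<le> n"
  shows "J i = K i"
proof -
  have x: "x \<in> L i" if "\<And>i. i < n \<Longrightarrow> (L i, L (Suc i)) \<in> E" "x \<in> L n" "i \<le> n" for L i
    using that(3,2)
  proof (induction rule: inc_induct)
    case (step m)
    then show ?case using E_psubset[OF that(1)[of m]] by blast
  qed
  show ?thesis using assms(6)
  proof (induction i)
    case (Suc i)
    then have "(J i, J (Suc i)) \<in> E" "(J i, K (Suc i)) \<in> E" using assms(1)[of i] assms(2)[of i] by auto
    moreover have "x \<in> J (Suc i)" "x \<in> K (Suc i)"
      using x[of J "Suc i"] x[of K "Suc i"] assms(1,2,4,5) Suc.prems by blast+
    ultimately show ?case by (rule cover_down_unique)
  qed (use assms in simp)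
qed

lemma ascending_unique:
  assumes "\<And>i. i < n \<Longrightarrow> (J (Suc i), J i) \<in> E" "\<And>i. i < n \<Longrightarrow> (K (Suc i), K i) \<in> E"
    and "J 0 = K 0" "y \<in> pol (J n)" "y \<in> pol (K n)" "i \<le> n"
  shows "J i = K i"
proof -
  have y: "y \<in> pol (L i)" if "\<And>i. i < n \<Longrightarrow> (L (Suc i), L i) \<in> E" "y \<in> pol (L n)" "i \<le> n" for L i
    using that(3,2)
  proof (induction rule: inc_induct)
    case (step m)
    then show ?case using polar_antimono[of "L m" "L (Suc m)" A] E_psubset[OF that(1)[of m]] by blast
  qed
  show ?thesis using assms(6)
  proof (induction i)
    case (Suc i)
    then have "(J (Suc i), J i) \<in> E" "(K (Suc i), J i) \<in> E" using assms(1)[of i] assms(2)[of i] by auto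
    moreover have "y \<in> pol (J (Suc i))" "y \<in> pol (K (Suc i))"
      using y[of J "Suc i"] y[of K "Suc i"] assms(1,2,4,5) Suc.prems by blast+
    ultimately show ?case by (rule cover_up_unique)
  qed (use assms in simp)
qed

text \<open>By \<open>ramify\<close> the first set of an arc is \<open>pol {y, y1}\<close>. Together
  with a point \<open>x\<close> of the last set this gives a 2-arc \<open>y, x, y1\<close> that
  determines the arc by \<open>descending_unique\<close>.\<close>

lemma highly_arc_transitive_E: "highly_arc_transitive C E"
  unfolding highly_arc_transitive_def arc_transitive_def
proof (intro allI impI, elim conjE)
  fix s p q assume "1 \<le> s" and p: "digraph_arc C E s p" and q: "digraph_arc C E s q"
  have arc: "\<exists>x y y1. y \<in> Y \<and> (y, x) \<in> A \<and> (x, y1) \<in> A \<and> y \<noteq> y1 \<and> x \<in> p ! s \<and> pol {y, y1} = p ! 0"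
    if p: "digraph_arc C E s p" for p
  proof -
    have C: "p ! s \<in> C" "p ! 0 \<in> C" and e: "\<And>i. i < s \<Longrightarrow> (p ! i, p ! Suc i) \<in> E"
      using p by (auto simp: digraph_arc_def)
    have "p ! s \<subseteq> p ! i" if "i \<le> s" for i
      using that
    proof (induction rule: inc_induct)
      case (step m)
      then show ?case using E_psubset[OF e[of m]] by blast
    qed simp
    then have sub: "p ! s \<subseteq> p ! 0" by simp
    obtain x y where xy: "x \<in> p ! s" "y \<in> pol (p ! 0)" using closed_point polar_point C by blast
    obtain y1 where y1: "y1 \<in> pol (p ! 0)" "y1 \<noteq> y" "pol {y, y1} = p ! 0" using ramify[OF C(2) xy(2)] by blast
    have "x \<in> p ! 0" using xy sub by blast
    then have "(y, x) \<in> A" "(x, y1) \<in> A"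
      using edge_A[OF _ xy(2)] edge_A[OF _ y1(1)] A_commute[of y x] by auto
    then show ?thesis using xy y1 closedD(6)[OF C(2)] by blast
  qed
  obtain x y y1 where P: "y \<in> Y" "(y, x) \<in> A" "(x, y1) \<in> A" "y \<noteq> y1" "x \<in> p ! s" "pol {y, y1} = p ! 0"
    using arc[OF p] by blast
  obtain x' y' y1' where Q: "y' \<in> Y" "(y', x') \<in> A" "(x', y1') \<in> A" "y' \<noteq> y1'" "x' \<in> q ! s" "pol {y', y1'} = q ! 0"
    using arc[OF q] by blast
  obtain g where g: "aut g" "g y = y'" "g x = x'" "g y1 = y1'"
    using transitive_on_arcs[OF P(1-4) Q(1-4)] by blast
  have E: "\<And>i. i < s \<Longrightarrow> (p ! i, p ! Suc i) \<in> E" "\<And>i. i < s \<Longrightarrow> (q ! i, q ! Suc i) \<in> E"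
    using p q by (auto simp: digraph_arc_def)
  have gE: "(g ` J, g ` K) \<in> E" if "(J, K) \<in> E" for J K
    using rel_aut_image[OF g(1)] that E_subset by (auto simp: rel_iso_def)
  have "g ` (p ! 0) = q ! 0"
    using polar_image[OF g(1), of "{y, y1}"] P Q g A_V by auto
  then have "g ` (p ! i) = q ! i" if "i \<le> s" for i
    by (intro descending_unique[of s "\<lambda>i. g ` (p ! i)" "\<lambda>i. q ! i" x' i])
      (use E gE P(5) Q(5) g(3) that in auto)
  then have "map ((`) g) p = q"
    using p q by (intro nth_equalityI) (auto simp: digraph_arc_def)
  then show "\<exists>f. rel_aut C E f \<and> map f p = q" using rel_aut_image[OF g(1)] by blast
qed

text \<open>The 2-arc consists of a point in the lowest set of the stem and one upper bound for the
  top of each branch. It recovers the vertex where the branches join, then the stem downwards and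
  the branches upwards.\<close>

lemma Y_configuration_approx:
  assumes c: "Y_configuration E x y" and c': "Y_configuration E x' y'"
  obtains g where "aut g" "\<And>i. \<bar>i\<bar> \<le> int n \<Longrightarrow> g ` x i = x' i \<and> g ` y i = y' i"
proof -
  \<comment> \<open>The successor makes \<open>N \<ge> 1\<close>, so that the considered piece
    contains index \<open>- 1\<close>, where the branches differ.\<close>
  define N where "N = Suc n"
  have props: "(z i, z (i + 1)) \<in> E \<and> z i \<in> C \<and> (i \<le> j \<longrightarrow> z j \<subseteq> z i)" if "directed_line E z" for z i j
  proof -
    have e: "(z i, z (i + 1)) \<in> E" for i using that by (simp add: directed_line_def)
    have "z j \<subseteq> z i" if "i \<le> j"
      using that
    proof (induction rule: int_ge_induct)
      case (step k)
      then show ?case using E_psubset[OF e[of k]] by blast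
    qed simp
    then show ?thesis using e E_subset by blast
  qed
  have arc: "\<exists>a b c. b \<in> Y \<and> (b, a) \<in> A \<and> (a, c) \<in> A \<and> b \<noteq> c \<and> a \<in> x (int N) \<and>
      b \<in> pol (x (- int N)) \<and> c \<in> pol (y (- int N)) \<and> pol {b, c} = x 0"
    if c: "Y_configuration E x y" for x y
  proof -
    have lx: "(x i, x (i + 1)) \<in> E" "x i \<in> C" "i \<le> j \<Longrightarrow> x j \<subseteq> x i" for i j
      using c props[of x i j] by (auto simp: Y_configuration_def)
    have ly: "(y i, y (i + 1)) \<in> E" "y i \<in> C" "i \<le> j \<Longrightarrow> y j \<subseteq> y i" for i j
      using c props[of y i j] by (auto simp: Y_configuration_def)
    have xy: "x i = y i \<longleftrightarrow> i \<ge> 0" for i using c by (simp add: Y_configuration_def)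
    have px: "pol (x i) \<subseteq> pol (x j)" if "i \<le> j" for i j using polar_antimono lx(3) that by blast
    have py: "pol (y i) \<subseteq> pol (y j)" if "i \<le> j" for i j using polar_antimono ly(3) that by blast
    have y0: "y 0 = x 0" using xy[of 0] by simp
    have cov: "(x (- 1), x 0) \<in> E" "(y (- 1), x 0) \<in> E" using lx(1)[of "- 1"] ly(1)[of "- 1"] y0 by auto
    have ne: "x (- 1) \<noteq> y (- 1)" using xy[of "- 1"] by simp
    obtain a where a: "a \<in> x (int N)" using closed_point polar_point lx(2) by blast
    obtain b where b: "b \<in> pol (x (- int N))" using closed_point polar_point lx(2) by blast
    obtain c where c: "c \<in> pol (y (- int N))" using closed_point polar_point ly(2) by blast
    have N: "- int N \<le> - 1" "(0::int) \<le> int N" by (auto simp: N_def)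
    have b1: "b \<in> pol (x (- 1))" and c1: "c \<in> pol (y (- 1))" using px py N b c by blast+
    have b0: "b \<in> pol (x 0)" and c0: "c \<in> pol (x 0)" using px[of "- 1" 0] py[of "- 1" 0] b1 c1 y0 by auto
    have a0: "a \<in> x 0" using lx(3)[OF N(2)] a by blast
    have e: "(a, b) \<in> A" "(a, c) \<in> A" "(b, a) \<in> A"
      using edge_A[OF a0 b0] edge_A[OF a0 c0] A_commute[of a b] by auto
    have Y: "b \<in> Y" "c \<in> Y" using closedD(6)[OF lx(2)] b0 c0 by blast+
    have bc: "b \<noteq> c" using cover_up_unique[OF cov b1] c1 ne by blast
    let ?m = "pol {b, c}"
    have m: "?m \<in> C" using meet_closed[OF Y bc e(1,2)] .
    have bm: "b \<in> pol ?m" "c \<in> pol ?m" using polar_polar[of "{b, c}"] by auto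
    have xm: "x 0 \<subseteq> ?m" using subset_polar_iff[of "{b, c}" "x 0"] b0 c0 by blast
    have am: "a \<in> ?m" "a \<in> x (- 1)" "a \<in> y (- 1)" using xm a0 cov E_psubset by blast+
    \<comment> \<open>If \<open>?m\<close> were larger than \<open>x 0\<close>, comparability would
      put both covers \<open>x (- 1)\<close> and \<open>y (- 1)\<close> inside it. Then
      \<open>b\<close> would bound two different covers of \<open>x 0\<close>, against
      \<open>cover_up_unique\<close>.\<close>
    have "?m = x 0 \<or> x (- 1) \<subseteq> ?m"
      using comparable[OF m lx(2) am(1,2) bm(1) b1] cov(1) xm m by (auto simp: cover_edges_def)
    moreover have "?m = x 0 \<or> y (- 1) \<subseteq> ?m"
      using comparable[OF m ly(2) am(1,3) bm(2) c1] cov(2) xm m by (auto simp: cover_edges_def)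
    moreover have "\<not> (x (- 1) \<subseteq> ?m \<and> y (- 1) \<subseteq> ?m)"
      using cover_up_unique[OF cov] polar_antimono[of _ ?m A] bm ne by blast
    ultimately have "?m = x 0" by blast
    then show ?thesis using a b c e Y bc by blast
  qed
  obtain a b d where P: "b \<in> Y" "(b, a) \<in> A" "(a, d) \<in> A" "b \<noteq> d" "a \<in> x (int N)"
      "b \<in> pol (x (- int N))" "d \<in> pol (y (- int N))" "pol {b, d} = x 0"
    using arc[OF c] by blast
  obtain a' b' d' where Q: "b' \<in> Y" "(b', a') \<in> A" "(a', d') \<in> A" "b' \<noteq> d'" "a' \<in> x' (int N)"
      "b' \<in> pol (x' (- int N))" "d' \<in> pol (y' (- int N))" "pol {b', d'} = x' 0"
    using arc[OF c'] by blast
  obtain g where g: "aut g" "g b = b'" "g a = a'" "g d = d'"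
    using transitive_on_arcs[OF P(1-4) Q(1-4)] by blast
  have gE: "(g ` J, g ` K) \<in> E" if "(J, K) \<in> E" for J K
    using rel_aut_image[OF g(1)] that E_subset by (auto simp: rel_iso_def)
  have gpol: "g z \<in> pol (g ` J)" if "J \<in> C" "z \<in> pol J" for J z
    using polar_image[OF g(1), of J] closedD[OF that(1)] that(2) by auto
  have lines: "directed_line E x" "directed_line E y" "directed_line E x'" "directed_line E y'"
    using c c' by (auto simp: Y_configuration_def)
  have xy0: "x i = y i" "x' i = y' i" if "i \<ge> 0" for i
    using c c' that by (auto simp: Y_configuration_def)
  have 0: "g ` x 0 = x' 0"
    using polar_image[OF g(1), of "{b, d}"] P Q g A_V by auto
  have down: "g ` x (int i) = x' (int i)" if "i \<le> N" for i
  proof (rule descending_unique[of N "\<lambda>i. g ` x (int i)" "\<lambda>i. x' (int i)" a'])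
    show "(g ` x (int i), g ` x (int (Suc i))) \<in> E" "(x' (int i), x' (int (Suc i))) \<in> E" for i
      using props[OF lines(1), of "int i"] props[OF lines(3), of "int i"] gE by (auto simp: add.commute)
  qed (use 0 P Q g that in auto)
  have up: "g ` z (- int i) = z' (- int i)"
    if "i \<le> N" and z: "directed_line E z" "directed_line E z'" "g ` z 0 = z' 0"
      "e \<in> pol (z (- int N))" "g e \<in> pol (z' (- int N))" for i z z' e
  proof (rule ascending_unique[of N "\<lambda>i. g ` z (- int i)" "\<lambda>i. z' (- int i)" "g e"])
    show "(g ` z (- int (Suc i)), g ` z (- int i)) \<in> E" "(z' (- int (Suc i)), z' (- int i)) \<in> E" for i
      using props[OF z(1), of "- int (Suc i)"] props[OF z(2), of "- int (Suc i)"] gE by auto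
    show "g e \<in> pol (g ` z (- int N))" using gpol props[OF z(1)] z(4) by blast
  qed (use that in auto)
  have "g ` x i = x' i \<and> g ` y i = y' i" if i: "\<bar>i\<bar> \<le> int n" for i
  proof (cases "i \<ge> 0")
    case True
    then obtain k where "i = int k" by (metis nonneg_int_cases)
    then show ?thesis using down[of k] i xy0[OF True] by (simp add: N_def)
  next
    case False
    then obtain k where k: "i = - int k" by (metis int_cases2 of_nat_0_le_iff)
    then have "k \<le> N" using i by (simp add: N_def)
    then show ?thesis
      using up[OF _ lines(1,3) 0 P(6)] up[OF _ lines(2,4) _ P(7)] Q g 0 xy0[of 0] k by simp
  qed
  then show thesis using that g(1) by blast
qed

lemma Y_transitive_E:
  assumes lf: "locally_finite C E"
  shows "Y_transitive C E"
  unfolding Y_transitive_def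
proof (intro allI impI, elim conjE)
  fix x y x' y' assume c: "Y_configuration E x y" "Y_configuration E x' y'"
  have "\<exists>g. aut g \<and> (\<forall>i. \<bar>i\<bar> \<le> int n \<longrightarrow> g ` x i = x' i \<and> g ` y i = y' i)" for n
    using Y_configuration_approx[OF c, of n] by metis
  then obtain g where g: "\<And>n. aut (g n)"
    "\<And>n i. \<bar>i\<bar> \<le> int n \<Longrightarrow> g n ` x i = x' i \<and> g n ` y i = y' i" by metis
  have xy: "x i \<in> C" "y i \<in> C" for i
    using c(1) E_subset by (auto simp: Y_configuration_def directed_line_def)
  \<comment> \<open>A common value at one vertex is what confines all the approximations to finite
    balls.\<close>
  have "g n ` x 0 = x' 0" for n using g(2)[of 0 n] by simp
  then obtain f where f: "rel_aut C E f"
    "\<And>S m. finite S \<Longrightarrow> S \<subseteq> C \<Longrightarrow> \<exists>n\<ge>m. \<forall>s\<in>S. f s = g n ` s"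
    using automorphism_limit[OF connected_E E_subset lf, of "\<lambda>n. (`) (g n)" "x 0" "x' 0"]
      rel_aut_image[OF g(1)] xy(1)[of 0] by blast
  have "f (x i) = x' i \<and> f (y i) = y' i" for i
  proof -
    obtain n where n: "nat \<bar>i\<bar> \<le> n" "\<forall>s\<in>{x i, y i}. f s = g n ` s"
      using f(2)[of "{x i, y i}" "nat \<bar>i\<bar>"] xy by auto
    then show ?thesis using g(2)[of i n] by simp
  qed
  then show "\<exists>f. rel_aut C E f \<and> (\<forall>i. f (x i) = x' i \<and> f (y i) = y' i)" using f(1) by blast
qed

text \<open>The second half is \<open>Y_transitive_E\<close> for the graph with exchanged parts,
  pulled back along the polarity; local finiteness is transported the other way.\<close>

lemma strongly_transitive_E:
  assumes lf: "locally_finite C E"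
  shows "strongly_transitive C E"
proof -
  interpret d: dense_bipartite Y X A by (rule dense_dual)
  have E': "E\<inverse> \<subseteq> C \<times> C" using E_subset by auto
  have "locally_finite C (E\<inverse>)" using lf by (simp add: locally_finite_def conj_commute)
  then have "locally_finite d.C d.E"
    by (rule locally_finite_transport[OF rel_iso_polar E' d.E_subset])
  then have "Y_transitive C (E\<inverse>)"
    using Y_transitive_transport[OF rel_iso_polar E'] d.Y_transitive_E by blast
  then show ?thesis using Y_transitive_E[OF lf] by (simp add: strongly_transitive_iff)
qed

end

section \<open>From the two-level order to the digraph\<close>

context bipartite
begin

abbreviation "ord \<equiv> P_of X Y A"

lemma in_ord: "(a, b) \<in> ord \<longleftrightarrow> a = b \<and> a \<in> X \<union> Y \<or> a \<in> X \<and> b \<in> Y \<and> (a, b) \<in> A"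
  by (auto simp: P_of_def)

lemma Field_ord: "Field ord = X \<union> Y"
  by (auto simp: Field_def in_ord)

lemma under_ord_X: "x \<in> X \<Longrightarrow> under ord x = {x}"
  using disj by (auto simp: under_def in_ord)

lemma under_ideal: "a \<in> X \<union> Y \<Longrightarrow> under ord a \<in> ideals ord"
proof -
  assume a: "a \<in> X \<union> Y"
  then have aa: "(a, a) \<in> ord" by (simp add: in_ord)
  have "a \<in> Above ord (under ord a)" using a by (simp add: Above_def under_def Field_ord)
  moreover have "under ord a \<subseteq> Under ord (Above ord (under ord a))"
    by (auto simp: Under_def Above_def under_def intro: FieldI1)
  ultimately show ?thesis using aa by (auto simp: ideals_def under_def Under_def)
qed

text \<open>Having two points excludes upper bounds in \<open>X\<close>; a single point would be its
  own upper bound, which \<open>pol\<close> does not see.\<close>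

lemma Above_ord:
  assumes J: "J \<subseteq> X" "two_points J"
  shows "Above ord J = pol J"
proof (intro set_eqI iffI)
  obtain a b where ab: "a \<in> J" "b \<in> J" "a \<noteq> b" using J(2) unfolding two_points_def by blast
  fix u
  {
    assume "u \<in> Above ord J"
    then have u: "\<And>s. s \<in> J \<Longrightarrow> (s, u) \<in> ord" by (simp add: Above_def)
    have "u \<notin> X" using u[OF ab(1)] u[OF ab(2)] ab(3) disj unfolding in_ord by blast
    then have "(s, u) \<in> A" if "s \<in> J" for s
      using u[OF that] J(1) that unfolding in_ord by blast
    then show "u \<in> pol J" by (simp add: polar_def)
  }
  assume "u \<in> pol J"
  then have u: "\<And>s. s \<in> J \<Longrightarrow> (s, u) \<in> A" by (simp add: polar_def)
  have "u \<in> Y" using AXY disj u[OF ab(1)] J(1) ab(1) by blast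
  then have "(s, u) \<in> ord" if "s \<in> J" for s using u[OF that] J(1) that unfolding in_ord by blast
  then show "u \<in> Above ord J" using \<open>u \<in> Y\<close> by (simp add: Above_def Field_ord)
qed

lemma Under_ord:
  assumes T: "T \<subseteq> Y" "two_points T"
  shows "Under ord T = pol T"
proof (intro set_eqI iffI)
  obtain a b where ab: "a \<in> T" "b \<in> T" "a \<noteq> b" using T(2) unfolding two_points_def by blast
  fix u
  {
    assume "u \<in> Under ord T"
    then have u: "\<And>s. s \<in> T \<Longrightarrow> (u, s) \<in> ord" by (simp add: Under_def)
    have "u \<notin> Y" using u[OF ab(1)] u[OF ab(2)] ab(3) disj unfolding in_ord by blast
    then have "(u, s) \<in> A" if "s \<in> T" for s
      using u[OF that] T(1) that unfolding in_ord by blast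
    then show "u \<in> pol T" using A_commute[of u] by (simp add: polar_def)
  }
  assume "u \<in> pol T"
  then have u: "(u, s) \<in> A" if "s \<in> T" for s using A_commute[of s u] that by (simp add: polar_def)
  have "u \<in> X" using AXY disj u[OF ab(1)] T(1) ab(1) by blast
  then have "(u, s) \<in> ord" if "s \<in> T" for s using u[OF that] T(1) that unfolding in_ord by blast
  then show "u \<in> Under ord T" using \<open>u \<in> X\<close> by (simp add: Under_def Field_ord)
qed

text \<open>An ideal with one point is the principal ideal of a lower point, and an ideal with one
  upper bound is the principal ideal of that bound. A member in \<open>Y\<close> would be the only
  upper bound.\<close>

lemma nonprincipal_ideals: "ideals ord - embedded ord = C"
proof (intro set_eqI iffI)
  fix J assume "J \<in> ideals ord - embedded ord"
  then have J: "J \<noteq> {}" "Above ord J \<noteq> {}" "J = Under ord (Above ord J)"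
    and np: "\<And>a. a \<in> X \<union> Y \<Longrightarrow> J \<noteq> under ord a"
    by (auto simp: ideals_def embedded_def Field_ord)
  \<comment> \<open>With \<open>a\<close> as only upper bound, \<open>J\<close> is the set of lower
    bounds of \<open>a\<close> and hence principal.\<close>
  have single: "a \<in> X \<union> Y \<Longrightarrow> Above ord J \<noteq> {a}" for a
    using J(3) np[of a] by (auto simp: Under_def under_def Field_ord in_ord)
  have "J \<subseteq> X \<union> Y" using J(3) by (auto simp: Under_def Field_ord)
  moreover have "J \<inter> Y = {}"
  proof (rule ccontr)
    assume "J \<inter> Y \<noteq> {}"
    then obtain y where y: "y \<in> J" "y \<in> Y" by blast
    then have "Above ord J \<subseteq> {y}" using disj by (auto simp: Above_def in_ord)
    then show False using J(2) single[of y] y by blast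
  qed
  ultimately have JX: "J \<subseteq> X" by blast
  have two: "two_points J"
  proof (rule ccontr)
    assume "\<not> two_points J"
    then obtain x where "J = {x}" using J(1) by (auto simp: two_points_def)
    then show False using np[of x] JX by (simp add: under_ord_X)
  qed
  have pY: "pol J \<subseteq> Y" using polar_subset_Y JX J(1) by blast
  have two': "two_points (pol J)"
  proof (rule ccontr)
    assume "\<not> two_points (pol J)"
    then obtain y where "pol J = {y}" using J(2) Above_ord[OF JX two] by (auto simp: two_points_def)
    then show False using single[of y] Above_ord[OF JX two] pY by auto
  qed
  then have "pol (pol J) = J" using J(3) Above_ord[OF JX two] Under_ord[OF pY two'] by simp
  then show "J \<in> C" using JX two two' by (simp add: closed_sets_def)
next
  fix J assume J: "J \<in> C"
  note D = closedD[OF J]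
  have "J \<in> ideals ord"
    using D Above_ord[OF D(1,3)] Under_ord[OF D(6,4)] by (simp add: ideals_def)
  moreover have "J \<noteq> under ord a" if "a \<in> X \<union> Y" for a
  proof (cases "a \<in> X")
    case True
    then show ?thesis using D(3) under_ord_X[OF True] by (auto simp: two_points_def)
  next
    case False
    then have "a \<in> under ord a" using that by (simp add: under_def in_ord)
    then show ?thesis using False D(1) by blast
  qed
  ultimately show "J \<in> ideals ord - embedded ord" by (auto simp: embedded_def Field_ord)
qed

lemma completion_chain:
  assumes xy: "x \<in> X" "y \<in> Y" "(x, y) \<in> A"
    and f: "rel_iso (completion_interval ord x y)
      (Restr (completion ord) (completion_interval ord x y)) (Field one_Z_one) one_Z_one f"
  shows "\<exists>l :: int \<Rightarrow> 'a set. range l = {J \<in> C. x \<in> J \<and> y \<in> pol J} \<and> (\<forall>i j. l i \<subset> l j \<longleftrightarrow> j < i)"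
proof -
  let ?I = "completion_interval ord x y"
  have ids: "under ord x \<in> ideals ord" "under ord y \<in> ideals ord" using under_ideal xy by auto
  have I: "J \<in> ?I \<longleftrightarrow> J \<in> ideals ord \<and> x \<in> J \<and> J \<subseteq> under ord y" for J
    using ids under_ord_X[OF xy(1)] by (auto simp: completion_interval_def completion_def)
  have xo: "(x, y) \<in> ord" using xy by (simp add: in_ord)
  have ends: "{x} \<in> ?I" "under ord y \<in> ?I"
    using I ids under_ord_X[OF xy(1)] xo by (auto simp: under_def)
  have "Field one_Z_one = UNIV" by (auto simp: one_Z_one_def Field_def)
  then have bij: "bij_betw f ?I UNIV" and ord: "J \<subseteq> K \<longleftrightarrow> f J \<le> f K" if "J \<in> ?I" "K \<in> ?I" for J K
    using f that I by (auto simp: rel_iso_def one_Z_one_def completion_def)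
  have bij: "bij_betw f ?I UNIV" using bij[OF ends] .
  have onto: "\<exists>J\<in>?I. f J = e" for e
  proof -
    have "e \<in> f ` ?I" using bij by (simp add: bij_betw_def)
    then show ?thesis by blast
  qed
  \<comment> \<open>As an order isomorphism, \<open>f\<close> sends the least and the greatest ideal
    of the interval to the two infinities.\<close>
  have fx: "f {x} = -\<infinity>"
  proof -
    obtain J where J: "J \<in> ?I" "f J = -\<infinity>" using onto by blast
    then have "{x} \<subseteq> J" using I[of J] by blast
    then show ?thesis using ord[OF ends(1) J(1)] J(2) by simp
  qed
  have fy: "f (under ord y) = \<infinity>"
  proof -
    obtain J where J: "J \<in> ?I" "f J = \<infinity>" using onto by blast
    then have "J \<subseteq> under ord y" using I[of J] by blast
    then show ?thesis using ord[OF J(1) ends(2)] J(2) by simp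
  qed
  \<comment> \<open>The only principal ideals in the interval are those of \<open>x\<close> and
    \<open>y\<close>, so finite values under \<open>f\<close> single out the members of
    \<open>C\<close>.\<close>
  have inner: "J \<in> C \<and> x \<in> J \<and> y \<in> pol J \<longleftrightarrow> J \<in> ?I \<and> (\<exists>k. f J = Fin k)" for J
  proof
    assume J: "J \<in> C \<and> x \<in> J \<and> y \<in> pol J"
    then have id: "J \<in> ideals ord" "J \<notin> embedded ord" using nonprincipal_ideals by blast+
    have "J \<subseteq> X" using closedD(1) J by blast
    then have "J \<subseteq> under ord y" using J xy(2) by (auto simp: under_def in_ord polar_def)
    then have JI: "J \<in> ?I" using I[of J] J id(1) by blast
    have "J \<noteq> under ord a" if "a \<in> X \<union> Y" for a
      using id(2) that by (auto simp: embedded_def Field_ord)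
    then have ne: "J \<noteq> {x}" "J \<noteq> under ord y" using under_ord_X[OF xy(1)] xy by auto
    have "inj_on f ?I" using bij by (simp add: bij_betw_def)
    then have "f J \<noteq> -\<infinity>" "f J \<noteq> \<infinity>"
      using inj_onD[of f ?I J "{x}"] inj_onD[of f ?I J "under ord y"] JI ends fx fy ne by auto
    then have "\<exists>k. f J = Fin k" by (cases "f J") auto
    with JI show "J \<in> ?I \<and> (\<exists>k. f J = Fin k)" by blast
  next
    assume J: "J \<in> ?I \<and> (\<exists>k. f J = Fin k)"
    then have ne: "J \<noteq> {x}" "J \<noteq> under ord y" using fx fy by auto
    have J': "J \<in> ideals ord" "x \<in> J" "J \<subseteq> under ord y" using J I[of J] by blast+
    have "J \<notin> embedded ord"
    proof
      assume "J \<in> embedded ord"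
      then obtain z where z: "z \<in> X \<union> Y" "J = under ord z" by (auto simp: embedded_def Field_ord)
      then have "z \<in> under ord z" by (simp add: under_def in_ord)
      then have "(x, z) \<in> ord" "(z, y) \<in> ord" using J' z(2) by (auto simp: under_def)
      then have "z = x \<or> z = y" using xy disj unfolding in_ord by blast
      then show False using z(2) ne under_ord_X[OF xy(1)] by blast
    qed
    then have "J \<in> C" using J' nonprincipal_ideals by blast
    moreover have "y \<in> pol J"
      unfolding polar_def
    proof (intro CollectI ballI)
      fix s assume "s \<in> J"
      then have "(s, y) \<in> ord" "s \<in> X"
        using J'(3) closedD(1)[OF \<open>J \<in> C\<close>] by (auto simp: under_def)
      then show "(s, y) \<in> A" using xy(2) disj unfolding in_ord by blast
    qed
    ultimately show "J \<in> C \<and> x \<in> J \<and> y \<in> pol J" using J' by blast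
  qed
  \<comment> \<open>The sign turns the increasing order of the integers into a decreasing
    chain.\<close>
  define l where "l = (\<lambda>i. inv_into ?I f (Fin (- i)))"
  have l: "l i \<in> ?I" "f (l i) = Fin (- i)" for i
    using inv_into_into[of "Fin (- i)" f ?I] f_inv_into_f[of "Fin (- i)" f ?I] bij
    by (simp_all add: l_def bij_betw_def)
  have "range l = {J \<in> C. x \<in> J \<and> y \<in> pol J}"
  proof (intro set_eqI iffI)
    fix J assume "J \<in> range l"
    then obtain i where "J = l i" by blast
    then have "J \<in> ?I \<and> (\<exists>k. f J = Fin k)" using l by blast
    then show "J \<in> {J \<in> C. x \<in> J \<and> y \<in> pol J}" using inner[of J] by blast
  next
    fix J assume "J \<in> {J \<in> C. x \<in> J \<and> y \<in> pol J}"
    then obtain k where k: "J \<in> ?I" "f J = Fin k" using inner[of J] by blast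
    then have "f J = f (l (- k))" using l(2) by simp
    then have "J = l (- k)" using bij k(1) l(1) by (meson bij_betw_def inj_onD)
    then show "J \<in> range l" by blast
  qed
  moreover have "l i \<subset> l j \<longleftrightarrow> j < i" for i j
    using ord[OF l(1) l(1)] l(2) by (simp add: less_le_not_le)
  ultimately show ?thesis by blast
qed

end

text \<open>Ramification points are ideals by definition; conversely \<open>ramify\<close> writes
  every nonprincipal ideal as the meet of two upper points.\<close>

lemma (in dense_bipartite) ram_verts_eq: "ram_verts ord = C"
proof (intro set_eqI iffI)
  fix J assume J: "J \<in> ram_verts ord"
  then have "J \<in> ideals ord"
    by (auto simp: ram_verts_def M_plus_def ramification_points_def is_meet_def is_join_def completion_def)
  moreover have "J \<notin> embedded ord" using J by (simp add: ram_verts_def)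
  ultimately show "J \<in> C" using nonprincipal_ideals by blast
next
  fix J assume J: "J \<in> C"
  then obtain y where y: "y \<in> pol J" using polar_point by blast
  then obtain y1 where y1: "y1 \<in> pol J" "y1 \<noteq> y" "pol {y, y1} = J" using ramify[OF J] by blast
  have Y: "y \<in> Y" "y1 \<in> Y" using closedD(6)[OF J] y y1(1) by auto
  have JI: "J \<in> ideals ord" "J \<notin> embedded ord" using J nonprincipal_ideals by blast+
  have "incomparable ord y y1"
    using Y y1(2) disj by (auto simp: incomparable_def Field_ord in_ord)
  moreover have "is_meet (completion ord) (under ord y) (under ord y1) J"
  proof -
    have ids: "under ord y \<in> ideals ord" "under ord y1 \<in> ideals ord" using under_ideal Y by auto
    have "J \<subseteq> under ord z" if "z \<in> pol J" for z
    proof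
      fix s assume "s \<in> J"
      then have "s \<in> X" "z \<in> Y" "(s, z) \<in> A" using closedD(1,6)[OF J] that edge_A by blast+
      then show "s \<in> under ord z" by (simp add: under_def in_ord)
    qed
    then have below: "J \<subseteq> under ord y" "J \<subseteq> under ord y1" using y y1(1) by blast+
    have "Z \<subseteq> J" if Z: "Z \<subseteq> under ord y" "Z \<subseteq> under ord y1" for Z
    proof
      fix z assume "z \<in> Z"
      then have "(z, y) \<in> ord" "(z, y1) \<in> ord" using Z by (auto simp: under_def)
      then have "(y, z) \<in> A" "(y1, z) \<in> A"
        using Y y1(2) disj A_commute[of z y] A_commute[of z y1] unfolding in_ord by blast+
      then have "z \<in> pol {y, y1}" by (simp add: polar_def)
      then show "z \<in> J" using y1(3) by simp
    qed
    then show ?thesis using JI(1) ids below by (simp add: is_meet_def completion_def)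
  qed
  ultimately have "J \<in> ramification_points ord"
    unfolding ramification_points_def by blast
  with JI show "J \<in> ram_verts ord" by (simp add: ram_verts_def M_plus_def)
qed

lemma dense_bipartite_if_interval_type:
  assumes G: "bipartite_graph X Y A" "countable (X \<union> Y)" "connected_on (X \<union> Y) A"
    "locally_arc_transitive (X \<union> Y) A 2" and I: "has_interval_type (P_of X Y A) one_Z_one"
  shows "dense_bipartite X Y A"
proof -
  interpret bipartite X Y A using G(1) by unfold_locales (auto simp: bipartite_graph_def)
  show ?thesis
  proof
    show "A \<noteq> {}" using I by (auto simp: has_interval_type_def P_of_def)
    fix x y assume xy: "x \<in> X" "y \<in> Y" "(x, y) \<in> A"
    then have "(x, y) \<in> ord" "x \<noteq> y" using disj by (auto simp: in_ord)
    then show "\<exists>l :: int \<Rightarrow> 'a set. range l = {J \<in> C. x \<in> J \<and> y \<in> pol J} \<and> (\<forall>i j. l i \<subset> l j \<longleftrightarrow> j < i)"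
      using completion_chain[OF xy] I unfolding has_interval_type_def by blast
  qed (use G in auto)
qed

theorem theorem3p15:
  shows
    "(\<forall>(V :: 'a set) E.
        is_digraph V E \<and> connected_on V E \<and> highly_arc_transitive V E \<and>
        locally_tree_like V E \<and> intersection_property V E \<and> strongly_transitive V E \<longrightarrow>
        (\<exists>M :: nat rel.
           countable (Field M) \<and> two_level M \<and> connected_poset M \<and> three_CS_homogeneous M \<and>
           (\<exists>f. rel_iso (ram_verts M) (ram_edges M) V E f))) \<and>
     (\<forall>(X :: 'b set) Y A M.
        bipartite_graph X Y A \<and> countable (X \<union> Y) \<and> connected_on (X \<union> Y) A \<and>
        locally_arc_transitive (X \<union> Y) A 2 \<and> M = P_of X Y A \<and>
        has_interval_type M one_Z_one \<longrightarrow>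
        is_digraph (ram_verts M) (ram_edges M) \<and>
        connected_on (ram_verts M) (ram_edges M) \<and>
        highly_arc_transitive (ram_verts M) (ram_edges M) \<and>
        locally_tree_like (ram_verts M) (ram_edges M) \<and>
        intersection_property (ram_verts M) (ram_edges M) \<and>
        (locally_finite (ram_verts M) (ram_edges M) \<longrightarrow>
           strongly_transitive (ram_verts M) (ram_edges M)))"
proof (intro conjI allI impI)
  fix V :: "'a set" and E
  assume "is_digraph V E \<and> connected_on V E \<and> highly_arc_transitive V E \<and>
        locally_tree_like V E \<and> intersection_property V E \<and> strongly_transitive V E"
  then obtain M :: "nat rel" and f where "two_level M" "connected_poset M" "three_CS_homogeneous M"
    "rel_iso (ram_verts M) (ram_edges M) V E f"
    using two_level_order_of_digraph by metis
  then show "\<exists>M :: nat rel.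
           countable (Field M) \<and> two_level M \<and> connected_poset M \<and> three_CS_homogeneous M \<and>
           (\<exists>f. rel_iso (ram_verts M) (ram_edges M) V E f)"
    by (intro exI[of _ M] conjI exI[of _ f]) simp_all
next
  fix X Y :: "'b set" and A M
  assume a: "bipartite_graph X Y A \<and> countable (X \<union> Y) \<and> connected_on (X \<union> Y) A \<and>
        locally_arc_transitive (X \<union> Y) A 2 \<and> M = P_of X Y A \<and>
        has_interval_type M one_Z_one"
  then have M: "M = P_of X Y A" by blast
  interpret dense_bipartite X Y A
    by (rule dense_bipartite_if_interval_type) (use a in \<open>simp_all add: M\<close>)
  have verts: "ram_verts M = C" by (simp only: M ram_verts_eq)
  have edges: "ram_edges M = E" by (simp add: ram_edges_def cover_edges_def verts)
  show "is_digraph (ram_verts M) (ram_edges M)"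
    "connected_on (ram_verts M) (ram_edges M)"
    "highly_arc_transitive (ram_verts M) (ram_edges M)"
    "locally_tree_like (ram_verts M) (ram_edges M)"
    "intersection_property (ram_verts M) (ram_edges M)"
    "locally_finite (ram_verts M) (ram_edges M) \<Longrightarrow>
      strongly_transitive (ram_verts M) (ram_edges M)"
    unfolding verts edges
    by (simp_all add: is_digraph_E connected_E highly_arc_transitive_E locally_tree_like_E
        intersection_property_E strongly_transitive_E)
qed

end
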